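(* Let $M$ be a smooth $7$-manifold and let $\lambda$ be a real constant. Let $\pi:X\to M$ be the bundle of pairs $(s,b)$ with $s\in\Lambda^3_+(T^*_mM)$ and $b\in\Lambda^2(T^*_mM)$, $m\in M$, and let $\mathcal{I}_\lambda$ be the exterior differential system on $X$ generated by $\Upsilon_3,\Upsilon_4,\Upsilon_5,\Upsilon_6$, with independence condition $\omega$ (all defined in the context). Let $\mathsf{z}$ be the $1$-form on $X$ whose value at $(s,b)$ is $\pi^*\bigl({\ast_s}(b\wedge{\ast_s}s)\bigr)$, and consider the augmented differential ideal generated by $\mathcal{I}_\lambda$ and the closed $2$-form $d\mathsf{z}$. Then the augmented differential ideal does not have any admissible integral elements at any $(s,b)\in X$ for which the $6$-form $\bigl({\ast_s}(b\wedge{\ast_s}s)\bigr)\wedge b\wedge s$ is nonzero. Hence the augmented ideal is not involutive.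
   Context: **$\mathrm{G}_2$-structures.** A $3$-form $s\in\Lambda^3(T_m^*M)$ on a $7$-manifold $M$ is definite if $(v\lrcorner s)\wedge(v\lrcorner s)\wedge s\neq0$ for every nonzero $v\in T_mM$; here $v\lrcorner$ is interior product. The open subset of definite $3$-forms is $\Lambda^3_+(T^*M)\subset\Lambda^3(T^*M)$. A definite $s$ determines a unique inner product $g_s$ and orientation, with Hodge star $\ast_s$, such that $(v\lrcorner s)\wedge(w\lrcorner s)\wedge s=6\,\langle v,w\rangle_{g_s}\,{\ast_s}1$ for all $v,w\in T_mM$. **The space $X$ and tautological forms.** $X\subset\Lambda^3(T^*M)\oplus\Lambda^2(T^*M)$ is the open set of pairs $(s,b)$ with $s\in\Lambda^3_+(T_m^*M)$, $b\in\Lambda^2(T^*_mM)$ for some $m\in M$; $\pi:X\to M$, $\pi(s,b)=m$. On $X$ define the smooth forms whose values at $(s,b)$ are $\mathsf{s}=\pi^*(s)$ (a $3$-form), $\mathsf{b}=\pi^*(b)$ (a $2$-form), $\mathsf{t}=\pi^*(\ast_s s)$ (a $4$-form), $\mathsf{p}=\pi^*(\ast_s b)$ (a $5$-form), $\omega=\pi^*(\ast_s 1)$ (a $7$-form). **The ideal $\mathcal{I}_\lambda$.** Put $\Upsilon_3=d\mathsf{b}-\lambda\,\mathsf{s}$, $\Upsilon_4=d\mathsf{s}$, $\Upsilon_5=d\mathsf{t}+\tfrac23\mathsf{p}-\tfrac13\mathsf{b}\wedge\mathsf{s}$, $\Upsilon_6=d\mathsf{p}$. $\mathcal{I}_\lambda$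 is the algebraic ideal in $\Omega^*(X)$ generated by $\Upsilon_3,\dots,\Upsilon_6$; it is closed under $d$. **Integral elements.** For a differential ideal $\mathcal{I}$ on $X$, a subspace $E\subset T_xX$ is an integral element if every form in $\mathcal{I}$ vanishes on $E$. A $7$-dimensional integral element $E$ is admissible if $\omega|_E\neq0$. Involutivity (in Cartan's sense) of $\mathcal{I}$ with independence condition $\omega$ on $X$ requires in particular that admissible integral elements exist at every point of $X$. *)

theory Defs
  imports "HOL-Analysis.Analysis"
begin

section \<open>Exterior algebra of a vector space\<close>

text \<open>
  An element of the exterior algebra of the dual of \<open>'a\<close>, possibly of mixed degree, is a function on
  lists of vectors: its component of degree \<open>k\<close> is its restriction to the lists of length \<open>k\<close>.
\<close>

type_synonym 'a form = "'a list \<Rightarrow> real"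

definition alternating :: "'a::real_vector form \<Rightarrow> bool" where
  "alternating \<alpha> \<longleftrightarrow>
     (\<forall>vs. \<forall>i<length vs. linear (\<lambda>v. \<alpha> (vs[i := v]))) \<and>
     (\<forall>vs. \<not> distinct vs \<longrightarrow> \<alpha> vs = 0)"

definition Alt :: "nat \<Rightarrow> 'a::real_vector form set" where
  "Alt k = {\<alpha>. alternating \<alpha> \<and> (\<forall>vs. length vs \<noteq> k \<longrightarrow> \<alpha> vs = 0)}"

definition zero_form :: "'a form" where
  "zero_form = (\<lambda>vs. 0)"

definition unit_form :: "'a form" where
  "unit_form = (\<lambda>vs. if vs = [] then 1 else 0)"

text \<open>
  The wedge product is the signed sum over shuffles, so that for covectors \<open>\<alpha>\<close>, \<open>\<beta>\<close> one has
  \<open>(\<alpha> \<and>\<^sub>f \<beta>) [v, w] = \<alpha> [v] * \<beta> [w] - \<alpha> [w] * \<beta> [v]\<close>, without factorial factors.  The set \<open>S\<close> holds the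
  positions of the arguments of \<open>\<alpha>\<close>; the exponent counts the inversions of the shuffle.
\<close>

definition wedge :: "'a form \<Rightarrow> 'a form \<Rightarrow> 'a form" (infixl "\<and>\<^sub>f" 70) where
  "\<alpha> \<and>\<^sub>f \<beta> = (\<lambda>vs. \<Sum>S\<in>Pow {..<length vs}.
      (-1) ^ card {(i, j). i \<in> S \<and> j \<in> {..<length vs} - S \<and> j < i}
      * \<alpha> (nths vs S) * \<beta> (nths vs ({..<length vs} - S)))"

definition interior_product :: "'a \<Rightarrow> 'a form \<Rightarrow> 'a form" (infixr "\<lrcorner>" 75) where
  "v \<lrcorner> \<alpha> = (\<lambda>vs. \<alpha> (v # vs))"

definition pull :: "('a \<Rightarrow> 'b) \<Rightarrow> 'b form \<Rightarrow> 'a form" where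
  "pull L \<alpha> = (\<lambda>vs. \<alpha> (map L vs))"

section \<open>Definite three-forms and the structure they determine\<close>

definition inner_product_on :: "('a::euclidean_space \<Rightarrow> 'a \<Rightarrow> real) \<Rightarrow> bool" where
  "inner_product_on g \<longleftrightarrow> bilinear g \<and> (\<forall>v w. g v w = g w v) \<and> (\<forall>v. v \<noteq> 0 \<longrightarrow> g v v > 0)"

definition orthonormal_basis :: "('a::euclidean_space \<Rightarrow> 'a \<Rightarrow> real) \<Rightarrow> 'a list \<Rightarrow> bool" where
  "orthonormal_basis g es \<longleftrightarrow> length es = DIM('a) \<and>
     (\<forall>i<length es. \<forall>j<length es. g (es ! i) (es ! j) = (if i = j then 1 else 0))"

text \<open>
  The volume forms of the inner product \<open>g\<close> for its two orientations; choosing an orientation is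
  choosing one of them.
\<close>

definition volume_form_of :: "('a::euclidean_space \<Rightarrow> 'a \<Rightarrow> real) \<Rightarrow> 'a form \<Rightarrow> bool" where
  "volume_form_of g vol \<longleftrightarrow> vol \<in> Alt DIM('a) \<and>
     (\<forall>es. orthonormal_basis g es \<longrightarrow> \<bar>vol es\<bar> = 1)"

text \<open>
  The Hodge star by contraction with the volume form: the classical index formula
  \<open>(*\<beta>)\<^sub>J = (1 / k!) \<beta>\<^sub>I vol\<^sub>I\<^sub>J\<close> in an orthonormal frame, summed over increasing \<open>I\<close> only.  It satisfies
  \<open>\<alpha> \<and>\<^sub>f *\<beta> = \<langle>\<alpha>, \<beta>\<rangle> vol\<close> for \<open>\<alpha>\<close>, \<open>\<beta>\<close> of equal degree and does not depend on the frame chosen.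
\<close>

definition hodge_star ::
  "('a::euclidean_space \<Rightarrow> 'a \<Rightarrow> real) \<Rightarrow> 'a form \<Rightarrow> 'a form \<Rightarrow> 'a form" where
  "hodge_star g vol \<beta> = (let es = (SOME es. orthonormal_basis g es) in
     (\<lambda>ws. \<Sum>S\<in>Pow {..<DIM('a)}. \<beta> (nths es S) * vol (nths es S @ ws)))"

type_synonym V7 = "real^7"

definition definite3 :: "V7 form set" where
  "definite3 = {s \<in> Alt 3. \<forall>v. v \<noteq> 0 \<longrightarrow> (v \<lrcorner> s) \<and>\<^sub>f (v \<lrcorner> s) \<and>\<^sub>f s \<noteq> zero_form}"

definition g2_metric_volume :: "V7 form \<Rightarrow> (V7 \<Rightarrow> V7 \<Rightarrow> real) \<times> V7 form" where
  "g2_metric_volume s = (THE (g, vol). inner_product_on g \<and> volume_form_of g vol \<and>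
     (\<forall>v w. (v \<lrcorner> s) \<and>\<^sub>f (w \<lrcorner> s) \<and>\<^sub>f s = (\<lambda>vs. 6 * g v w * vol vs)))"

definition star :: "V7 form \<Rightarrow> V7 form \<Rightarrow> V7 form" where
  "star s = hodge_star (fst (g2_metric_volume s)) (snd (g2_metric_volume s))"

definition zform :: "V7 form \<Rightarrow> V7 form \<Rightarrow> V7 form" where
  "zform s b = star s (b \<and>\<^sub>f star s s)"

section \<open>Smooth manifolds\<close>

text \<open>For an open set \<open>S\<close>, \<open>C_on k f S\<close> says that \<open>f\<close> is \<open>k\<close> times continuously differentiable on \<open>S\<close>.\<close>

fun C_on :: "nat \<Rightarrow> ('a::euclidean_space \<Rightarrow> 'b::real_normed_vector) \<Rightarrow> 'a set \<Rightarrow> bool" where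
  "C_on 0 f S \<longleftrightarrow> continuous_on S f"
| "C_on (Suc k) f S \<longleftrightarrow> f differentiable_on S \<and>
     (\<forall>v. C_on k (\<lambda>x. frechet_derivative f (at x) v) S)"

definition smooth_on :: "'a::euclidean_space set \<Rightarrow> ('a \<Rightarrow> 'b::real_normed_vector) \<Rightarrow> bool" where
  "smooth_on S f \<longleftrightarrow> (\<forall>k. C_on k f S)"

type_synonym ('p, 'e) chart = "'p set \<times> ('p \<Rightarrow> 'e)"

abbreviation chart_dom :: "('p, 'e) chart \<Rightarrow> 'p set" where
  "chart_dom c \<equiv> fst c"

abbreviation chart_map :: "('p, 'e) chart \<Rightarrow> 'p \<Rightarrow> 'e" where
  "chart_map c \<equiv> snd c"

definition chart_image :: "('p, 'e) chart \<Rightarrow> 'e set" where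
  "chart_image c = chart_map c ` chart_dom c"

definition chart_inv :: "('p, 'e) chart \<Rightarrow> 'e \<Rightarrow> 'p" where
  "chart_inv c = inv_into (chart_dom c) (chart_map c)"

definition second_countable :: "'p topology \<Rightarrow> bool" where
  "second_countable T \<longleftrightarrow> (\<exists>B. countable B \<and> (\<forall>U\<in>B. openin T U) \<and>
     (\<forall>U. openin T U \<longrightarrow> (\<exists>C\<subseteq>B. U = \<Union>C)))"

text \<open>The atlas need not be maximal; the dimension is that of the model space \<open>'e\<close>.\<close>

definition smooth_manifold :: "'p topology \<Rightarrow> ('p, 'e::euclidean_space) chart set \<Rightarrow> bool" where
  "smooth_manifold T A \<longleftrightarrow>
     Hausdorff_space T \<and> second_countable T \<and>
     (\<Union>c\<in>A. chart_dom c) = topspace T \<and>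
     (\<forall>c\<in>A. openin T (chart_dom c) \<and> open (chart_image c) \<and>
        homeomorphic_map (subtopology T (chart_dom c)) (top_of_set (chart_image c)) (chart_map c)) \<and>
     (\<forall>c\<in>A. \<forall>c'\<in>A.
        smooth_on (chart_map c ` (chart_dom c \<inter> chart_dom c')) (chart_map c' \<circ> chart_inv c))"

definition carrier :: "('p, 'e) chart set \<Rightarrow> 'p set" where
  "carrier A = (\<Union>c\<in>A. chart_dom c)"

text \<open>
  As every chart around \<open>p\<close> identifies the tangent space at \<open>p\<close> with the model space, the tangent space
  at \<open>p\<close> is taken to be the model space itself, a tangent vector being given by its coordinates in the
  fixed chart \<open>chart_at A p\<close>.  \<open>tangent_of_coords A c p\<close> converts the coordinates of a tangent vector at
  \<open>p\<close> in another chart \<open>c\<close> into this representation.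
\<close>

definition chart_at :: "('p, 'e) chart set \<Rightarrow> 'p \<Rightarrow> ('p, 'e) chart" where
  "chart_at A p = (SOME c. c \<in> A \<and> p \<in> chart_dom c)"

definition tangent_of_coords ::
  "('p, 'e::euclidean_space) chart set \<Rightarrow> ('p, 'e) chart \<Rightarrow> 'p \<Rightarrow> 'e \<Rightarrow> 'e" where
  "tangent_of_coords A c p =
     frechet_derivative (chart_map (chart_at A p) \<circ> chart_inv c) (at (chart_map c p))"

definition tangent_map ::
  "('p, 'e::euclidean_space) chart set \<Rightarrow> ('q, 'f::euclidean_space) chart set \<Rightarrow>
   ('p \<Rightarrow> 'q) \<Rightarrow> 'p \<Rightarrow> 'e \<Rightarrow> 'f" where
  "tangent_map A B F p =
     frechet_derivative (chart_map (chart_at B (F p)) \<circ> F \<circ> chart_inv (chart_at A p))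
       (at (chart_map (chart_at A p) p))"

section \<open>Differential forms\<close>

type_synonym ('p, 'e) dform = "'p \<Rightarrow> 'e form"

definition form_in_chart ::
  "('p, 'e::euclidean_space) chart set \<Rightarrow> ('p, 'e) chart \<Rightarrow> ('p, 'e) dform \<Rightarrow> 'e \<Rightarrow> 'e form" where
  "form_in_chart A c \<theta> y = pull (tangent_of_coords A c (chart_inv c y)) (\<theta> (chart_inv c y))"

definition forms :: "('p, 'e::euclidean_space) chart set \<Rightarrow> ('p, 'e) dform set" where
  "forms A = {\<theta>. (\<forall>p\<in>carrier A. alternating (\<theta> p)) \<and> (\<forall>p. p \<notin> carrier A \<longrightarrow> \<theta> p = zero_form) \<and>
     (\<forall>c\<in>A. \<forall>ws. smooth_on (chart_image c) (\<lambda>y. form_in_chart A c \<theta> y ws))}"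

definition kforms :: "('p, 'e::euclidean_space) chart set \<Rightarrow> nat \<Rightarrow> ('p, 'e) dform set" where
  "kforms A k = {\<theta> \<in> forms A. \<forall>p\<in>carrier A. \<theta> p \<in> Alt k}"

definition dwedge :: "('p, 'e) dform \<Rightarrow> ('p, 'e) dform \<Rightarrow> ('p, 'e) dform" (infixl "\<and>\<^sub>d" 70) where
  "\<alpha> \<and>\<^sub>d \<beta> = (\<lambda>p. \<alpha> p \<and>\<^sub>f \<beta> p)"

text \<open>
  The exterior derivative at \<open>p\<close>, computed in the chart \<open>chart_at A p\<close>.  For a smooth form any other
  chart around \<open>p\<close> gives the same result.
\<close>

definition ext_d ::
  "('p, 'e::euclidean_space) chart set \<Rightarrow> ('p, 'e) dform \<Rightarrow> ('p, 'e) dform" where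
  "ext_d A \<theta> p vs = (if p \<in> carrier A then
     (let c = chart_at A p in \<Sum>i<length vs. (-1) ^ i *
        frechet_derivative (\<lambda>y. form_in_chart A c \<theta> y (take i vs @ drop (Suc i) vs))
          (at (chart_map c p)) (vs ! i))
     else 0)"

section \<open>Exterior differential systems\<close>

inductive_set algebraic_ideal ::
  "('p, 'e::euclidean_space) chart set \<Rightarrow> ('p, 'e) dform set \<Rightarrow> ('p, 'e) dform set"
  for A and G where
  gen: "\<theta> \<in> G \<Longrightarrow> \<theta> \<in> algebraic_ideal A G"
| zero: "(\<lambda>p. zero_form) \<in> algebraic_ideal A G"
| add: "\<theta> \<in> algebraic_ideal A G \<Longrightarrow> \<eta> \<in> algebraic_ideal A G \<Longrightarrow>
    (\<lambda>p vs. \<theta> p vs + \<eta> p vs) \<in> algebraic_ideal A G"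
| left: "\<alpha> \<in> forms A \<Longrightarrow> \<theta> \<in> algebraic_ideal A G \<Longrightarrow> \<alpha> \<and>\<^sub>d \<theta> \<in> algebraic_ideal A G"
| right: "\<alpha> \<in> forms A \<Longrightarrow> \<theta> \<in> algebraic_ideal A G \<Longrightarrow> \<theta> \<and>\<^sub>d \<alpha> \<in> algebraic_ideal A G"

inductive_set differential_ideal ::
  "('p, 'e::euclidean_space) chart set \<Rightarrow> ('p, 'e) dform set \<Rightarrow> ('p, 'e) dform set"
  for A and G where
  gen: "\<theta> \<in> G \<Longrightarrow> \<theta> \<in> differential_ideal A G"
| zero: "(\<lambda>p. zero_form) \<in> differential_ideal A G"
| add: "\<theta> \<in> differential_ideal A G \<Longrightarrow> \<eta> \<in> differential_ideal A G \<Longrightarrow>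
    (\<lambda>p vs. \<theta> p vs + \<eta> p vs) \<in> differential_ideal A G"
| left: "\<alpha> \<in> forms A \<Longrightarrow> \<theta> \<in> differential_ideal A G \<Longrightarrow> \<alpha> \<and>\<^sub>d \<theta> \<in> differential_ideal A G"
| right: "\<alpha> \<in> forms A \<Longrightarrow> \<theta> \<in> differential_ideal A G \<Longrightarrow> \<theta> \<and>\<^sub>d \<alpha> \<in> differential_ideal A G"
| closed: "\<theta> \<in> differential_ideal A G \<Longrightarrow> ext_d A \<theta> \<in> differential_ideal A G"

definition integral_element ::
  "('p, 'e::euclidean_space) chart set \<Rightarrow> ('p, 'e) dform set \<Rightarrow> 'p \<Rightarrow> 'e set \<Rightarrow> bool" where
  "integral_element A I x E \<longleftrightarrow> x \<in> carrier A \<and> subspace E \<and>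
     (\<forall>\<theta>\<in>I. \<forall>vs. set vs \<subseteq> E \<longrightarrow> \<theta> x vs = 0)"

definition admissible ::
  "('p, 'e::euclidean_space) chart set \<Rightarrow> ('p, 'e) dform set \<Rightarrow> ('p, 'e) dform \<Rightarrow> nat \<Rightarrow>
   'p \<Rightarrow> 'e set \<Rightarrow> bool" where
  "admissible A I \<omega> n x E \<longleftrightarrow> integral_element A I x E \<and> dim E = n \<and>
     (\<exists>vs. set vs \<subseteq> E \<and> \<omega> x vs \<noteq> 0)"

subsection \<open>Involutivity\<close>

text \<open>
  Cartan's notions in the form given to them by Bryant, Chern, Gardner, Goldschmidt and Griffiths
  (Exterior Differential Systems, Chapter III).  An element of the Grassmann bundle is represented by a
  frame spanning it, that is, by a list of linearly independent tangent vectors.  A function on the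
  Grassmann bundle is pulled back to the bundle of frames, which is a submersion over it; this affects
  neither the independence of differentials nor local statements about zero sets.  Everything is
  expressed in the chart \<open>chart_at A x\<close>, by coordinates \<open>y\<close> of a base point and \<open>ws\<close> of a frame.
\<close>

definition frame_near ::
  "('p, 'e::euclidean_space) chart set \<Rightarrow> real \<Rightarrow> 'p \<Rightarrow> 'e list \<Rightarrow> 'e \<Rightarrow> 'e list \<Rightarrow> bool" where
  "frame_near A \<epsilon> x vs y ws \<longleftrightarrow>
     y \<in> chart_image (chart_at A x) \<and> dist y (chart_map (chart_at A x) x) < \<epsilon> \<and>
     length ws = length vs \<and> (\<forall>j<length vs. dist (ws ! j) (vs ! j) < \<epsilon>)"

text \<open>
  The function \<open>\<phi> / \<Omega>\<close> on the planes on which the form \<open>\<Omega>\<close> of top degree does not vanish, and the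
  linear independence at \<open>(y, ws)\<close> of the differentials of such functions, tested on the directions
  \<open>(\<eta>, \<zeta>s)\<close>.
\<close>

definition form_quotient ::
  "('p, 'e::euclidean_space) chart set \<Rightarrow> 'p \<Rightarrow> ('p, 'e) dform \<Rightarrow> ('p, 'e) dform \<Rightarrow>
   'e \<Rightarrow> 'e list \<Rightarrow> real" where
  "form_quotient A x \<Omega> \<phi> y ws =
     form_in_chart A (chart_at A x) \<phi> y ws / form_in_chart A (chart_at A x) \<Omega> y ws"

definition independent_differentials ::
  "('e::euclidean_space \<Rightarrow> 'e list \<Rightarrow> real) list \<Rightarrow> 'e \<Rightarrow> 'e list \<Rightarrow> bool" where
  "independent_differentials fs y ws \<longleftrightarrow>
     (\<forall>a :: nat \<Rightarrow> real.
        (\<forall>\<eta> \<zeta>s. length \<zeta>s = length ws \<longrightarrow>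
          (\<Sum>i<length fs. a i *
             deriv (\<lambda>t. (fs ! i) (y + t *\<^sub>R \<eta>) (map2 (\<lambda>w \<zeta>. w + t *\<^sub>R \<zeta>) ws \<zeta>s)) 0) = 0)
        \<longrightarrow> (\<forall>i<length fs. a i = 0))"

text \<open>
  The integral element is an ordinary zero of the functions \<open>\<phi> / \<Omega>\<close> with \<open>\<phi>\<close> in the ideal.  For the
  empty frame this says that \<open>x\<close> is an ordinary zero of the functions in the ideal.
\<close>

definition kaehler_ordinary ::
  "('p, 'e::euclidean_space) chart set \<Rightarrow> ('p, 'e) dform set \<Rightarrow> 'p \<Rightarrow> 'e list \<Rightarrow> bool" where
  "kaehler_ordinary A I x vs \<longleftrightarrow> integral_element A I x (span (set vs)) \<and>
     (\<exists>\<Omega>\<in>kforms A (length vs). \<exists>\<beta>s. \<exists>\<epsilon>>0.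
        \<Omega> x vs \<noteq> 0 \<and> set \<beta>s \<subseteq> I \<inter> kforms A (length vs) \<and>
        (\<forall>y ws. frame_near A \<epsilon> x vs y ws \<longrightarrow>
           form_in_chart A (chart_at A x) \<Omega> y ws \<noteq> 0 \<and>
           independent_differentials (map (form_quotient A x \<Omega>) \<beta>s) y ws \<and>
           ((\<forall>\<phi>\<in>I \<inter> kforms A (length vs). form_quotient A x \<Omega> \<phi> y ws = 0) \<longleftrightarrow>
            (\<forall>\<phi>\<in>set \<beta>s. form_quotient A x \<Omega> \<phi> y ws = 0))))"

definition polar_space ::
  "('p, 'e::euclidean_space) chart set \<Rightarrow> ('p, 'e) dform set \<Rightarrow> 'p \<Rightarrow> 'e \<Rightarrow> 'e list \<Rightarrow> 'e set" where
  "polar_space A I x y ws =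
     {w. \<forall>\<phi>\<in>I \<inter> kforms A (Suc (length ws)). form_in_chart A (chart_at A x) \<phi> y (w # ws) = 0}"

definition kaehler_regular ::
  "('p, 'e::euclidean_space) chart set \<Rightarrow> ('p, 'e) dform set \<Rightarrow> 'p \<Rightarrow> 'e list \<Rightarrow> bool" where
  "kaehler_regular A I x vs \<longleftrightarrow> kaehler_ordinary A I x vs \<and>
     (\<exists>\<epsilon>>0. \<forall>y ws. frame_near A \<epsilon> x vs y ws \<longrightarrow>
        (\<forall>\<phi>\<in>I. \<forall>us. set us \<subseteq> span (set ws) \<longrightarrow> form_in_chart A (chart_at A x) \<phi> y us = 0) \<longrightarrow>
        dim (polar_space A I x y ws) = dim (polar_space A I x (chart_map (chart_at A x) x) vs))"

text \<open>
  A flag \<open>E\<^sub>0 \<subset> E\<^sub>1 \<subset> \<dots> \<subset> E\<^sub>n = E\<close> is given by a basis \<open>vs\<close> of \<open>E\<close> adapted to it: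
  \<open>E\<^sub>k\<close> is spanned by the first \<open>k\<close> elements of \<open>vs\<close>.
\<close>

definition ordinary_element ::
  "('p, 'e::euclidean_space) chart set \<Rightarrow> ('p, 'e) dform set \<Rightarrow> 'p \<Rightarrow> 'e set \<Rightarrow> bool" where
  "ordinary_element A I x E \<longleftrightarrow> integral_element A I x E \<and>
     (\<exists>vs. distinct vs \<and> independent (set vs) \<and> span (set vs) = E \<and>
        (\<forall>k<length vs. kaehler_regular A I x (take k vs)))"

definition involutive ::
  "('p, 'e::euclidean_space) chart set \<Rightarrow> ('p, 'e) dform set \<Rightarrow> ('p, 'e) dform \<Rightarrow> nat \<Rightarrow> bool" where
  "involutive A I \<omega> n \<longleftrightarrow>
     (\<forall>x\<in>carrier A. \<exists>E. admissible A I \<omega> n x E \<and> ordinary_element A I x E)"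

section \<open>The bundle of pairs and its tautological forms\<close>

typedef idx3 = "{I :: 7 set. card I = 3}"
  by (rule exI[of _ "{0, 1, 2}"]) simp

typedef idx2 = "{I :: 7 set. card I = 2}"
  by (rule exI[of _ "{0, 1}"]) simp

instance idx3 :: finite
proof
  have "inj Rep_idx3" by (simp add: inj_def Rep_idx3_inject)
  then show "finite (UNIV :: idx3 set)" by (rule finite_imageD[rotated]) simp
qed

instance idx2 :: finite
proof
  have "inj Rep_idx2" by (simp add: inj_def Rep_idx2_inject)
  then show "finite (UNIV :: idx2 set)" by (rule finite_imageD[rotated]) simp
qed

definition basis_vectors :: "7 set \<Rightarrow> V7 list" where
  "basis_vectors I = map (\<lambda>i. axis i 1) (sorted_list_of_set I)"

type_synonym 'm point = "'m \<times> V7 form \<times> V7 form"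

type_synonym coords = "V7 \<times> (real^idx3) \<times> (real^idx2)"

abbreviation base :: "'m point \<Rightarrow> 'm" where
  "base \<equiv> fst"

definition X_space :: "('m, V7) chart set \<Rightarrow> 'm point set" where
  "X_space A = {(m, s, b). m \<in> carrier A \<and> s \<in> definite3 \<and> b \<in> Alt 2}"

text \<open>
  A chart \<open>c\<close> of the base induces a chart of the bundle: the coordinates of the base point together with
  the components of the two forms with respect to the coordinate frame of \<open>c\<close>.
\<close>

definition X_chart :: "('m, V7) chart set \<Rightarrow> ('m, V7) chart \<Rightarrow> ('m point, coords) chart" where
  "X_chart A c =
     ({x \<in> X_space A. base x \<in> chart_dom c},
      \<lambda>(m, s, b). (chart_map c m,
        \<chi> I. pull (tangent_of_coords A c m) s (basis_vectors (Rep_idx3 I)),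
        \<chi> I. pull (tangent_of_coords A c m) b (basis_vectors (Rep_idx2 I))))"

definition X_atlas :: "('m, V7) chart set \<Rightarrow> ('m point, coords) chart set" where
  "X_atlas A = X_chart A ` A"

definition tautological ::
  "('m, V7) chart set \<Rightarrow> (V7 form \<Rightarrow> V7 form \<Rightarrow> V7 form) \<Rightarrow> ('m point, coords) dform" where
  "tautological A F x = (if x \<in> X_space A then
     (case x of (m, s, b) \<Rightarrow> pull (tangent_map (X_atlas A) A base x) (F s b))
     else zero_form)"

definition s_form :: "('m, V7) chart set \<Rightarrow> ('m point, coords) dform" where
  "s_form A = tautological A (\<lambda>s b. s)"

definition b_form :: "('m, V7) chart set \<Rightarrow> ('m point, coords) dform" where
  "b_form A = tautological A (\<lambda>s b. b)"

definition t_form :: "('m, V7) chart set \<Rightarrow> ('m point, coords) dform" where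
  "t_form A = tautological A (\<lambda>s b. star s s)"

definition p_form :: "('m, V7) chart set \<Rightarrow> ('m point, coords) dform" where
  "p_form A = tautological A (\<lambda>s b. star s b)"

definition omega_form :: "('m, V7) chart set \<Rightarrow> ('m point, coords) dform" where
  "omega_form A = tautological A (\<lambda>s b. star s unit_form)"

definition z_form :: "('m, V7) chart set \<Rightarrow> ('m point, coords) dform" where
  "z_form A = tautological A zform"

definition Upsilon3 :: "('m, V7) chart set \<Rightarrow> real \<Rightarrow> ('m point, coords) dform" where
  "Upsilon3 A lam = (\<lambda>x vs. ext_d (X_atlas A) (b_form A) x vs - lam * s_form A x vs)"

definition Upsilon4 :: "('m, V7) chart set \<Rightarrow> ('m point, coords) dform" where
  "Upsilon4 A = ext_d (X_atlas A) (s_form A)"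

definition Upsilon5 :: "('m, V7) chart set \<Rightarrow> ('m point, coords) dform" where
  "Upsilon5 A = (\<lambda>x vs. ext_d (X_atlas A) (t_form A) x vs
     + 2 / 3 * p_form A x vs - 1 / 3 * (b_form A \<and>\<^sub>d s_form A) x vs)"

definition Upsilon6 :: "('m, V7) chart set \<Rightarrow> ('m point, coords) dform" where
  "Upsilon6 A = ext_d (X_atlas A) (p_form A)"

definition I_ideal :: "('m, V7) chart set \<Rightarrow> real \<Rightarrow> ('m point, coords) dform set" where
  "I_ideal A lam =
     algebraic_ideal (X_atlas A) {Upsilon3 A lam, Upsilon4 A, Upsilon5 A, Upsilon6 A}"

definition augmented_ideal :: "('m, V7) chart set \<Rightarrow> real \<Rightarrow> ('m point, coords) dform set" where
  "augmented_ideal A lam =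
     differential_ideal (X_atlas A) (I_ideal A lam \<union> {ext_d (X_atlas A) (z_form A)})"

end

(* On Lambda^2_7 one has b /\ s = 2 * star b, on Lambda^2_14 one has b /\ s = - star b, and the form
   z = star (b /\ star s) is an isomorphism from Lambda^2_7 onto the 1-forms which vanishes on Lambda^2_14;
   together these facts say that star b = z /\ star s - b /\ s for every 2-form b.  On an admissible
   integral element star b is closed (Upsilon_6), b /\ s is closed (Upsilon_3, Upsilon_4 and s /\ s = 0),
   and z is closed.  Hence 0 = d(z /\ star s) = - z /\ d(star s).  By Upsilon_5 and the identity,
   d(star s) = b /\ s - 2/3 z /\ star s, so that z /\ b /\ s = 0.

   The identity is verified in a frame in which s has its standard components.  Such a frame starts with
   three unit vectors on which s is maximal; definiteness then determines all other components.  The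
   star operator depends differentiably on s because the metric is the quotient of the bilinear form
   (v -| s) /\ (w -| s) /\ s by the ninth root of a rational function of s without zeros. *)

theory Submission
  imports Defs
begin

section \<open>Wedge products on lists\<close>

text \<open>\<open>ext_d\<close> is built from Frechet derivatives in charts, while
  \<open>star\<close> is specified through \<open>THE\<close> and \<open>SOME\<close>. To
  differentiate the identity for star b, \<open>star\<close> is first rewritten as an explicit
  expression in s: Cramer's rule inverts the bilinear form, and the condition that the volume form
  has norm 1 fixes the remaining factor. All tautological forms come from operations on (s, b) that
  commute with linear isomorphisms. In a bundle chart they are therefore given by one formula on
  \<open>V7\<close> times the fibre coordinates, the same for every manifold, and d is computed
  there. The relations hold only on arguments from E; this suffices because a wedge product
  evaluates its factors on sublists of its argument list. Since omega does not vanish on E, the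
  projection maps E onto the base tangent space, so a six-form pulled back from the base and
  vanishing on E is zero. Non-involutivity then requires one bad point: a definite form exists, and
  over it b = e^01 + e^23 in an adapted frame makes the six-form nonzero.\<close>

definition hat :: "'a form \<Rightarrow> 'a form" where
  "hat \<alpha> = (\<lambda>vs. (-1) ^ length vs * \<alpha> vs)"

lemma wedge_Nil [simp]: "(\<alpha> \<and>\<^sub>f \<beta>) [] = \<alpha> [] * \<beta> []"
  by (simp add: wedge_def)

lemma nths_Cons_Suc_image: "nths (v # vs) (Suc ` S) = nths vs S"
  by (simp add: nths_Cons inj_image_mem_iff)

lemma nths_Cons_insert_0: "nths (v # vs) (insert 0 (Suc ` S)) = v # nths vs S"
  by (simp add: nths_Cons inj_image_mem_iff)

text \<open>The subsets are split by whether they contain 0. For a shuffle this decides whether the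
  first argument goes to the right factor (first sum) or to the left one (second sum).\<close>

lemma sum_Pow_lessThan_Suc:
  fixes f :: "nat set \<Rightarrow> 'b::comm_monoid_add"
  shows "(\<Sum>S\<in>Pow {..<Suc n}. f S)
     = (\<Sum>S\<in>Pow {..<n}. f (Suc ` S)) + (\<Sum>S\<in>Pow {..<n}. f (insert 0 (Suc ` S)))"
proof -
  let ?P = "(`) Suc ` Pow {..<n}"
  have P: "Pow {..<Suc n} = ?P \<union> insert 0 ` ?P"
    by (simp only: lessThan_Suc_eq_insert_0 Pow_insert image_Pow_surj[OF refl])
  have inj1: "inj_on ((`) Suc) (Pow {..<n})"
    by (rule inj_on_image) auto
  have inj2: "inj_on (\<lambda>S. insert 0 (Suc ` S)) (Pow {..<n})"
  proof (rule inj_onI)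
    fix S S' :: "nat set" assume "insert 0 (Suc ` S) = insert 0 (Suc ` S')"
    then have "Suc ` S = Suc ` S'"
      by (metis Diff_insert_absorb image_iff nat.distinct(1))
    then show "S = S'" by (simp add: inj_image_eq_iff)
  qed
  have "?P \<inter> insert 0 ` ?P = {}" by auto
  then have "sum f (Pow {..<Suc n}) = sum f ?P + sum f (insert 0 ` ?P)"
    unfolding P by (intro sum.union_disjoint) auto
  also have "sum f ?P = (\<Sum>S\<in>Pow {..<n}. f (Suc ` S))"
    by (simp add: sum.reindex[OF inj1])
  also have "sum f (insert 0 ` ?P) = (\<Sum>S\<in>Pow {..<n}. f (insert 0 (Suc ` S)))"
    unfolding image_image using inj2 by (simp add: sum.reindex)
  finally show ?thesis .
qed

lemma lessThan_Suc_minus_Suc_image: "{..<Suc n} - Suc ` S = insert 0 (Suc ` ({..<n} - S))"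
  by (auto simp: lessThan_Suc_eq_insert_0)

lemma lessThan_Suc_minus_insert_0: "{..<Suc n} - insert 0 (Suc ` S) = Suc ` ({..<n} - S)"
  by (auto simp: lessThan_Suc_eq_insert_0)

text \<open>If position 0 goes to the right factor, every element of \<open>S\<close> is inverted
  with it, which adds \<open>card S\<close> inversions and hence the sign that becomes
  \<open>hat\<close> in \<open>wedge_Cons\<close>. If it goes to the left factor, no inversion is
  added.\<close>

lemma card_shuffle_inversions_Suc:
  fixes S :: "nat set"
  assumes "S \<subseteq> {..<n}"
  shows "card {(i, j). i \<in> Suc ` S \<and> j \<in> insert 0 (Suc ` ({..<n} - S)) \<and> j < i}
       = card S + card {(i, j). i \<in> S \<and> j \<in> {..<n} - S \<and> j < i}" (is "card ?L = _ + card ?R")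
    and "card {(i, j). i \<in> insert 0 (Suc ` S) \<and> j \<in> Suc ` ({..<n} - S) \<and> j < i}
       = card {(i, j). i \<in> S \<and> j \<in> {..<n} - S \<and> j < i}" (is "card ?M = _")
proof -
  have fin: "finite S" using assms finite_subset by auto
  have finR: "finite ?R" by (rule finite_subset[of _ "S \<times> {..<n}"]) (use fin in auto)
  have L: "?L = (\<lambda>i. (Suc i, 0)) ` S \<union> map_prod Suc Suc ` ?R" by (auto simp: image_iff)
  have M: "?M = map_prod Suc Suc ` ?R" by (auto simp: image_iff)
  have c: "card (map_prod Suc Suc ` ?R) = card ?R"
    by (rule card_image) (auto simp: inj_on_def)
  have "card ((\<lambda>i. (Suc i, 0::nat)) ` S) = card S"
    by (rule card_image) (auto simp: inj_on_def)
  then show "card ?L = card S + card ?R"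
    unfolding L using c fin finR by (subst card_Un_disjoint) auto
  show "card ?M = card ?R" unfolding M c ..
qed

lemma length_nths_subset: "S \<subseteq> {..<length vs} \<Longrightarrow> length (nths vs S) = card S"
  by (simp add: length_nths) (rule arg_cong[where f = card], auto)

text \<open>This recursion determines the wedge product, so that its algebra follows by induction on lists of
  arguments, without any hypothesis on the forms.\<close>

lemma wedge_Cons:
  "(\<alpha> \<and>\<^sub>f \<beta>) (v # vs) = ((v \<lrcorner> \<alpha>) \<and>\<^sub>f \<beta>) vs + (hat \<alpha> \<and>\<^sub>f (v \<lrcorner> \<beta>)) vs"
  unfolding wedge_def length_Cons sum_Pow_lessThan_Suc
  unfolding lessThan_Suc_minus_Suc_image lessThan_Suc_minus_insert_0
    nths_Cons_Suc_image nths_Cons_insert_0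
  apply (subst add.commute)
  apply (intro arg_cong2[where f = "(+)"] sum.cong refl)
   apply (simp_all only: Pow_iff card_shuffle_inversions_Suc)
  by (simp_all add: hat_def interior_product_def length_nths_subset power_add mult_ac)

lemma interior_wedge:
  "v \<lrcorner> (\<alpha> \<and>\<^sub>f \<beta>) = (\<lambda>vs. ((v \<lrcorner> \<alpha>) \<and>\<^sub>f \<beta>) vs + (hat \<alpha> \<and>\<^sub>f (v \<lrcorner> \<beta>)) vs)"
  by (simp add: fun_eq_iff interior_product_def[of v "\<alpha> \<and>\<^sub>f \<beta>"] wedge_Cons)

lemma wedge_add_left: "((\<lambda>us. \<alpha> us + \<alpha>' us) \<and>\<^sub>f \<beta>) vs = (\<alpha> \<and>\<^sub>f \<beta>) vs + (\<alpha>' \<and>\<^sub>f \<beta>) vs"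
  by (simp add: wedge_def sum.distrib[symmetric] algebra_simps)

lemma wedge_add_right: "(\<beta> \<and>\<^sub>f (\<lambda>us. \<alpha> us + \<alpha>' us)) vs = (\<beta> \<and>\<^sub>f \<alpha>) vs + (\<beta> \<and>\<^sub>f \<alpha>') vs"
  by (simp add: wedge_def sum.distrib[symmetric] algebra_simps)

lemma wedge_scale_left: "((\<lambda>us. c * \<alpha> us) \<and>\<^sub>f \<beta>) vs = c * (\<alpha> \<and>\<^sub>f \<beta>) vs"
  by (simp add: wedge_def sum_distrib_left algebra_simps)

lemma wedge_scale_right: "(\<beta> \<and>\<^sub>f (\<lambda>us. c * \<alpha> us)) vs = c * (\<beta> \<and>\<^sub>f \<alpha>) vs"
  by (simp add: wedge_def sum_distrib_left algebra_simps)

lemma wedge_uminus_left: "((\<lambda>us. - \<alpha> us) \<and>\<^sub>f \<beta>) vs = - (\<alpha> \<and>\<^sub>f \<beta>) vs"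
  using wedge_scale_left[of "-1"] by simp

lemma wedge_uminus_right: "(\<beta> \<and>\<^sub>f (\<lambda>us. - \<alpha> us)) vs = - (\<beta> \<and>\<^sub>f \<alpha>) vs"
  using wedge_scale_right[of _ "-1"] by simp

lemma wedge_diff_right: "(\<beta> \<and>\<^sub>f (\<lambda>us. \<alpha> us - \<alpha>' us)) vs = (\<beta> \<and>\<^sub>f \<alpha>) vs - (\<beta> \<and>\<^sub>f \<alpha>') vs"
  using wedge_add_right[of _ \<alpha> "\<lambda>us. - \<alpha>' us"] by (simp add: wedge_uminus_right)

lemmas wedge_linear = wedge_add_left wedge_add_right wedge_scale_left wedge_scale_right

lemma wedge_linear_fun:
  "(\<lambda>us. \<alpha> us + \<alpha>' us) \<and>\<^sub>f \<beta> = (\<lambda>us. (\<alpha> \<and>\<^sub>f \<beta>) us + (\<alpha>' \<and>\<^sub>f \<beta>) us)"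
  "(\<lambda>us. c * \<alpha> us) \<and>\<^sub>f \<beta> = (\<lambda>us. c * (\<alpha> \<and>\<^sub>f \<beta>) us)"
  by (simp_all add: fun_eq_iff wedge_linear)

lemma wedge_zero_left [simp]: "((\<lambda>us. 0) \<and>\<^sub>f \<beta>) = (\<lambda>us. 0)"
  and wedge_zero_right [simp]: "(\<beta> \<and>\<^sub>f (\<lambda>us. 0)) = (\<lambda>us. 0)"
  by (simp_all add: wedge_def)

lemma hat_hat [simp]: "hat (hat \<alpha>) = \<alpha>"
  by (simp add: hat_def fun_eq_iff flip: power_add mult.assoc)

lemma interior_hat: "v \<lrcorner> hat \<alpha> = (\<lambda>us. - hat (v \<lrcorner> \<alpha>) us)"
  by (simp add: hat_def interior_product_def fun_eq_iff)

text \<open>\<open>hat\<close> is the grading involution, an automorphism of the wedge product. It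
  carries the signs that depend on degrees, so that the antiderivation rules make sense for forms of
  mixed degree.\<close>

lemma hat_wedge: "hat (\<alpha> \<and>\<^sub>f \<beta>) = hat \<alpha> \<and>\<^sub>f hat \<beta>"
proof
  fix vs
  show "hat (\<alpha> \<and>\<^sub>f \<beta>) vs = (hat \<alpha> \<and>\<^sub>f hat \<beta>) vs"
  proof (induction vs arbitrary: \<alpha> \<beta>)
    case Nil
    then show ?case by (simp add: hat_def)
  next
    case (Cons v vs)
    have "hat (\<alpha> \<and>\<^sub>f \<beta>) (v # vs) = - (hat ((v \<lrcorner> \<alpha>) \<and>\<^sub>f \<beta>) vs + hat (hat \<alpha> \<and>\<^sub>f (v \<lrcorner> \<beta>)) vs)"
      by (simp add: hat_def[of "_ \<and>\<^sub>f _"] wedge_Cons algebra_simps)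
    also have "\<dots> = (hat \<alpha> \<and>\<^sub>f hat \<beta>) (v # vs)"
      by (simp add: wedge_Cons interior_hat wedge_uminus_left wedge_uminus_right Cons.IH)
    finally show ?case .
  qed
qed

lemma wedge_assoc: "(\<alpha> \<and>\<^sub>f \<beta>) \<and>\<^sub>f \<gamma> = \<alpha> \<and>\<^sub>f (\<beta> \<and>\<^sub>f \<gamma>)"
proof
  fix vs
  show "((\<alpha> \<and>\<^sub>f \<beta>) \<and>\<^sub>f \<gamma>) vs = (\<alpha> \<and>\<^sub>f (\<beta> \<and>\<^sub>f \<gamma>)) vs"
    by (induction vs arbitrary: \<alpha> \<beta> \<gamma>)
      (simp_all add: wedge_Cons interior_wedge hat_wedge wedge_add_left wedge_add_right)
qed

text \<open>The factor is (-1)^(k l), written through the parities p = (-1)^k and q = (-1)^l. With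
  parities in place of degrees a contraction merely flips a sign, and the induction has no special
  case in degree 0.\<close>

lemma wedge_commute_parity:
  assumes "hat \<alpha> = (\<lambda>us. p * \<alpha> us)" "hat \<beta> = (\<lambda>us. q * \<beta> us)" "p \<in> {1, -1}" "q \<in> {1, -1}"
  shows "(\<alpha> \<and>\<^sub>f \<beta>) vs = (1 + p + q - p * q) / 2 * (\<beta> \<and>\<^sub>f \<alpha>) vs"
  using assms
proof (induction vs arbitrary: \<alpha> \<beta> p q)
  case Nil
  have "\<alpha> [] = p * \<alpha> []" "\<beta> [] = q * \<beta> []"
    using Nil(1,2) by (simp_all add: hat_def fun_eq_iff) (metis list.size(3) mult_1 power_0)+
  then show ?case using Nil(3,4) by auto
next
  case (Cons v vs)
  have par: "hat (v \<lrcorner> \<gamma>) = (\<lambda>us. - r * (v \<lrcorner> \<gamma>) us)" if "hat \<gamma> = (\<lambda>us. r * \<gamma> us)" for \<gamma> r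
    using interior_hat[of v \<gamma>] unfolding that by (simp add: interior_product_def fun_eq_iff)
  have "(v \<lrcorner> \<alpha> \<and>\<^sub>f \<beta>) vs = (1 + - p + q - - p * q) / 2 * (\<beta> \<and>\<^sub>f v \<lrcorner> \<alpha>) vs"
    by (rule Cons.IH) (use Cons.prems par in auto)
  moreover have "(\<alpha> \<and>\<^sub>f v \<lrcorner> \<beta>) vs = (1 + p + - q - p * - q) / 2 * (v \<lrcorner> \<beta> \<and>\<^sub>f \<alpha>) vs"
    by (rule Cons.IH) (use Cons.prems par in auto)
  moreover have "(\<alpha> \<and>\<^sub>f \<beta>) (v # vs) = (v \<lrcorner> \<alpha> \<and>\<^sub>f \<beta>) vs + p * (\<alpha> \<and>\<^sub>f v \<lrcorner> \<beta>) vs"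
    "(\<beta> \<and>\<^sub>f \<alpha>) (v # vs) = (v \<lrcorner> \<beta> \<and>\<^sub>f \<alpha>) vs + q * (\<beta> \<and>\<^sub>f v \<lrcorner> \<alpha>) vs"
    by (simp_all add: wedge_Cons Cons.prems(1,2) wedge_linear)
  ultimately have "(\<alpha> \<and>\<^sub>f \<beta>) (v # vs)
      = (1 + - p + q - - p * q) / 2 * (\<beta> \<and>\<^sub>f v \<lrcorner> \<alpha>) vs
        + p * ((1 + p + - q - p * - q) / 2 * (v \<lrcorner> \<beta> \<and>\<^sub>f \<alpha>) vs)"
    "(\<beta> \<and>\<^sub>f \<alpha>) (v # vs) = (v \<lrcorner> \<beta> \<and>\<^sub>f \<alpha>) vs + q * (\<beta> \<and>\<^sub>f v \<lrcorner> \<alpha>) vs"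
    by (simp_all only:)
  then show ?case using Cons.prems(3,4) by auto
qed

lemma pull_wedge: "pull L (\<alpha> \<and>\<^sub>f \<beta>) = pull L \<alpha> \<and>\<^sub>f pull L \<beta>"
  by (simp add: pull_def wedge_def nths_map)

lemma interior_pull: "v \<lrcorner> pull L \<alpha> = pull L (L v \<lrcorner> \<alpha>)"
  by (simp add: pull_def interior_product_def)

lemma wedge_cong_on:
  assumes "\<And>us. set us \<subseteq> set vs \<Longrightarrow> \<alpha> us = \<alpha>' us" "\<And>us. set us \<subseteq> set vs \<Longrightarrow> \<beta> us = \<beta>' us"
  shows "(\<alpha> \<and>\<^sub>f \<beta>) vs = (\<alpha>' \<and>\<^sub>f \<beta>') vs"
  by (simp add: wedge_def assms set_nths_subset)

section \<open>The exterior derivative as an antiderivation\<close>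

text \<open>Here \<open>A v\<close> plays the role of the derivative of a form in the direction \<open>v\<close>.\<close>

definition antisym_deriv :: "('a \<Rightarrow> 'a form) \<Rightarrow> 'a form" where
  "antisym_deriv A vs = (\<Sum>i<length vs. (-1) ^ i * A (vs ! i) (take i vs @ drop (Suc i) vs))"

lemma antisym_deriv_Nil [simp]: "antisym_deriv A [] = 0"
  by (simp add: antisym_deriv_def)

lemma antisym_deriv_Cons:
  "antisym_deriv A (v # vs) = A v vs - antisym_deriv (\<lambda>w. v \<lrcorner> A w) vs"
  unfolding antisym_deriv_def length_Cons sum.lessThan_Suc_shift
  by (simp add: interior_product_def sum_negf)

lemma antisym_deriv_add:
  "antisym_deriv (\<lambda>v us. A v us + B v us) vs = antisym_deriv A vs + antisym_deriv B vs"
  by (simp add: antisym_deriv_def sum.distrib distrib_left)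

lemma antisym_deriv_diff:
  "antisym_deriv (\<lambda>v us. A v us - B v us) vs = antisym_deriv A vs - antisym_deriv B vs"
  by (simp add: antisym_deriv_def sum_subtractf right_diff_distrib)

lemma interior_antisym_deriv:
  "v \<lrcorner> antisym_deriv A = (\<lambda>us. A v us - antisym_deriv (\<lambda>w. v \<lrcorner> A w) us)"
  by (simp add: interior_product_def[of v "antisym_deriv A"] antisym_deriv_Cons fun_eq_iff)

lemma hat_antisym_deriv: "hat (antisym_deriv A) = (\<lambda>us. - antisym_deriv (\<lambda>v. hat (A v)) us)"
proof
  fix us :: "'a list"
  show "hat (antisym_deriv A) us = - antisym_deriv (\<lambda>v. hat (A v)) us"
    unfolding hat_def antisym_deriv_def sum_distrib_left sum_negf[symmetric]
  proof (rule sum.cong)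
    fix i assume "i \<in> {..<length us}"
    then obtain k where "length us = Suc k" by (cases us) auto
    with \<open>i \<in> _\<close> show "(- 1) ^ length us * ((- 1) ^ i * A (us ! i) (take i us @ drop (Suc i) us)) =
        - ((- 1) ^ i * ((- 1) ^ length (take i us @ drop (Suc i) us)
           * A (us ! i) (take i us @ drop (Suc i) us)))"
      by simp
  qed simp
qed

lemma wedge_diff_left: "((\<lambda>us. \<alpha> us - \<alpha>' us) \<and>\<^sub>f \<beta>) vs = (\<alpha> \<and>\<^sub>f \<beta>) vs - (\<alpha>' \<and>\<^sub>f \<beta>) vs"
  using wedge_add_left[of \<alpha> "\<lambda>us. - \<alpha>' us"] by (simp add: wedge_uminus_left)

lemma antisym_deriv_wedge_left:
  "antisym_deriv (\<lambda>v. A v \<and>\<^sub>f \<beta>) vs = (antisym_deriv A \<and>\<^sub>f \<beta>) vs"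
proof (induction vs arbitrary: A \<beta>)
  case (Cons v vs)
  show ?case
    by (simp add: antisym_deriv_Cons wedge_Cons interior_wedge antisym_deriv_add Cons.IH
        interior_antisym_deriv hat_antisym_deriv wedge_diff_left wedge_uminus_left)
qed simp

text \<open>Together with \<open>antisym_deriv_wedge_left\<close> and the product rule this is the
  Leibniz rule for d. Here the direction of differentiation has to pass the arguments of \<alpha>,
  which produces \<open>hat\<close>.\<close>

lemma antisym_deriv_wedge_right:
  "antisym_deriv (\<lambda>v. \<alpha> \<and>\<^sub>f B v) vs = (hat \<alpha> \<and>\<^sub>f antisym_deriv B) vs"
proof (induction vs arbitrary: \<alpha> B)
  case (Cons v vs)
  show ?case
    by (simp add: antisym_deriv_Cons wedge_Cons interior_wedge antisym_deriv_add Cons.IH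
        interior_antisym_deriv wedge_diff_right interior_hat wedge_uminus_left)
qed simp

section \<open>Alternating forms\<close>

lemma alternating_linear: "alternating \<alpha> \<Longrightarrow> linear (\<lambda>v. \<alpha> (us @ v # vs))"
proof -
  assume "alternating \<alpha>"
  then have "linear (\<lambda>v. \<alpha> ((us @ 0 # vs)[length us := v]))"
    unfolding alternating_def by (metis add_Suc_right length_Cons length_append less_add_Suc1)
  then show ?thesis by simp
qed

lemma alternating_linear_Cons: "alternating \<alpha> \<Longrightarrow> linear (\<lambda>v. \<alpha> (v # vs))"
  using alternating_linear[of \<alpha> "[]"] by simp

text \<open>Stated for two local conditions, linearity in each slot and vanishing on adjacent
  repetitions, because it serves to prove that these conditions already give
  \<open>alternating\<close>.\<close>

lemma alternating_swap:
  assumes lin: "\<And>us vs. linear (\<lambda>v. \<alpha> (us @ v # vs))" and z: "\<And>us v vs. \<alpha> (us @ v # v # vs) = 0"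
  shows "\<alpha> (us @ v # w # vs) = - (\<alpha> (us @ w # v # vs) :: real)"
proof -
  have "0 = \<alpha> (us @ (v + w) # (v + w) # vs)" using z by simp
  also have "\<dots> = \<alpha> (us @ v # (v + w) # vs) + \<alpha> (us @ w # (v + w) # vs)"
    using linear_add[OF lin[of us "(v + w) # vs"]] by simp
  also have "\<dots> = \<alpha> (us @ v # w # vs) + \<alpha> (us @ w # v # vs)"
    using linear_add[OF lin[of "us @ [_]" vs]] z by simp
  finally show ?thesis by simp
qed

lemma alternating_move_front:
  assumes lin: "\<And>us vs. linear (\<lambda>v. \<alpha> (us @ v # vs))" and z: "\<And>us v vs. \<alpha> (us @ v # v # vs) = 0"
  shows "\<alpha> (ws @ us @ v # vs) = (-1) ^ length us * (\<alpha> (ws @ v # us @ vs) :: real)"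
proof (induction us arbitrary: ws)
  case (Cons u us)
  have "\<alpha> (ws @ (u # us) @ v # vs) = (-1) ^ length us * \<alpha> (ws @ u # v # us @ vs)"
    using Cons[of "ws @ [u]"] by simp
  also have "\<alpha> (ws @ u # v # us @ vs) = - \<alpha> (ws @ v # u # us @ vs)"
    by (rule alternating_swap[OF lin z])
  finally show ?case by simp
qed simp

text \<open>Two equal arguments can be made adjacent at the cost of a sign. The right-hand side is
  easier to verify: it is visibly inherited by contractions, pullbacks, sums and forms with some
  arguments fixed.\<close>

lemma alternating_iff:
  "alternating \<alpha> \<longleftrightarrow>
     (\<forall>us vs. linear (\<lambda>v. \<alpha> (us @ v # vs))) \<and> (\<forall>us v vs. \<alpha> (us @ v # v # vs) = 0)"
proof (intro iffI)
  assume a: "alternating \<alpha>"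
  then have "\<alpha> (us @ v # v # vs) = 0" for us v vs
    by (simp add: alternating_def)
  with alternating_linear[OF a]
  show "(\<forall>us vs. linear (\<lambda>v. \<alpha> (us @ v # vs))) \<and> (\<forall>us v vs. \<alpha> (us @ v # v # vs) = 0)"
    by blast
next
  assume a: "(\<forall>us vs. linear (\<lambda>v. \<alpha> (us @ v # vs))) \<and> (\<forall>us v vs. \<alpha> (us @ v # v # vs) = 0)"
  show "alternating \<alpha>"
    unfolding alternating_def
  proof (intro conjI allI impI)
    fix vs :: "'a list" and i assume "i < length vs"
    then show "linear (\<lambda>v. \<alpha> (vs[i := v]))" using a by (simp add: upd_conv_take_nth_drop)
  next
    fix vs :: "'a list" assume "\<not> distinct vs"
    then obtain xs ys zs y where vs: "vs = xs @ [y] @ ys @ [y] @ zs"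
      using not_distinct_decomp by blast
    have "\<alpha> vs = (-1) ^ length ys * \<alpha> ((xs @ [y]) @ y # ys @ zs)"
      unfolding vs using alternating_move_front[of \<alpha> "xs @ [y]" ys y zs] a by simp
    then show "\<alpha> vs = 0" using a by simp
  qed
qed

lemma alternating_repeat: "alternating \<alpha> \<Longrightarrow> \<alpha> (us @ v # v # vs) = 0"
  by (simp add: alternating_iff)

lemma alternating_to_front:
  "alternating \<alpha> \<Longrightarrow> \<alpha> (us @ v # vs) = (-1) ^ length us * \<alpha> (v # us @ vs)"
  using alternating_move_front[of \<alpha> "[]" us v vs] by (auto simp: alternating_iff)

lemma alternating_swap_front: "alternating \<alpha> \<Longrightarrow> \<alpha> (v # w # vs) = - \<alpha> (w # v # vs)"
  using alternating_to_front[of \<alpha> "[v]" w vs] by simp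

lemma alternating_interior: "alternating \<alpha> \<Longrightarrow> alternating (v \<lrcorner> \<alpha>)"
  unfolding alternating_iff interior_product_def by (simp flip: append_Cons)

lemma alternating_pull: "linear L \<Longrightarrow> alternating \<alpha> \<Longrightarrow> alternating (pull L \<alpha>)"
  unfolding alternating_iff pull_def using linear_compose[of L] by (fastforce simp: o_def)

lemma alternating_append: "alternating \<alpha> \<Longrightarrow> alternating (\<lambda>us. \<alpha> (us @ ws))"
  unfolding alternating_iff by simp

lemma alternating_add: "alternating \<alpha> \<Longrightarrow> alternating \<beta> \<Longrightarrow> alternating (\<lambda>us. \<alpha> us + \<beta> us)"
  unfolding alternating_iff by (auto intro!: linear_compose_add)

lemma alternating_scale: "alternating \<alpha> \<Longrightarrow> alternating (\<lambda>us. c * \<alpha> us)"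
  unfolding alternating_iff by (auto simp flip: real_scaleR_def intro!: linear_compose_scale_right)

lemma alternating_sum: "(\<And>i. i \<in> I \<Longrightarrow> alternating (\<alpha> i)) \<Longrightarrow> alternating (\<lambda>us. \<Sum>i\<in>I. \<alpha> i us)"
  unfolding alternating_iff by (auto intro!: linear_compose_sum)

lemma alternating_hat:
  assumes "alternating \<alpha>" shows "alternating (hat \<alpha>)"
  unfolding alternating_iff
proof (intro conjI allI)
  fix us vs :: "'a list" and v
  show "linear (\<lambda>v. hat \<alpha> (us @ v # vs))"
    using alternating_linear[OF alternating_scale[OF assms], of "(-1) ^ Suc (length us + length vs)"]
    by (simp add: hat_def)
  show "hat \<alpha> (us @ v # v # vs) = 0"
    by (simp add: hat_def alternating_repeat[OF assms])
qed

lemma interior_linear_arg: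
  assumes "alternating \<alpha>"
  shows "(v + w) \<lrcorner> \<alpha> = (\<lambda>us. (v \<lrcorner> \<alpha>) us + (w \<lrcorner> \<alpha>) us)"
    "(c *\<^sub>R v) \<lrcorner> \<alpha> = (\<lambda>us. c * (v \<lrcorner> \<alpha>) us)"
  by (simp_all add: interior_product_def linear_add[OF alternating_linear_Cons[OF assms]]
      linear_scale[OF alternating_linear_Cons[OF assms]])

lemma interior_interior_swap: "alternating \<alpha> \<Longrightarrow> v \<lrcorner> w \<lrcorner> \<alpha> = (\<lambda>us. - (w \<lrcorner> v \<lrcorner> \<alpha>) us)"
  using alternating_swap_front by (auto simp: interior_product_def fun_eq_iff)

lemma interior_self: "alternating \<alpha> \<Longrightarrow> v \<lrcorner> v \<lrcorner> \<alpha> = (\<lambda>us. 0)"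
  using alternating_repeat[of \<alpha> "[]"] by (auto simp: interior_product_def fun_eq_iff)

text \<open>The recursion \<open>wedge_Cons\<close> brings the slot in question to the front. There
  the two mixed terms of a double contraction by the same vector cancel, because \<open>hat\<close>
  anticommutes with contraction.\<close>

lemma alternating_wedge:
  assumes "alternating \<alpha>" "alternating \<beta>"
  shows "alternating (\<alpha> \<and>\<^sub>f \<beta>)"
proof -
  have "linear (\<lambda>v. (\<alpha> \<and>\<^sub>f \<beta>) (us @ v # vs))" for us vs
    using assms
  proof (induction us arbitrary: \<alpha> \<beta>)
    case Nil
    show ?case
      by (rule linearI)
        (simp_all add: wedge_Cons interior_linear_arg[OF Nil(1)] interior_linear_arg[OF Nil(2)]
          wedge_linear algebra_simps)
  next
    case (Cons u us)
    show ?case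
      by (simp add: wedge_Cons) (intro linear_compose_add Cons alternating_interior alternating_hat)
  qed
  moreover have "(\<alpha> \<and>\<^sub>f \<beta>) (us @ v # v # vs) = 0" for us v vs
    using assms
  proof (induction us arbitrary: \<alpha> \<beta>)
    case Nil
    then show ?case
      by (simp add: wedge_Cons interior_hat interior_self wedge_uminus_left)
  next
    case (Cons u us)
    show ?case
      using Cons by (simp add: wedge_Cons alternating_interior alternating_hat)
  qed
  ultimately show ?thesis by (simp add: alternating_iff)
qed

lemma Alt_alternating: "\<alpha> \<in> Alt k \<Longrightarrow> alternating \<alpha>"
  and Alt_length: "\<alpha> \<in> Alt k \<Longrightarrow> length vs \<noteq> k \<Longrightarrow> \<alpha> vs = 0"
  by (simp_all add: Alt_def)

lemma wedge_Alt:
  assumes "\<alpha> \<in> Alt k" "\<beta> \<in> Alt l"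
  shows "\<alpha> \<and>\<^sub>f \<beta> \<in> Alt (k + l)"
proof -
  have "(\<alpha> \<and>\<^sub>f \<beta>) vs = 0" if "length vs \<noteq> k + l" for vs
    unfolding wedge_def
  proof (rule sum.neutral, rule ballI)
    fix S assume "S \<in> Pow {..<length vs}"
    then have S: "S \<subseteq> {..<length vs}" by simp
    then have "length (nths vs S) + length (nths vs ({..<length vs} - S)) = length vs"
      by (simp add: length_nths_subset card_Diff_subset finite_subset[OF S] card_mono[OF _ S, simplified])
    then have "length (nths vs S) \<noteq> k \<or> length (nths vs ({..<length vs} - S)) \<noteq> l"
      using that by auto
    then show "(- 1) ^ card {(i, j). i \<in> S \<and> j \<in> {..<length vs} - S \<and> j < i} * \<alpha> (nths vs S) *
         \<beta> (nths vs ({..<length vs} - S)) = 0"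
      using Alt_length[OF assms(1)] Alt_length[OF assms(2)] by auto
  qed
  then show ?thesis using assms alternating_wedge by (auto simp: Alt_def)
qed

lemma interior_Alt: "\<alpha> \<in> Alt (Suc k) \<Longrightarrow> v \<lrcorner> \<alpha> \<in> Alt k"
  using alternating_interior by (auto simp: Alt_def interior_product_def)

lemma interior_Alt_0: "\<alpha> \<in> Alt 0 \<Longrightarrow> v \<lrcorner> \<alpha> = (\<lambda>us. 0)"
  by (auto simp: Alt_def interior_product_def)

lemma Alt_add: "\<alpha> \<in> Alt k \<Longrightarrow> \<beta> \<in> Alt k \<Longrightarrow> (\<lambda>us. \<alpha> us + \<beta> us) \<in> Alt k"
  and Alt_scale: "\<alpha> \<in> Alt k \<Longrightarrow> (\<lambda>us. c * \<alpha> us) \<in> Alt k"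
  by (simp_all add: Alt_def alternating_add alternating_scale)

lemma Alt_sum: "(\<And>i. i \<in> I \<Longrightarrow> \<alpha> i \<in> Alt k) \<Longrightarrow> (\<lambda>us. \<Sum>i\<in>I. \<alpha> i us) \<in> Alt k"
  by (simp add: Alt_def alternating_sum)

lemma hat_Alt: "\<alpha> \<in> Alt k \<Longrightarrow> hat \<alpha> = (\<lambda>us. (-1) ^ k * \<alpha> us)"
  unfolding hat_def fun_eq_iff by (metis Alt_length mult_zero_right)

lemma pull_Alt: "linear L \<Longrightarrow> \<alpha> \<in> Alt k \<Longrightarrow> pull L \<alpha> \<in> Alt k"
  by (simp add: Alt_def alternating_pull) (simp add: pull_def)

lemma wedge_self_odd:
  assumes "\<alpha> \<in> Alt k" "odd k"
  shows "\<alpha> \<and>\<^sub>f \<alpha> = (\<lambda>us. 0)"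
proof
  fix vs
  have "hat \<alpha> = (\<lambda>us. - 1 * \<alpha> us)" using hat_Alt[OF assms(1)] assms(2) by simp
  from wedge_commute_parity[OF this this, of vs] show "(\<alpha> \<and>\<^sub>f \<alpha>) vs = 0" by simp
qed

text \<open>The induction on the list \<open>vs\<close> inside the one on \<open>es\<close> splits off the multiple of \<open>e\<close> in one argument and
  moves it to the front, where \<open>e \<lrcorner> \<alpha>\<close> satisfies the same hypotheses.\<close>

lemma alternating_zero_on_span:
  assumes "alternating \<alpha>" "\<And>S. \<alpha> (nths es S) = 0" "set vs \<subseteq> span (set es)"
  shows "\<alpha> vs = 0"
  using assms
proof (induction es arbitrary: \<alpha> vs)
  case Nil
  show ?case
  proof (cases vs)
    case Nil
    then show ?thesis using Nil.prems(2)[of "{}"] by simp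
  next
    case (Cons v ws)
    then have "v = 0" using Nil.prems(3) by simp
    then show ?thesis
      using linear_0[OF alternating_linear_Cons[OF Nil.prems(1)]] Cons by simp
  qed
next
  case (Cons e es)
  have "\<alpha> (us @ vs) = 0"
    if "alternating \<alpha>" "\<And>S. \<alpha> (nths (e # es) S) = 0" "set us \<subseteq> span (set es)"
       "set vs \<subseteq> span (set (e # es))" for \<alpha> us vs
    using that
  proof (induction "length vs" arbitrary: vs us \<alpha>)
    case 0
    have "\<alpha> (nths es S) = 0" for S
      using 0(3)[of "Suc ` S"] by (simp add: nths_Cons_Suc_image)
    then show ?case using Cons.IH[of \<alpha> us] 0 by simp
  next
    case (Suc n)
    then obtain v ws where vs: "vs = v # ws" by (cases vs) auto
    with Suc.prems(4) obtain c where c: "v - c *\<^sub>R e \<in> span (set es)"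
      using span_breakdown_eq[of v e "set es"] by auto
    have "\<alpha> (us @ vs) = \<alpha> (us @ (v - c *\<^sub>R e) # ws) + c * \<alpha> (us @ e # ws)"
      using linear_add[OF alternating_linear[OF Suc.prems(1)], of us "v - c *\<^sub>R e" "c *\<^sub>R e" ws]
        linear_scale[OF alternating_linear[OF Suc.prems(1)], of us c e ws] vs by simp
    moreover have "\<alpha> ((us @ [v - c *\<^sub>R e]) @ ws) = 0"
      by (rule Suc.hyps(1)) (use vs Suc.hyps(2) Suc.prems c in auto)
    moreover have "(e \<lrcorner> \<alpha>) (us @ ws) = 0"
    proof (rule Suc.hyps(1))
      show "alternating (e \<lrcorner> \<alpha>)" using Suc.prems(1) by (rule alternating_interior)
      show "(e \<lrcorner> \<alpha>) (nths (e # es) S) = 0" for S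
      proof (cases "0 \<in> S")
        case True
        then show ?thesis
          using alternating_repeat[OF Suc.prems(1), of "[]"]
          by (simp add: nths_Cons interior_product_def)
      next
        case False
        then show ?thesis
          using Suc.prems(2)[of "insert 0 S"] by (simp add: nths_Cons interior_product_def)
      qed
    qed (use vs Suc.hyps(2) Suc.prems in auto)
    ultimately show ?case
      using alternating_to_front[OF Suc.prems(1), of us e ws] by (simp add: interior_product_def)
  qed
  from this[of \<alpha> "[]" vs] show ?case using Cons.prems by simp
qed

lemma Alt_eq_on_frame:
  assumes "\<alpha> \<in> Alt k" "\<beta> \<in> Alt k" "span (set es) = UNIV"
    "\<And>S. S \<subseteq> {..<length es} \<Longrightarrow> card S = k \<Longrightarrow> \<alpha> (nths es S) = \<beta> (nths es S)"
  shows "\<alpha> = \<beta>"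
proof
  fix vs
  let ?\<delta> = "\<lambda>us. \<alpha> us + - 1 * \<beta> us"
  have "?\<delta> vs = 0"
  proof (rule alternating_zero_on_span)
    show "alternating ?\<delta>"
      using assms(1,2) by (intro alternating_add alternating_scale) (rule Alt_alternating, assumption)+
    fix S
    \<comment> \<open>\<open>nths\<close> ignores positions beyond the end of the list, so an
      arbitrary \<open>S\<close> may be cut down to genuine positions.\<close>
    have "nths es S = nths es (S \<inter> {..<length es})"
      unfolding nths_def by (intro arg_cong[where f = "map fst"] filter_cong) (auto dest: set_zip_rightD)
    then show "?\<delta> (nths es S) = 0"
      using assms(4)[of "S \<inter> {..<length es}"] Alt_length[OF assms(1), of "nths es S"]
        Alt_length[OF assms(2), of "nths es S"]
      by (cases "card (S \<inter> {..<length es}) = k") (auto simp: length_nths_subset)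
  qed (use assms(3) in auto)
  then show "\<alpha> vs = \<beta> vs" by simp
qed

section \<open>The inner product of forms in a frame\<close>

text \<open>For orthonormal \<open>es\<close> this is the induced inner product of forms, taken over
  all degrees at once; the subsets \<open>S\<close> are the increasing multi-indices.\<close>

definition frame_ip :: "'a list \<Rightarrow> 'a form \<Rightarrow> 'a form \<Rightarrow> real" where
  "frame_ip es \<beta> \<gamma> = (\<Sum>S\<in>Pow {..<length es}. \<beta> (nths es S) * \<gamma> (nths es S))"

lemma frame_ip_Nil [simp]: "frame_ip [] \<beta> \<gamma> = \<beta> [] * \<gamma> []"
  by (simp add: frame_ip_def)

lemma frame_ip_Cons: "frame_ip (e # es) \<beta> \<gamma> = frame_ip es \<beta> \<gamma> + frame_ip es (e \<lrcorner> \<beta>) (e \<lrcorner> \<gamma>)"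
  by (simp add: frame_ip_def sum_Pow_lessThan_Suc nths_Cons_Suc_image nths_Cons_insert_0
      interior_product_def)

lemma frame_ip_zero [simp]: "frame_ip es (\<lambda>us. 0) \<gamma> = 0"
  by (simp add: frame_ip_def)

lemma frame_ip_uminus: "frame_ip es (\<lambda>us. - \<beta> us) (\<lambda>us. - \<gamma> us) = frame_ip es \<beta> \<gamma>"
  by (simp add: frame_ip_def)

text \<open>The number operator: this recursion replaces the sum over increasing index sets by contractions
  with single frame vectors, for which independence of the frame is elementary.\<close>

lemma frame_ip_degree:
  assumes "\<beta> \<in> Alt k" "alternating \<gamma>"
  shows "(\<Sum>e\<leftarrow>es. frame_ip es (e \<lrcorner> \<beta>) (e \<lrcorner> \<gamma>)) = real k * frame_ip es \<beta> \<gamma>"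
  using assms
proof (induction es arbitrary: \<beta> \<gamma> k)
  case Nil
  then show ?case using Alt_length[of \<beta> k "[]"] by auto
next
  case (Cons e es)
  note alt = Alt_alternating[OF Cons.prems(1)] Cons.prems(2)
  have "frame_ip (e # es) (x \<lrcorner> \<beta>) (x \<lrcorner> \<gamma>) = frame_ip es (x \<lrcorner> \<beta>) (x \<lrcorner> \<gamma>)
      + frame_ip es (x \<lrcorner> e \<lrcorner> \<beta>) (x \<lrcorner> e \<lrcorner> \<gamma>)" for x
    using interior_interior_swap[OF alt(1), of e x] interior_interior_swap[OF alt(2), of e x]
    by (simp add: frame_ip_Cons frame_ip_uminus)
  then have *: "(\<Sum>x\<leftarrow>e # es. frame_ip (e # es) (x \<lrcorner> \<beta>) (x \<lrcorner> \<gamma>))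
    = frame_ip es (e \<lrcorner> \<beta>) (e \<lrcorner> \<gamma>) + (\<Sum>x\<leftarrow>es. frame_ip es (x \<lrcorner> \<beta>) (x \<lrcorner> \<gamma>))
      + (\<Sum>x\<leftarrow>es. frame_ip es (x \<lrcorner> e \<lrcorner> \<beta>) (x \<lrcorner> e \<lrcorner> \<gamma>))"
    by (simp add: sum_list_addf interior_self[OF alt(1)])
  show ?case
  proof (cases k)
    case 0
    then show ?thesis
      using interior_Alt_0[of \<beta>] Cons.prems(1) by (simp add: interior_product_def frame_ip_def)
  next
    case (Suc l)
    then have "e \<lrcorner> \<beta> \<in> Alt l" using Cons.prems(1) interior_Alt by blast
    then show ?thesis
      using Cons.IH[OF Cons.prems] Cons.IH[of "e \<lrcorner> \<beta>" l "e \<lrcorner> \<gamma>"] alternating_interior[OF alt(2)] Suc *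
      by (simp add: frame_ip_Cons algebra_simps)
  qed
qed

text \<open>For \<open>G\<close> the inverse matrix of the metric in the standard basis this is the same inner product; unlike
  a frame, \<open>G\<close> depends differentiably on the metric by Cramer's rule.\<close>

fun contraction :: "nat \<Rightarrow> ('a::euclidean_space \<Rightarrow> 'a \<Rightarrow> real) \<Rightarrow> 'a form \<Rightarrow> 'a form \<Rightarrow> real" where
  "contraction 0 G \<beta> \<gamma> = \<beta> [] * \<gamma> []"
| "contraction (Suc k) G \<beta> \<gamma> =
     (\<Sum>i\<in>Basis. \<Sum>j\<in>Basis. G i j * contraction k G (i \<lrcorner> \<beta>) (j \<lrcorner> \<gamma>)) / real (Suc k)"

definition dual_metric :: "'a::euclidean_space list \<Rightarrow> 'a \<Rightarrow> 'a \<Rightarrow> real" where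
  "dual_metric es i j = (\<Sum>e\<leftarrow>es. (e \<bullet> i) * (e \<bullet> j))"

lemma sum_list_bilinear:
  fixes Q :: "'a::euclidean_space \<Rightarrow> 'a \<Rightarrow> real"
  assumes "\<And>w. linear (\<lambda>v. Q v w)" "\<And>v. linear (Q v)"
  shows "(\<Sum>e\<leftarrow>es. Q e e) = (\<Sum>i\<in>Basis. \<Sum>j\<in>Basis. dual_metric es i j * Q i j)"
proof -
  have "Q e e = (\<Sum>i\<in>Basis. \<Sum>j\<in>Basis. (e \<bullet> i) * (e \<bullet> j) * Q i j)" for e
  proof -
    have "Q (\<Sum>i\<in>Basis. (e \<bullet> i) *\<^sub>R i) w = (\<Sum>i\<in>Basis. (e \<bullet> i) * Q i w)" for w
      by (simp only: linear_sum[OF assms(1)] linear_scale[OF assms(1)] real_scaleR_def)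
    moreover have "Q v (\<Sum>i\<in>Basis. (e \<bullet> i) *\<^sub>R i) = (\<Sum>i\<in>Basis. (e \<bullet> i) * Q v i)" for v
      by (simp only: linear_sum[OF assms(2)] linear_scale[OF assms(2)] real_scaleR_def)
    ultimately have 1: "Q e w = (\<Sum>i\<in>Basis. (e \<bullet> i) * Q i w)"
      and 2: "Q v e = (\<Sum>j\<in>Basis. (e \<bullet> j) * Q v j)" for v w
      by (simp_all only: euclidean_representation)
    show ?thesis
      by (subst 1, subst 2) (simp only: sum_distrib_left mult.assoc)
  qed
  then have "(\<Sum>e\<leftarrow>es. Q e e) = (\<Sum>e\<leftarrow>es. \<Sum>i\<in>Basis. \<Sum>j\<in>Basis. (e \<bullet> i) * (e \<bullet> j) * Q i j)"
    by simp
  also have "\<dots> = (\<Sum>i\<in>Basis. \<Sum>j\<in>Basis. dual_metric es i j * Q i j)"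
    by (induction es) (simp_all add: dual_metric_def sum.distrib[symmetric] algebra_simps)
  finally show ?thesis .
qed

lemma frame_ip_linear:
  assumes "alternating \<beta>" "alternating \<gamma>"
  shows "linear (\<lambda>v. frame_ip es (v \<lrcorner> \<beta>) \<gamma>')" "linear (\<lambda>w. frame_ip es \<beta>' (w \<lrcorner> \<gamma>))"
  by (rule linearI; simp add: frame_ip_def interior_linear_arg[OF assms(1)]
      interior_linear_arg[OF assms(2)] sum.distrib[symmetric] sum_distrib_left algebra_simps)+

text \<open>The division in \<open>contraction\<close> undoes the degree factor of
  \<open>frame_ip_degree\<close>. The right-hand side sees the frame only through
  \<open>dual_metric es\<close>; this yields both the independence of the frame and, later, a
  formula in terms of s.\<close>

lemma frame_ip_contraction:
  assumes "\<beta> \<in> Alt k" "alternating \<gamma>"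
  shows "frame_ip es \<beta> \<gamma> = contraction k (dual_metric es) \<beta> \<gamma>"
  using assms
proof (induction k arbitrary: \<beta> \<gamma>)
  case 0
  have "frame_ip es \<beta> \<gamma> = (\<Sum>S\<in>{{}}. \<beta> (nths es S) * \<gamma> (nths es S))"
    unfolding frame_ip_def
  proof (rule sum.mono_neutral_right)
    show "\<forall>S\<in>Pow {..<length es} - {{}}. \<beta> (nths es S) * \<gamma> (nths es S) = 0"
    proof
      fix S assume S: "S \<in> Pow {..<length es} - {{}}"
      then have "length (nths es S) \<noteq> 0"
        using finite_subset[of S "{..<length es}"] by (simp add: length_nths_subset)
      then show "\<beta> (nths es S) * \<gamma> (nths es S) = 0" using Alt_length[OF 0(1)] by simp
    qed
  qed auto
  then show ?case by simp
next
  case (Suc k)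
  note alt = Alt_alternating[OF Suc.prems(1)] Suc.prems(2)
  have "real (Suc k) * frame_ip es \<beta> \<gamma> = (\<Sum>e\<leftarrow>es. frame_ip es (e \<lrcorner> \<beta>) (e \<lrcorner> \<gamma>))"
    using frame_ip_degree[OF Suc.prems] by simp
  also have "\<dots> = (\<Sum>i\<in>Basis. \<Sum>j\<in>Basis. dual_metric es i j * frame_ip es (i \<lrcorner> \<beta>) (j \<lrcorner> \<gamma>))"
    by (rule sum_list_bilinear[where Q = "\<lambda>v w. frame_ip es (v \<lrcorner> \<beta>) (w \<lrcorner> \<gamma>)"])
      (rule frame_ip_linear[OF alt])+
  also have "\<dots> = (\<Sum>i\<in>Basis. \<Sum>j\<in>Basis. dual_metric es i j *
      contraction k (dual_metric es) (i \<lrcorner> \<beta>) (j \<lrcorner> \<gamma>))"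
    using Suc.IH[OF interior_Alt[OF Suc.prems(1)] alternating_interior[OF alt(2)]] by simp
  finally show ?case by (simp add: field_simps)
qed

lemma contraction_scale_metric: "contraction k (\<lambda>i j. c * G i j) \<beta> \<gamma> = c ^ k * contraction k G \<beta> \<gamma>"
  by (induction k arbitrary: \<beta> \<gamma>) (simp_all add: sum_distrib_left mult_ac)

lemma interior_scale: "v \<lrcorner> (\<lambda>us. a * \<beta> us) = (\<lambda>us. a * (v \<lrcorner> \<beta>) us)"
  by (simp add: interior_product_def)

lemma contraction_scale:
  "contraction k G (\<lambda>us. a * \<beta> us) (\<lambda>us. b * \<gamma> us) = a * b * contraction k G \<beta> \<gamma>"
  by (induction k arbitrary: \<beta> \<gamma>) (simp_all add: interior_scale sum_distrib_left mult_ac)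

section \<open>Orthonormal frames\<close>

context
  fixes g :: "'a::euclidean_space \<Rightarrow> 'a \<Rightarrow> real"
  assumes ip: "inner_product_on g"
begin

lemma ip_bilinear: "bilinear g" and ip_sym: "g v w = g w v" and ip_pos: "v \<noteq> 0 \<Longrightarrow> 0 < g v v"
  using ip by (auto simp: inner_product_on_def)

lemma ip_linear: "linear (g v)" "linear (\<lambda>v. g v w)"
  using ip_bilinear by (auto simp: bilinear_def)

lemma orthogonal_vector_exists:
  assumes "length us < DIM('a)"
  obtains v where "g v v = 1" "\<And>u. u \<in> set us \<Longrightarrow> g v u = 0"
proof -
  \<comment> \<open>\<open>?n u\<close> represents the functional g(-, u) with respect to the
    standard inner product, so that g-orthogonality turns into Euclidean orthogonality to a proper
    subspace.\<close>
  let ?n = "\<lambda>u. \<Sum>i\<in>Basis. g i u *\<^sub>R i"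
  have n: "v \<bullet> ?n u = g v u" for v u
  proof -
    have "v \<bullet> ?n u = g (\<Sum>i\<in>Basis. (v \<bullet> i) *\<^sub>R i) u"
      by (simp only: inner_sum_right inner_scaleR_right linear_sum[OF ip_linear(2)]
          linear_scale[OF ip_linear(2)] real_scaleR_def mult.commute)
    then show ?thesis by (simp add: euclidean_representation)
  qed
  have "dim (?n ` set us) \<le> length us"
    using dim_le_card'[of "?n ` set us"] card_image_le[of "set us" ?n] card_length[of us] by simp
  then have "span (?n ` set us) \<noteq> UNIV"
    using assms dim_eq_full[of "?n ` set us"] by linarith
  then obtain v where v0: "v \<noteq> 0" "\<And>x. x \<in> span (?n ` set us) \<Longrightarrow> v \<bullet> x = 0"
    using span_not_UNIV_orthogonal[of "?n ` set us"] by blast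
  have "g v u = 0" if "u \<in> set us" for u
    using v0(2)[of "?n u"] span_base[OF imageI[OF that], of ?n] n[of v u] by (simp only:)
  with v0(1) have v: "v \<noteq> 0" "\<forall>u\<in>set us. g v u = 0" by blast+
  let ?w = "(1 / sqrt (g v v)) *\<^sub>R v"
  have "g ?w ?w = 1"
    using ip_pos[OF v(1)] by (simp add: linear_scale[OF ip_linear(1)] linear_scale[OF ip_linear(2)])
  moreover have "g ?w u = 0" if "u \<in> set us" for u
    using v(2) that by (simp add: linear_scale[OF ip_linear(2)])
  ultimately show ?thesis using that by blast
qed

lemma orthonormal_basis_ex: "\<exists>es. orthonormal_basis g es"
proof -
  have "\<exists>es. length es = n \<and>
      (\<forall>i<n. \<forall>j<n. g (es ! i) (es ! j) = (if i = j then 1 else 0))" if "n \<le> DIM('a)" for n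
    using that
  proof (induction n)
    case (Suc n)
    then obtain es where es: "length es = n"
      "\<forall>i<n. \<forall>j<n. g (es ! i) (es ! j) = (if i = j then 1 else 0)" by auto
    obtain v where v: "g v v = 1" "\<And>u. u \<in> set es \<Longrightarrow> g v u = 0"
      using orthogonal_vector_exists[of es] Suc.prems es(1) by auto
    have v': "g u v = 0" if "u \<in> set es" for u using v(2)[OF that] ip_sym by simp
    have "\<forall>i<Suc n. \<forall>j<Suc n. g ((es @ [v]) ! i) ((es @ [v]) ! j) = (if i = j then 1 else 0)"
      using es v v' by (auto simp: nth_append less_Suc_eq)
    then show ?case using es(1) by (intro exI[of _ "es @ [v]"]) auto
  qed simp
  from this[of "DIM('a)"] show ?thesis by (auto simp: orthonormal_basis_def)
qed

lemma orthonormal_basis_span: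
  assumes "orthonormal_basis g es"
  shows "distinct es" "independent (set es)" "span (set es) = UNIV"
proof -
  have len: "length es = DIM('a)"
    and on: "\<And>i j. i < length es \<Longrightarrow> j < length es \<Longrightarrow> g (es ! i) (es ! j) = (if i = j then 1 else 0)"
    using assms by (auto simp: orthonormal_basis_def)
  show d: "distinct es"
    unfolding distinct_conv_nth by (metis on zero_neq_one)
  have on': "g v w = (if v = w then 1 else 0)" if "v \<in> set es" "w \<in> set es" for v w
    using that on d by (metis in_set_conv_nth nth_eq_iff_index_eq)
  show i: "independent (set es)"
  proof (rule independent_if_scalars_zero)
    fix f x assume 0: "(\<Sum>x\<in>set es. f x *\<^sub>R x) = 0" and x: "x \<in> set es"
    have "0 = g (\<Sum>x\<in>set es. f x *\<^sub>R x) x"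
      unfolding 0 using linear_0[OF ip_linear(2)] by simp
    also have "\<dots> = (\<Sum>y\<in>set es. f y * g y x)"
      by (simp add: linear_sum[OF ip_linear(2)] linear_scale[OF ip_linear(2)])
    also have "\<dots> = (\<Sum>y\<in>set es. if y = x then f x else 0)"
      using on' x by (intro sum.cong) auto
    finally show "f x = 0" using x by simp
  qed simp
  have "card (set es) = DIM('a)" using d len distinct_card by metis
  then show "span (set es) = UNIV"
    using card_ge_dim_independent[OF _ i, of UNIV] by (auto simp: dim_UNIV)
qed

lemma orthonormal_expansion:
  assumes "orthonormal_basis g es"
  shows "v = (\<Sum>e\<leftarrow>es. g v e *\<^sub>R e)"
proof -
  have len: "length es = DIM('a)"
    and on: "\<And>i j. i < length es \<Longrightarrow> j < length es \<Longrightarrow> g (es ! i) (es ! j) = (if i = j then 1 else 0)"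
    using assms by (auto simp: orthonormal_basis_def)
  note d = orthonormal_basis_span[OF assms]
  have on': "g v w = (if v = w then 1 else 0)" if "v \<in> set es" "w \<in> set es" for v w
    using that on d by (metis in_set_conv_nth nth_eq_iff_index_eq)
  have "v \<in> span (set es)" using d(3) by simp
  then obtain u where u: "v = (\<Sum>e\<in>set es. u e *\<^sub>R e)"
    using span_finite[of "set es"] by auto
  have "g v e = u e" if e: "e \<in> set es" for e
  proof -
    have "g v e = (\<Sum>y\<in>set es. u y * g y e)"
      unfolding u by (simp add: linear_sum[OF ip_linear(2)] linear_scale[OF ip_linear(2)])
    also have "\<dots> = (\<Sum>y\<in>set es. if y = e then u e else 0)"
      using on' e by (intro sum.cong) auto
    finally show ?thesis using e by simp
  qed
  then have "v = (\<Sum>e\<in>set es. g v e *\<^sub>R e)" using u by simp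
  also have "\<dots> = (\<Sum>e\<leftarrow>es. g v e *\<^sub>R e)"
    using d(1) by (simp add: sum_list_distinct_conv_sum_set)
  finally show ?thesis .
qed

text \<open>The vector is the g-gradient of the coordinate function v \<bullet> j. Being
  characterised by g alone, it is the same for all orthonormal bases.\<close>

lemma dual_metric_representer:
  assumes "orthonormal_basis g es"
  shows "g (\<Sum>e\<leftarrow>es. (e \<bullet> j) *\<^sub>R e) v = v \<bullet> j"
proof -
  have "v \<bullet> j = (\<Sum>e\<leftarrow>es. g v e *\<^sub>R e) \<bullet> j"
    using orthonormal_expansion[OF assms, of v] by simp
  also have "\<dots> = (\<Sum>e\<leftarrow>es. g v e * (e \<bullet> j))"
    by (induction es) (simp_all add: inner_add_left)
  also have "\<dots> = g v (\<Sum>e\<leftarrow>es. (e \<bullet> j) *\<^sub>R e)"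
    by (induction es)
      (simp_all add: linear_0[OF ip_linear(1)] linear_add[OF ip_linear(1)] linear_scale[OF ip_linear(1)])
  finally show ?thesis by (simp add: ip_sym)
qed

lemma dual_metric_alt: "dual_metric es i j = (\<Sum>e\<leftarrow>es. (e \<bullet> j) *\<^sub>R e) \<bullet> i"
  unfolding dual_metric_def by (induction es) (simp_all add: inner_add_left)

lemma dual_metric_unique:
  assumes "orthonormal_basis g es" "orthonormal_basis g es'"
  shows "dual_metric es = dual_metric es'"
proof -
  have "(\<Sum>e\<leftarrow>es. (e \<bullet> j) *\<^sub>R e) = (\<Sum>e\<leftarrow>es'. (e \<bullet> j) *\<^sub>R e)" (is "?w = ?w'") for j :: 'a
  proof -
    have "g (?w - ?w') (?w - ?w') = 0"
      using dual_metric_representer[OF assms(1), of j "?w - ?w'"]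
        dual_metric_representer[OF assms(2), of j "?w - ?w'"]
      by (simp add: linear_diff[OF ip_linear(2)])
    then show ?thesis using ip_pos[of "?w - ?w'"] by auto
  qed
  then show ?thesis by (simp add: fun_eq_iff dual_metric_alt)
qed

lemma dual_metric_inverse:
  assumes "orthonormal_basis g es" "k \<in> Basis" "j \<in> Basis"
  shows "(\<Sum>i\<in>Basis. g k i * dual_metric es i j) = (if k = j then 1 else 0)"
proof -
  have "(\<Sum>i\<in>Basis. g k i * dual_metric es i j) = g k (\<Sum>i\<in>Basis. dual_metric es i j *\<^sub>R i)"
    by (simp add: linear_sum[OF ip_linear(1)] linear_scale[OF ip_linear(1)] mult.commute)
  also have "(\<Sum>i\<in>Basis. dual_metric es i j *\<^sub>R i) = (\<Sum>e\<leftarrow>es. (e \<bullet> j) *\<^sub>R e)"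
    unfolding dual_metric_alt by (rule euclidean_representation)
  finally show ?thesis
    using dual_metric_representer[OF assms(1), of j k] assms(2,3) ip_sym by (auto simp: inner_Basis)
qed

lemma frame_ip_unique:
  assumes "orthonormal_basis g es" "orthonormal_basis g es'" "\<beta> \<in> Alt k" "alternating \<gamma>"
  shows "frame_ip es \<beta> \<gamma> = frame_ip es' \<beta> \<gamma>"
  unfolding frame_ip_contraction[OF assms(3,4)] dual_metric_unique[OF assms(1,2)] ..

text \<open>By frame independence the basis picked by \<open>SOME\<close> in
  \<open>hodge_star\<close> may be replaced by any other orthonormal basis.\<close>

lemma hodge_star_frame:
  assumes "orthonormal_basis g es" "\<beta> \<in> Alt k" "alternating vol"
  shows "hodge_star g vol \<beta> ws = frame_ip es \<beta> (\<lambda>us. vol (us @ ws))"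
proof -
  define es' where "es' = (SOME es. orthonormal_basis g es)"
  have es': "orthonormal_basis g es'"
    unfolding es'_def using assms(1) by (rule someI)
  then have "length es' = DIM('a)" by (simp add: orthonormal_basis_def)
  then have "hodge_star g vol \<beta> ws = frame_ip es' \<beta> (\<lambda>us. vol (us @ ws))"
    by (simp add: hodge_star_def es'_def[symmetric] Let_def frame_ip_def)
  then show ?thesis
    using frame_ip_unique[OF es' assms(1,2) alternating_append[OF assms(3)]] by simp
qed

lemma frame_ip_top:
  assumes "length es = DIM('a)" "vol \<in> Alt DIM('a)"
  shows "frame_ip es vol \<gamma> = vol es * \<gamma> es"
proof -
  have "frame_ip es vol \<gamma> = (\<Sum>S\<in>{{..<length es}}. vol (nths es S) * \<gamma> (nths es S))"
    unfolding frame_ip_def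
  proof (rule sum.mono_neutral_right)
    show "\<forall>S\<in>Pow {..<length es} - {{..<length es}}. vol (nths es S) * \<gamma> (nths es S) = 0"
    proof
      fix S assume S: "S \<in> Pow {..<length es} - {{..<length es}}"
      then have "length (nths es S) < length es"
        using psubset_card_mono[of "{..<length es}" S] by (auto simp: length_nths_subset)
      then show "vol (nths es S) * \<gamma> (nths es S) = 0"
        using Alt_length[OF assms(2), of "nths es S"] assms(1) by simp
    qed
  qed auto
  then show ?thesis by (simp add: nths_all)
qed

text \<open>The square of \<open>vol es\<close> is the squared norm of \<open>vol\<close>, hence the
  same for every orthonormal basis; no determinant of a change of basis enters.\<close>

lemma volume_form_ofI:
  assumes "vol \<in> Alt DIM('a)" "orthonormal_basis g es" "\<bar>vol es\<bar> = 1"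
  shows "volume_form_of g vol"
proof -
  have "\<bar>vol es'\<bar> = 1" if "orthonormal_basis g es'" for es'
  proof -
    have "vol es' * vol es' = vol es * vol es"
      using frame_ip_unique[OF assms(2) that assms(1) Alt_alternating[OF assms(1)]]
        frame_ip_top[OF _ assms(1)] assms(2) that by (simp add: orthonormal_basis_def)
    then have "\<bar>vol es'\<bar> = \<bar>vol es\<bar>"
      by (metis abs_mult real_sqrt_abs2)
    then show ?thesis using assms(3) by simp
  qed
  then show ?thesis using assms(1) by (simp add: volume_form_of_def)
qed

end

section \<open>Products of covectors\<close>

fun covectors :: "('a \<Rightarrow> real) list \<Rightarrow> 'a form" where
  "covectors [] = unit_form"
| "covectors (u # us) = (\<lambda>vs. case vs of [v] \<Rightarrow> u v | _ \<Rightarrow> 0) \<and>\<^sub>f covectors us"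

lemma covector_Alt:
  assumes "linear u" shows "(\<lambda>vs. case vs of [v] \<Rightarrow> u v | _ \<Rightarrow> 0) \<in> Alt 1"
proof -
  have "linear (\<lambda>v. case us @ v # vs of [v] \<Rightarrow> u v | _ \<Rightarrow> 0)" for us vs
    using assms linear_zero by (cases us; cases "tl us"; cases vs; simp)
  moreover have "(case us @ v # v # vs of [v] \<Rightarrow> u v | _ \<Rightarrow> 0) = 0" for us v vs
    by (cases us; simp split: list.splits)
  ultimately show ?thesis
    unfolding Alt_def alternating_iff by (auto split: list.splits)
qed

lemma unit_form_Alt: "unit_form \<in> Alt 0"
  unfolding Alt_def alternating_iff unit_form_def using linear_zero by auto

lemma covectors_Alt: "(\<And>u. u \<in> set us \<Longrightarrow> linear u) \<Longrightarrow> covectors us \<in> Alt (length us)"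
proof (induction us)
  case (Cons u us)
  then show ?case using wedge_Alt[OF covector_Alt, of u "covectors us"] by simp
qed (simp add: unit_form_Alt)

lemma wedge_eq_0_left:
  "(\<And>us. set us \<subseteq> set vs \<Longrightarrow> \<alpha> us = 0) \<Longrightarrow> (\<alpha> \<and>\<^sub>f \<beta>) vs = 0"
  by (simp add: wedge_def set_nths_subset)

lemma wedge_eq_0_right:
  "(\<And>us. set us \<subseteq> set vs \<Longrightarrow> \<beta> us = 0) \<Longrightarrow> (\<alpha> \<and>\<^sub>f \<beta>) vs = 0"
  by (simp add: wedge_def set_nths_subset)

lemma wedge_unit_left: "(unit_form \<and>\<^sub>f \<beta>) vs = \<beta> vs"
  by (induction vs arbitrary: \<beta>)
    (simp_all add: wedge_Cons interior_product_def unit_form_def hat_def if_distrib cong: if_cong)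

lemma covectors_Cons_eq:
  assumes "u e = 1" "\<And>x. x \<in> set es \<Longrightarrow> u x = 0"
  shows "covectors (u # us) (e # es) = covectors us es"
proof -
  have "(hat (\<lambda>vs. case vs of [v] \<Rightarrow> u v | _ \<Rightarrow> 0) \<and>\<^sub>f e \<lrcorner> covectors us) es = 0"
    by (rule wedge_eq_0_left) (use assms(2) in \<open>auto simp: hat_def split: list.splits\<close>)
  moreover have "e \<lrcorner> (\<lambda>vs. case vs of [v] \<Rightarrow> u v | _ \<Rightarrow> 0) = unit_form"
    using assms(1) by (auto simp: interior_product_def unit_form_def fun_eq_iff split: list.splits)
  ultimately show ?thesis by (simp add: wedge_Cons wedge_unit_left)
qed

lemma covectors_eq_0:
  assumes "u \<in> set us" "\<And>x. x \<in> set vs \<Longrightarrow> u x = 0"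
  shows "covectors us vs = 0"
  using assms
proof (induction us arbitrary: vs)
  case (Cons w us)
  show ?case
  proof (cases "u = w")
    case True
    then show ?thesis
      using Cons.prems(2) by (auto intro!: wedge_eq_0_left split: list.splits)
  next
    case False
    then show ?thesis
      using Cons.prems by (auto intro!: wedge_eq_0_right Cons.IH)
  qed
qed simp

abbreviation (input) coord :: "7 \<Rightarrow> V7 \<Rightarrow> real" where
  "coord i \<equiv> \<lambda>v. v $ i"

lemma linear_coord: "linear (coord i)"
  by (rule linearI) simp_all

definition index_form :: "7 set \<Rightarrow> V7 form" where
  "index_form I = covectors (map coord (sorted_list_of_set I))"

lemma index_form_Alt: "index_form I \<in> Alt (card I)"
proof -
  have "covectors (map coord (sorted_list_of_set I)) \<in> Alt (length (map coord (sorted_list_of_set I)))"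
    by (rule covectors_Alt) (auto simp: linear_coord)
  then show ?thesis by (simp add: index_form_def)
qed

lemma covectors_coord_self: "distinct is \<Longrightarrow> covectors (map coord is) (map (\<lambda>i. axis i 1) is) = 1"
proof (induction "is")
  case (Cons i "is")
  then show ?case
    by (simp only: list.map) (subst covectors_Cons_eq, auto simp: axis_def)
qed (simp add: unit_form_def)

lemma index_form_basis_vectors:
  assumes "card I = card J"
  shows "index_form I (basis_vectors J) = (if I = J then 1 else 0)"
proof (cases "I = J")
  case True
  then show ?thesis by (simp add: index_form_def basis_vectors_def covectors_coord_self)
next
  case False
  then obtain i where i: "i \<in> I" "i \<notin> J"
    using assms card_subset_eq[of J I] by (metis finite subsetI)
  then have "index_form I (basis_vectors J) = 0"
    unfolding index_form_def basis_vectors_def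
    by (intro covectors_eq_0[of "coord i"]) (auto simp: axis_def)
  then show ?thesis using False by simp
qed

definition std_frame :: "V7 list" where
  "std_frame = basis_vectors UNIV"

definition std_vol :: "V7 form" where
  "std_vol = index_form UNIV"

lemma std_vol_Alt: "std_vol \<in> Alt 7"
  using index_form_Alt[of UNIV] by (simp add: std_vol_def)

lemma std_vol_std_frame [simp]: "std_vol std_frame = 1"
  by (simp add: std_vol_def std_frame_def index_form_basis_vectors)

lemma length_std_frame [simp]: "length std_frame = 7"
  by (simp add: std_frame_def basis_vectors_def)

lemma span_std_frame: "span (set std_frame) = UNIV"
proof -
  have "set std_frame = Basis"
    by (auto simp: std_frame_def basis_vectors_def Basis_vec_def)
  then show ?thesis by simp
qed

lemma subset_lessThan_card_eq: "S \<subseteq> {..<n} \<Longrightarrow> card S = n \<Longrightarrow> S = {..<n::nat}"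
  by (simp add: card_subset_eq)

lemma Alt_7_eq:
  assumes "\<alpha> \<in> Alt 7"
  shows "\<alpha> = (\<lambda>vs. \<alpha> std_frame * std_vol vs)"
proof (rule Alt_eq_on_frame[OF assms Alt_scale[OF std_vol_Alt] span_std_frame])
  fix S assume "S \<subseteq> {..<length std_frame}" "card S = 7"
  then have "S = {..<length std_frame}" by (intro subset_lessThan_card_eq) simp_all
  then show "\<alpha> (nths std_frame S) = \<alpha> std_frame * std_vol (nths std_frame S)"
    by (simp add: nths_all del: length_std_frame)
qed

lemma alternating_scale_args:
  assumes "alternating \<alpha>"
  shows "\<alpha> (map ((*\<^sub>R) r) vs) = r ^ length vs * \<alpha> vs"
  using assms
proof (induction vs arbitrary: \<alpha>)
  case (Cons v vs)
  have "\<alpha> (map ((*\<^sub>R) r) (v # vs)) = r * \<alpha> (v # map ((*\<^sub>R) r) vs)"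
    using linear_scale[OF alternating_linear_Cons[OF Cons.prems]] by simp
  also have "\<alpha> (v # map ((*\<^sub>R) r) vs) = (v \<lrcorner> \<alpha>) (map ((*\<^sub>R) r) vs)"
    by (simp add: interior_product_def)
  finally show ?case
    using Cons.IH[OF alternating_interior[OF Cons.prems]] by (simp add: interior_product_def)
qed simp

text \<open>If the span were smaller, a basis of it would have no sublist of length
  \<open>DIM('a)\<close>, and \<alpha> would vanish by \<open>alternating_zero_on_span\<close>.
  Applied to omega, this shows that an admissible element projects onto the tangent space of the
  base.\<close>

lemma Alt_nonzero_span:
  fixes \<alpha> :: "'a::euclidean_space form"
  assumes "\<alpha> \<in> Alt DIM('a)" "\<alpha> vs \<noteq> 0"
  shows "span (set vs) = UNIV"
proof -
  obtain B where B: "B \<subseteq> span (set vs)" "independent B" "span B = span (set vs)"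
      "card B = dim (span (set vs))"
    by (metis basis_exists span_mono span_span subset_antisym)
  obtain es where es: "set es = B" "distinct es"
    using finite_distinct_list independent_imp_finite[OF B(2)] by blast
  have "\<exists>S. \<alpha> (nths es S) \<noteq> 0"
    using alternating_zero_on_span[OF Alt_alternating[OF assms(1)], of es vs] assms(2) es B(3)
    by (auto simp: span_superset)
  then obtain S where "\<alpha> (nths es S) \<noteq> 0" ..
  then have "length (nths es S) = DIM('a)" using Alt_length[OF assms(1)] by blast
  moreover have "length (nths es S) \<le> length es"
    by (simp add: length_nths) (metis (no_types, lifting) card_lessThan card_mono finite_lessThan lessThan_iff mem_Collect_eq subsetI)
  ultimately have "DIM('a) \<le> dim (span (set vs))"
    using es B(4) distinct_card by metis
  then have "dim (set vs) = DIM('a)" using dim_subset_UNIV[of "set vs"] by simp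
  then show ?thesis using dim_eq_full by blast
qed

lemma Alt_7_nonzero_on_frame:
  assumes "\<alpha> \<in> Alt 7" "\<alpha> \<noteq> (\<lambda>us. 0)" "length es = 7" "span (set es) = UNIV"
  shows "\<alpha> es \<noteq> 0"
proof
  assume 0: "\<alpha> es = 0"
  have "\<alpha> = (\<lambda>us. 0 * \<alpha> us)"
  proof (rule Alt_eq_on_frame[OF assms(1) Alt_scale[OF assms(1)] assms(4)])
    fix S assume "S \<subseteq> {..<length es}" "card S = 7"
    then have "S = {..<length es}" using assms(3) by (intro subset_lessThan_card_eq) simp_all
    then show "\<alpha> (nths es S) = 0 * \<alpha> (nths es S)" using 0 by (simp add: nths_all)
  qed
  then show False using assms(2) by simp
qed

section \<open>The metric and the volume form of a definite three-form\<close>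

text \<open>The bilinear form with values in the 7-forms that defines the metric, made real-valued
  by evaluation on the standard frame. If the volume form is \<mu> times \<open>std_vol\<close>,
  then it equals 6 \<mu> g.\<close>

definition bform :: "V7 form \<Rightarrow> V7 \<Rightarrow> V7 \<Rightarrow> real" where
  "bform s v w = ((v \<lrcorner> s) \<and>\<^sub>f (w \<lrcorner> s) \<and>\<^sub>f s) std_frame"

lemma triple_wedge_Alt:
  assumes "s \<in> Alt 3" shows "(v \<lrcorner> s) \<and>\<^sub>f (w \<lrcorner> s) \<and>\<^sub>f s \<in> Alt 7"
proof -
  have "v \<lrcorner> s \<in> Alt 2" for v using interior_Alt[of s 2 v] assms by simp
  from wedge_Alt[OF wedge_Alt[OF this this] assms, of v w] show ?thesis by simp
qed

lemma triple_wedge_eq: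
  assumes "s \<in> Alt 3"
  shows "(v \<lrcorner> s) \<and>\<^sub>f (w \<lrcorner> s) \<and>\<^sub>f s = (\<lambda>vs. bform s v w * std_vol vs)"
  using Alt_7_eq[OF triple_wedge_Alt[OF assms]] by (simp add: bform_def)

lemma definite3_iff: "s \<in> definite3 \<longleftrightarrow> s \<in> Alt 3 \<and> (\<forall>v. v \<noteq> 0 \<longrightarrow> bform s v v \<noteq> 0)"
proof -
  have "(v \<lrcorner> s) \<and>\<^sub>f (v \<lrcorner> s) \<and>\<^sub>f s = zero_form \<longleftrightarrow> bform s v v = 0" if "s \<in> Alt 3" for v
    unfolding triple_wedge_eq[OF that] zero_form_def fun_eq_iff
    by (metis mult.right_neutral mult_zero_left std_vol_std_frame)
  then show ?thesis by (auto simp: definite3_def)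
qed

lemma bform_linear:
  assumes "s \<in> Alt 3"
  shows "linear (\<lambda>v. bform s v w)" "linear (bform s v)"
  by (rule linearI; simp add: bform_def wedge_assoc wedge_linear wedge_linear_fun
      interior_linear_arg[OF Alt_alternating[OF assms]])+

lemma bform_sym:
  assumes "s \<in> Alt 3"
  shows "bform s v w = bform s w v"
proof -
  have "v \<lrcorner> s \<in> Alt 2" for v using interior_Alt[of s 2 v] assms by simp
  then have par: "hat (v \<lrcorner> s) = (\<lambda>us. 1 * (v \<lrcorner> s) us)" for v
    using hat_Alt[of "v \<lrcorner> s" 2] by simp
  have "(v \<lrcorner> s) \<and>\<^sub>f (w \<lrcorner> s) = (w \<lrcorner> s) \<and>\<^sub>f (v \<lrcorner> s)"
    using wedge_commute_parity[OF par par, of v w] by (simp add: fun_eq_iff)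
  then show ?thesis by (simp add: bform_def)
qed

text \<open>With opposite signs, the quadratic form would vanish somewhere on the segment from v to
  w. By \<open>nz\<close> the segment then passes through 0, so w is a multiple of v and its value
  is a square times the value at v.\<close>

lemma definite_constant_sign:
  fixes B :: "'a::real_vector \<Rightarrow> 'a \<Rightarrow> real"
  assumes lin: "\<And>w. linear (\<lambda>v. B v w)" "\<And>v. linear (B v)"
    and nz: "\<And>v. v \<noteq> 0 \<Longrightarrow> B v v \<noteq> 0"
    and "B v v > 0" "w \<noteq> 0"
  shows "B w w > 0"
proof (rule ccontr)
  assume "\<not> B w w > 0"
  then have neg: "B w w < 0" using nz[OF assms(5)] by simp
  let ?u = "\<lambda>t::real. (1 - t) *\<^sub>R v + t *\<^sub>R w"
  let ?p = "\<lambda>t::real. (1 - t) * ((1 - t) * B v v + t * B w v) + t * ((1 - t) * B v w + t * B w w)"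
  have p: "B (?u t) (?u t) = ?p t" for t
    by (simp add: linear_add[OF lin(1)] linear_scale[OF lin(1)] linear_add[OF lin(2)]
        linear_scale[OF lin(2)])
  have "\<exists>t\<ge>0. t \<le> 1 \<and> ?p t = 0"
    by (rule IVT2'[of ?p]) (use neg assms(4) in \<open>auto intro!: continuous_intros\<close>)
  then obtain t where t: "?p t = 0" by blast
  then have "?u t = 0" using nz[of "?u t"] p by metis
  moreover have "t \<noteq> 0" using t assms(4) by auto
  ultimately have "t *\<^sub>R w = (t - 1) *\<^sub>R v"
    by (simp add: algebra_simps)
  then have "w = ((t - 1) / t) *\<^sub>R v"
    using \<open>t \<noteq> 0\<close> by (metis divide_inverse_commute scaleR_scaleR left_inverse scaleR_one)
  then have "B w w = ((t - 1) / t)\<^sup>2 * B v v"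
    by (simp add: linear_scale[OF lin(1)] linear_scale[OF lin(2)] power2_eq_square)
  then show False using neg assms(4) by (metis mult_nonneg_nonneg less_imp_le not_le zero_le_power2)
qed

definition g2_pair :: "V7 form \<Rightarrow> (V7 \<Rightarrow> V7 \<Rightarrow> real) \<Rightarrow> V7 form \<Rightarrow> bool" where
  "g2_pair s g vol \<longleftrightarrow> inner_product_on g \<and> volume_form_of g vol \<and>
     (\<forall>v w. (v \<lrcorner> s) \<and>\<^sub>f (w \<lrcorner> s) \<and>\<^sub>f s = (\<lambda>vs. 6 * g v w * vol vs))"

lemma g2_pair_frame: "g2_pair s g vol \<Longrightarrow> \<exists>es. orthonormal_basis g es"
  by (rule orthonormal_basis_ex) (simp add: g2_pair_def)

lemma inner_product_on_scale:
  assumes "inner_product_on g" "c > 0"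
  shows "inner_product_on (\<lambda>v w. c * g v w)"
proof -
  have "linear (\<lambda>v. c * f v)" if "linear f" for f :: "'a \<Rightarrow> real"
    using linear_compose_scale_right[OF that, of c] by simp
  then show ?thesis using assms by (simp add: inner_product_on_def bilinear_def)
qed

lemma orthonormal_basis_scale:
  assumes "orthonormal_basis g es" "bilinear g" "c * r\<^sup>2 = 1"
  shows "orthonormal_basis (\<lambda>v w. c * g v w) (map ((*\<^sub>R) r) es)"
proof -
  have "g (r *\<^sub>R v) (r *\<^sub>R w) = r\<^sup>2 * g v w" for v w
    using assms(2) by (simp add: bilinear_lmul bilinear_rmul power2_eq_square)
  then show ?thesis
    using assms(1,3) by (simp add: orthonormal_basis_def mult.assoc[symmetric])
qed

lemma g2_pair_exists:
  assumes "s \<in> definite3"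
  shows "\<exists>\<mu>. \<mu> \<noteq> 0 \<and> g2_pair s (\<lambda>v w. bform s v w / (6 * \<mu>)) (\<lambda>vs. \<mu> * std_vol vs)"
proof -
  have s: "s \<in> Alt 3" and nz: "\<And>v. v \<noteq> 0 \<Longrightarrow> bform s v v \<noteq> 0"
    using assms by (auto simp: definite3_iff)
  note lin = bform_linear[OF s]
  define \<sigma> where "\<sigma> = sgn (bform s (axis 0 1) (axis 0 1))"
  have \<sigma>: "\<sigma> = 1 \<or> \<sigma> = -1" "0 < \<sigma> * bform s (axis 0 1) (axis 0 1)"
    using nz[of "axis 0 1"] by (auto simp: \<sigma>_def sgn_real_def)
  have lin': "linear (\<lambda>v. \<sigma> * f v)" if "linear f" for f :: "V7 \<Rightarrow> real"
    using linear_compose_scale_right[OF that, of \<sigma>] by simp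
  have "0 < \<sigma> * bform s w w" if "w \<noteq> 0" for w
    by (rule definite_constant_sign[where B = "\<lambda>v w. \<sigma> * bform s v w",
          OF lin'[OF lin(1)] lin'[OF lin(2)] _ \<sigma>(2) that])
      (use nz \<sigma>(1) in auto)
  then have ip: "inner_product_on (\<lambda>v w. \<sigma> * bform s v w)"
    using lin'[OF lin(1)] lin'[OF lin(2)] bform_sym[OF s]
    by (auto simp: inner_product_on_def bilinear_def)
  obtain es where es: "orthonormal_basis (\<lambda>v w. \<sigma> * bform s v w) es"
    using orthonormal_basis_ex[OF ip] by blast
  have len: "length es = 7" using es by (simp add: orthonormal_basis_def)
  have "std_vol \<noteq> (\<lambda>us. 0)"
    by (metis std_vol_std_frame zero_neq_one)
  then have d: "std_vol es \<noteq> 0"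
    using Alt_7_nonzero_on_frame[OF std_vol_Alt _ len orthonormal_basis_span(3)[OF ip es]] by blast
  \<comment> \<open>Scaling the frame by r divides the metric by r^2, which forces \<bar>\<mu>\<bar>
    = r^2 / 6. The volume form then has absolute value r^9 \<bar>std_vol es\<bar> / 6 on the scaled
    frame, and this has to be 1.\<close>
  define r where "r = root 9 (6 / \<bar>std_vol es\<bar>)"
  have r: "r > 0" "r ^ 9 = 6 / \<bar>std_vol es\<bar>"
    using d by (simp_all add: r_def real_root_pow_pos)
  define \<mu> where "\<mu> = \<sigma> * r\<^sup>2 / 6"
  have \<mu>: "\<mu> \<noteq> 0" using \<sigma>(1) r(1) by (auto simp: \<mu>_def)
  have g: "(\<lambda>v w. bform s v w / (6 * \<mu>)) = (\<lambda>v w. 1 / r\<^sup>2 * (\<sigma> * bform s v w))"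
    using \<sigma>(1) by (auto simp: \<mu>_def fun_eq_iff)
  have ipg: "inner_product_on (\<lambda>v w. bform s v w / (6 * \<mu>))"
    unfolding g using r(1) by (intro inner_product_on_scale[OF ip]) simp
  have on: "orthonormal_basis (\<lambda>v w. bform s v w / (6 * \<mu>)) (map ((*\<^sub>R) r) es)"
    unfolding g using r(1) ip by (intro orthonormal_basis_scale es) (auto simp: inner_product_on_def)
  have "volume_form_of (\<lambda>v w. bform s v w / (6 * \<mu>)) (\<lambda>vs. \<mu> * std_vol vs)"
  proof (rule volume_form_ofI[OF ipg _ on])
    have "\<bar>\<mu> * std_vol (map ((*\<^sub>R) r) es)\<bar> = r\<^sup>2 / 6 * (r ^ 7 * \<bar>std_vol es\<bar>)"
      using \<sigma>(1) r(1) alternating_scale_args[OF Alt_alternating[OF std_vol_Alt], of r es] len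
      by (auto simp: \<mu>_def abs_mult)
    also have "\<dots> = r ^ 9 * \<bar>std_vol es\<bar> / 6"
      by (simp add: power_add[symmetric] mult.assoc[symmetric])
    also have "\<dots> = 1" using r(2) d by simp
    finally show "\<bar>\<mu> * std_vol (map ((*\<^sub>R) r) es)\<bar> = 1" .
  qed (use Alt_scale[OF std_vol_Alt] in simp)
  then have "g2_pair s (\<lambda>v w. bform s v w / (6 * \<mu>)) (\<lambda>vs. \<mu> * std_vol vs)"
    using ipg \<mu> by (simp add: g2_pair_def triple_wedge_eq[OF s])
  then show ?thesis using \<mu> by blast
qed

text \<open>Equality of the products g vol and g' vol' makes the metrics proportional, say g = r^2
  g'. On a g-orthonormal basis vol' then has absolute value r^2 by the relation and r^(-7) by its
  normalisation, so r^9 = 1.\<close>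

lemma g2_pair_unique:
  assumes "g2_pair s g vol" "g2_pair s g' vol'"
  shows "g = g'" "vol = vol'"
proof -
  have ip: "inner_product_on g" "inner_product_on g'"
    and vf: "volume_form_of g vol" "volume_form_of g' vol'"
    and "(\<lambda>vs. 6 * g v w * vol vs) = (\<lambda>vs. 6 * g' v w * vol' vs)" for v w
    using assms by (auto simp: g2_pair_def)
  then have eq: "g v w * vol vs = g' v w * vol' vs" for v w vs
    by (metis mult.assoc mult_left_cancel zero_neq_numeral)
  obtain es where es: "orthonormal_basis g es" using orthonormal_basis_ex[OF ip(1)] by blast
  define \<rho> where "\<rho> = vol' es / vol es"
  have \<epsilon>: "\<bar>vol es\<bar> = 1" using vf(1) es by (auto simp: volume_form_of_def)
  have g: "g v w = \<rho> * g' v w" for v w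
    using eq[of v w es] \<epsilon> by (auto simp: \<rho>_def field_simps)
  have "0 < \<rho>"
    using g[of "axis 0 1" "axis 0 1"] ip_pos[OF ip(1), of "axis 0 1"] ip_pos[OF ip(2), of "axis 0 1"]
    by (simp add: zero_less_mult_iff)
  define r where "r = sqrt \<rho>"
  have r: "r > 0" "\<rho> = r\<^sup>2" using \<open>0 < \<rho>\<close> by (auto simp: r_def)
  have "orthonormal_basis (\<lambda>v w. 1 / \<rho> * g v w) (map ((*\<^sub>R) r) es)"
    using r ip(1) by (intro orthonormal_basis_scale es) (auto simp: inner_product_on_def)
  then have "orthonormal_basis g' (map ((*\<^sub>R) r) es)"
    using r by (simp add: g)
  then have "\<bar>vol' (map ((*\<^sub>R) r) es)\<bar> = 1" using vf(2) by (auto simp: volume_form_of_def)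
  moreover have "alternating vol'" "length es = 7"
    using vf(2) es by (auto simp: volume_form_of_def Alt_def orthonormal_basis_def)
  ultimately have "r ^ 7 * \<bar>vol' es\<bar> = 1"
    using r(1) by (simp add: alternating_scale_args abs_mult)
  moreover have "\<bar>\<rho>\<bar> = \<bar>vol' es\<bar>" unfolding \<rho>_def abs_divide \<epsilon> by simp
  then have "\<bar>vol' es\<bar> = r\<^sup>2" using \<open>0 < \<rho>\<close> r(2) by linarith
  ultimately have "r ^ 9 = 1" by (simp add: power_add[symmetric])
  then have "r = 1" using r(1) power_eq_imp_eq_base[of r 9 1] by simp
  then show "g = g'" using g r(2) by (simp add: fun_eq_iff)
  then show "vol = vol'"
    using eq[of "axis 0 1" "axis 0 1"] ip_pos[OF ip(1), of "axis 0 1"] by (auto simp: fun_eq_iff)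
qed

lemma g2_metric_volume_eq:
  assumes "g2_pair s g vol"
  shows "g2_metric_volume s = (g, vol)"
  unfolding g2_metric_volume_def
proof (rule the_equality)
  fix p :: "(V7 \<Rightarrow> V7 \<Rightarrow> real) \<times> V7 form"
  assume "case p of (g, vol) \<Rightarrow> inner_product_on g \<and> volume_form_of g vol \<and>
     (\<forall>v w. (v \<lrcorner> s) \<and>\<^sub>f (w \<lrcorner> s) \<and>\<^sub>f s = (\<lambda>vs. 6 * g v w * vol vs))"
  then have "g2_pair s (fst p) (snd p)" by (auto simp: g2_pair_def)
  from g2_pair_unique[OF assms this] show "p = (g, vol)" by simp
qed (use assms in \<open>simp add: g2_pair_def\<close>)

lemma g2_pair_definite3:
  assumes "s \<in> Alt 3" "g2_pair s g vol"
  shows "s \<in> definite3"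
proof -
  have ip: "inner_product_on g" and vf: "volume_form_of g vol"
    and eq: "\<And>v w. (v \<lrcorner> s) \<and>\<^sub>f (w \<lrcorner> s) \<and>\<^sub>f s = (\<lambda>vs. 6 * g v w * vol vs)"
    using assms by (auto simp: g2_pair_def)
  obtain es where "orthonormal_basis g es" using orthonormal_basis_ex[OF ip] by blast
  then have "vol es \<noteq> 0" using vf by (auto simp: volume_form_of_def)
  then have "(v \<lrcorner> s) \<and>\<^sub>f (v \<lrcorner> s) \<and>\<^sub>f s \<noteq> zero_form" if "v \<noteq> 0" for v
    using ip_pos[OF ip that] by (auto simp: eq zero_form_def fun_eq_iff)
  then show ?thesis using assms(1) by (simp add: definite3_def)
qed

lemma star_frame:
  assumes "g2_pair s g vol" "orthonormal_basis g es" "\<beta> \<in> Alt k"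
  shows "star s \<beta> ws = frame_ip es \<beta> (\<lambda>us. vol (us @ ws))"
  using assms hodge_star_frame[of g es \<beta> k vol ws] g2_metric_volume_eq[OF assms(1)]
  by (auto simp: star_def g2_pair_def volume_form_of_def Alt_def)

lemma alternating_prepend: "alternating \<alpha> \<Longrightarrow> alternating (\<lambda>ws. \<alpha> (us @ ws))"
proof -
  assume a: "alternating \<alpha>"
  have "linear (\<lambda>v. \<alpha> (us @ us' @ v # vs))" "\<alpha> (us @ us' @ v # v # vs) = 0" for us' vs v
    using alternating_linear[OF a, of "us @ us'" vs] alternating_repeat[OF a, of "us @ us'" v vs]
    by simp_all
  then show ?thesis by (simp add: alternating_iff)
qed

lemma star_Alt:
  assumes "s \<in> definite3" "\<beta> \<in> Alt k" "k \<le> 7"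
  shows "star s \<beta> \<in> Alt (7 - k)"
proof -
  obtain g vol where gv: "g2_pair s g vol" using g2_pair_exists[OF assms(1)] by blast
  obtain es where es: "orthonormal_basis g es"
    using g2_pair_frame[OF gv] by blast
  have vol: "vol \<in> Alt 7" using gv by (auto simp: g2_pair_def volume_form_of_def)
  have "star s \<beta> = (\<lambda>ws. \<Sum>S\<in>Pow {..<length es}. \<beta> (nths es S) * vol (nths es S @ ws))"
    using star_frame[OF gv es assms(2)] by (simp add: fun_eq_iff frame_ip_def)
  moreover have "(\<lambda>ws. \<beta> (nths es S) * vol (nths es S @ ws)) \<in> Alt (7 - k)" for S
  proof (cases "\<beta> (nths es S) = 0")
    case True
    then show ?thesis using Alt_scale[of "\<lambda>_. 0" "7 - k" 0] linear_zero
      by (simp add: Alt_def alternating_iff)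
  next
    case False
    then have "length (nths es S) = k" using Alt_length[OF assms(2)] by blast
    then have "(\<lambda>ws. vol (nths es S @ ws)) \<in> Alt (7 - k)"
      using alternating_prepend[OF Alt_alternating[OF vol]] Alt_length[OF vol] assms(3)
      by (auto simp: Alt_def)
    then show ?thesis by (rule Alt_scale)
  qed
  ultimately show ?thesis by (simp add: Alt_sum)
qed

section \<open>Equivariance of the metric, the volume form and the Hodge star under linear
  isomorphisms\<close>

lemma g2_pair_pull:
  assumes "g2_pair s g vol" "linear L" "bij L"
  shows "g2_pair (pull L s) (\<lambda>v w. g (L v) (L w)) (pull L vol)"
proof -
  have on: "orthonormal_basis g (map L es)" if "orthonormal_basis (\<lambda>v w. g (L v) (L w)) es" for es
    using that by (simp add: orthonormal_basis_def)
  have "L v = 0 \<longleftrightarrow> v = 0" for v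
    using assms(2,3) by (metis bij_is_inj linear_0 injD)
  then show ?thesis
    using assms linear_compose[OF assms(2)]
    by (auto simp: g2_pair_def inner_product_on_def bilinear_def volume_form_of_def pull_Alt on
        pull_wedge[symmetric] interior_pull o_def) (auto simp: pull_def on)
qed

lemma definite3_Alt: "s \<in> definite3 \<Longrightarrow> s \<in> Alt 3"
  by (simp add: definite3_def)

lemma definite3_pull:
  assumes "s \<in> definite3" "linear L" "bij L"
  shows "pull L s \<in> definite3"
  using g2_pair_exists[OF assms(1)] g2_pair_pull[OF _ assms(2,3)]
    g2_pair_definite3[OF pull_Alt[OF assms(2) definite3_Alt[OF assms(1)]]] by blast

text \<open>By uniqueness the metric and volume form of \<open>pull L s\<close> are the pulled back
  ones, and L carries an orthonormal basis of the former to one of the latter.\<close>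

lemma star_pull:
  assumes "s \<in> definite3" "\<beta> \<in> Alt k" "linear L" "bij L"
  shows "star (pull L s) (pull L \<beta>) = pull L (star s \<beta>)"
proof
  fix ws
  obtain g vol where gv: "g2_pair s g vol" using g2_pair_exists[OF assms(1)] by blast
  note gv' = g2_pair_pull[OF gv assms(3,4)]
  obtain es where es: "orthonormal_basis (\<lambda>v w. g (L v) (L w)) es"
    using g2_pair_frame[OF gv'] by blast
  then have "orthonormal_basis g (map L es)" by (simp add: orthonormal_basis_def)
  from star_frame[OF gv this assms(2)]
  have "pull L (star s \<beta>) ws = frame_ip (map L es) \<beta> (\<lambda>us. vol (us @ map L ws))"
    by (simp add: pull_def)
  also have "\<dots> = star (pull L s) (pull L \<beta>) ws"
    using star_frame[OF gv' es pull_Alt[OF assms(3,2)], of ws]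
    by (simp add: frame_ip_def pull_def nths_map)
  finally show "star (pull L s) (pull L \<beta>) ws = pull L (star s \<beta>) ws" ..
qed

lemma zform_pull:
  assumes "s \<in> definite3" "b \<in> Alt 2" "linear L" "bij L"
  shows "zform (pull L s) (pull L b) = pull L (zform s b)"
proof -
  have "star s s \<in> Alt 4" using star_Alt[OF assms(1) definite3_Alt[OF assms(1)]] by simp
  from star_pull[OF assms(1) wedge_Alt[OF assms(2) this] assms(3,4)]
  show ?thesis
    using star_pull[OF assms(1) definite3_Alt[OF assms(1)] assms(3,4)] by (simp add: zform_def pull_wedge)
qed

section \<open>Differentiable dependence of the Hodge star on the three-form\<close>

lemma bform_expand:
  assumes "s \<in> Alt 3"
  shows "bform s v w = (\<Sum>i\<in>UNIV. \<Sum>j\<in>UNIV. v $ i * w $ j * bform s (axis i 1) (axis j 1))"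
proof -
  have "bform s v w = bform s (\<Sum>i\<in>UNIV. v $ i *\<^sub>R axis i 1) (\<Sum>j\<in>UNIV. w $ j *\<^sub>R axis j 1)"
    by (simp only: basis_expansion scalar_mult_eq_scaleR[symmetric])
  also have "\<dots> = (\<Sum>i\<in>UNIV. v $ i * bform s (axis i 1) (\<Sum>j\<in>UNIV. w $ j *\<^sub>R axis j 1))"
    by (simp only: linear_sum[OF bform_linear(1)[OF assms]] linear_scale[OF bform_linear(1)[OF assms]]
        real_scaleR_def)
  also have "\<dots> = (\<Sum>i\<in>UNIV. \<Sum>j\<in>UNIV. v $ i * w $ j * bform s (axis i 1) (axis j 1))"
    by (simp only: linear_sum[OF bform_linear(2)[OF assms]] linear_scale[OF bform_linear(2)[OF assms]]
        real_scaleR_def sum_distrib_left mult.assoc)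
  finally show ?thesis .
qed

definition bmat :: "V7 form \<Rightarrow> real^7^7" where
  "bmat s = (\<chi> i j. bform s (axis i 1) (axis j 1))"

text \<open>Cramer's rule for the solution x of \<open>bmat s *v x = j\<close>, paired with i. On
  basis vectors this is an entry of the inverse matrix, and thus a rational function of the
  components of s.\<close>

definition binv :: "V7 form \<Rightarrow> V7 \<Rightarrow> V7 \<Rightarrow> real" where
  "binv s i j = (\<chi> k. det (\<chi> p l. if l = k then j $ p else bmat s $ p $ l) / det (bmat s)) \<bullet> i"

text \<open>Since the volume form has norm 1, \<open>\<mu>\<close> satisfies \<open>(6 * \<mu>) ^ 7 * \<mu>\<^sup>2 * c = 1\<close>, where \<open>c\<close> is the
  squared norm of the standard volume form with respect to \<open>bform s\<close>.\<close>

definition g2_mu :: "V7 form \<Rightarrow> real" where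
  "g2_mu s = root 9 (1 / (6 ^ 7 * contraction 7 (binv s) std_vol std_vol))"

text \<open>A vector x in the kernel of the matrix satisfies \<open>bform s x x = 0\<close>, which
  definiteness excludes unless x = 0.\<close>

lemma det_bmat_nonzero:
  assumes "s \<in> definite3"
  shows "det (bmat s) \<noteq> 0"
proof -
  have s: "s \<in> Alt 3" and nz: "\<And>v. v \<noteq> 0 \<Longrightarrow> bform s v v \<noteq> 0"
    using assms by (auto simp: definite3_iff)
  have "x = 0" if "bmat s *v x = 0" for x
  proof -
    have "bform s x x = x \<bullet> (bmat s *v x)"
      unfolding bform_expand[OF s, of x x]
      by (simp add: inner_vec_def matrix_vector_mult_def bmat_def sum_distrib_left mult_ac)
    then show ?thesis using that nz[of x] by auto
  qed
  then have "\<exists>B. B ** bmat s = mat 1"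
    using matrix_left_invertible_ker by blast
  then show ?thesis
    by (metis invertible_det_nz invertible_left_inverse)
qed

lemma contraction_cong:
  assumes "\<And>i j. i \<in> Basis \<Longrightarrow> j \<in> Basis \<Longrightarrow> G i j = G' i j"
  shows "contraction k G \<beta> \<gamma> = contraction k G' \<beta> \<gamma>"
  by (induction k arbitrary: \<beta> \<gamma>) (simp_all add: assms)

text \<open>\<open>dual_metric es\<close> is the inverse matrix of the metric, and inverting
  \<open>bform s\<close> / (6 \<mu>) brings the factor 6 \<mu> to the numerator. The squared norm 1
  of the volume form, homogeneous of degree 7 in the inverse metric and of degree 2 in the form,
  then determines \<mu>^9 and so \<mu>.\<close>

lemma g2_pair_explicit:
  assumes "s \<in> definite3" "g2_pair s (\<lambda>v w. bform s v w / (6 * \<mu>)) (\<lambda>vs. \<mu> * std_vol vs)" "\<mu> \<noteq> 0"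
    "orthonormal_basis (\<lambda>v w. bform s v w / (6 * \<mu>)) es"
  shows "\<And>i j. i \<in> Basis \<Longrightarrow> j \<in> Basis \<Longrightarrow> dual_metric es i j = 6 * \<mu> * binv s i j"
    and "\<mu> = g2_mu s"
proof -
  let ?g = "\<lambda>v w. bform s v w / (6 * \<mu>)"
  have ip: "inner_product_on ?g" and vf: "volume_form_of ?g (\<lambda>vs. \<mu> * std_vol vs)"
    using assms(2) by (auto simp: g2_pair_def)
  have Basis: "(Basis :: V7 set) = range (\<lambda>i. axis i 1)"
    by (auto simp: Basis_vec_def)
  have inj: "inj (\<lambda>i::7. axis i (1::real))" by (auto simp: inj_def axis_eq_axis)
  show G: "dual_metric es i j = 6 * \<mu> * binv s i j" if "i \<in> Basis" "j \<in> Basis" for i j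
  proof -
    let ?x = "\<chi> l. dual_metric es (axis l 1) j / (6 * \<mu>)"
    have "(bmat s *v ?x) $ k = j $ k" for k
    proof -
      have "(bmat s *v ?x) $ k = (\<Sum>l\<in>UNIV. ?g (axis k 1) (axis l 1) * dual_metric es (axis l 1) j)"
        by (simp add: matrix_vector_mult_def bmat_def)
      also have "\<dots> = (\<Sum>i\<in>Basis. ?g (axis k 1) i * dual_metric es i j)"
        unfolding Basis by (simp add: sum.reindex[OF inj])
      also have "\<dots> = (if axis k 1 = j then 1 else 0)"
        by (rule dual_metric_inverse[OF ip assms(4) _ that(2)]) (simp add: Basis)
      also have "\<dots> = j $ k"
        using that(2) unfolding Basis by (auto simp: axis_def vec_eq_iff split: if_splits)
      finally show ?thesis .
    qed
    then have "bmat s *v ?x = j" by (simp add: vec_eq_iff)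
    then have "?x = (\<chi> k. det (\<chi> p l. if l = k then j $ p else bmat s $ p $ l) / det (bmat s))"
      using cramer[OF det_bmat_nonzero[OF assms(1)]] by blast
    then have "binv s i j = ?x \<bullet> i" by (simp add: binv_def)
    also have "\<dots> = dual_metric es i j / (6 * \<mu>)"
      using that(1) unfolding Basis by (auto simp: inner_axis)
    finally show ?thesis using assms(3) by simp
  qed
  let ?c = "contraction 7 (binv s) std_vol std_vol"
  have len: "length es = DIM(V7)" using assms(4) by (simp add: orthonormal_basis_def)
  have volA: "(\<lambda>vs. \<mu> * std_vol vs) \<in> Alt 7" using Alt_scale[OF std_vol_Alt] .
  have "\<bar>\<mu> * std_vol es\<bar> = 1" using vf assms(4) by (simp add: volume_form_of_def)
  then have "1 = (\<mu> * std_vol es) * (\<mu> * std_vol es)"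
    by (metis abs_mult_self_eq mult_1)
  also have "\<dots> = frame_ip es (\<lambda>vs. \<mu> * std_vol vs) (\<lambda>vs. \<mu> * std_vol vs)"
    by (rule frame_ip_top[OF ip len, symmetric]) (use volA in simp)
  also have "\<dots> = contraction 7 (\<lambda>i j. 6 * \<mu> * binv s i j) (\<lambda>vs. \<mu> * std_vol vs) (\<lambda>vs. \<mu> * std_vol vs)"
    unfolding frame_ip_contraction[OF volA Alt_alternating[OF volA]] by (rule contraction_cong[OF G])
  also have "\<dots> = (6 * \<mu>) ^ 7 * (\<mu> * \<mu> * ?c)"
    by (simp only: contraction_scale_metric contraction_scale)
  also have "\<dots> = \<mu> ^ 9 * (6 ^ 7 * ?c)"
    by (simp add: power_mult_distrib power_numeral_reduce)
  finally have "\<mu> ^ 9 * (6 ^ 7 * ?c) = 1" by simp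
  then have "\<mu> ^ 9 = 1 / (6 ^ 7 * ?c)"
    by (metis mult_zero_right nonzero_eq_divide_eq zero_neq_one)
  then show "\<mu> = g2_mu s"
    using odd_real_root_power_cancel[of 9 \<mu>] by (simp add: g2_mu_def)
qed

lemma g2_mu_pair:
  assumes "s \<in> definite3"
  shows "g2_mu s \<noteq> 0"
    "g2_pair s (\<lambda>v w. bform s v w / (6 * g2_mu s)) (\<lambda>vs. g2_mu s * std_vol vs)"
  using g2_pair_exists[OF assms] g2_pair_explicit(2)[OF assms] g2_pair_frame by metis+

text \<open>The formula involves neither a frame nor a choice: each ingredient is an explicit
  function of the components of s.\<close>

lemma star_contraction:
  assumes "s \<in> definite3" "\<beta> \<in> Alt k"
  shows "star s \<beta> ws
    = contraction k (\<lambda>i j. 6 * g2_mu s * binv s i j) \<beta> (\<lambda>us. g2_mu s * std_vol (us @ ws))"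
proof -
  note gv = g2_mu_pair[OF assms(1)]
  obtain es where es: "orthonormal_basis (\<lambda>v w. bform s v w / (6 * g2_mu s)) es"
    using g2_pair_frame[OF gv(2)] by blast
  have "alternating (\<lambda>us. g2_mu s * std_vol (us @ ws))"
    by (rule alternating_scale[OF alternating_append[OF Alt_alternating[OF std_vol_Alt]]])
  then show ?thesis
    unfolding star_frame[OF gv(2) es assms(2)] frame_ip_contraction[OF assms(2) \<open>alternating _\<close>]
    using g2_pair_explicit(1)[OF assms(1) gv(2,1) es] by (intro contraction_cong) auto
qed

lemma differentiable_eventually_cong:
  assumes "\<forall>\<^sub>F y in nhds x. f y = g y" "g differentiable at x"
  shows "f differentiable at x"
proof -
  obtain D where "(g has_derivative D) (at x)" using assms(2) by (auto simp: differentiable_def)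
  moreover have "g x = f x" using eventually_nhds_x_imp_x[OF assms(1)] by simp
  moreover have "\<forall>\<^sub>F y in at x. g y = f y"
    using assms(1) by (auto simp: eventually_at_filter elim: eventually_mono)
  ultimately have "(f has_derivative D) (at x)"
    by (auto intro: has_derivative_transform_eventually)
  then show ?thesis by (auto simp: differentiable_def)
qed

lemma differentiable_prod:
  fixes f :: "'i \<Rightarrow> 'p::real_normed_vector \<Rightarrow> real"
  assumes "finite I" "\<And>i. i \<in> I \<Longrightarrow> f i differentiable at x"
  shows "(\<lambda>y. \<Prod>i\<in>I. f i y) differentiable at x"
  using assms by (induction I) auto

lemma differentiable_wedge:
  fixes \<alpha> :: "'p::real_normed_vector \<Rightarrow> 'a form"
  assumes "\<And>us. (\<lambda>y. \<alpha> y us) differentiable at x" "\<And>us. (\<lambda>y. \<beta> y us) differentiable at x"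
  shows "(\<lambda>y. (\<alpha> y \<and>\<^sub>f \<beta> y) us) differentiable at x"
  unfolding wedge_def using assms by (intro differentiable_sum ballI differentiable_mult) auto

lemma differentiable_det:
  fixes M :: "'p::real_normed_vector \<Rightarrow> real^'n^'n"
  assumes "\<And>i j. (\<lambda>y. M y $ i $ j) differentiable at x"
  shows "(\<lambda>y. det (M y)) differentiable at x"
  unfolding det_def using assms
  by (intro differentiable_sum ballI differentiable_mult differentiable_prod)
    (auto simp: finite_permutations)

lemma differentiable_bform:
  fixes s :: "'p::real_normed_vector \<Rightarrow> V7 form"
  assumes "\<And>us. (\<lambda>y. s y us) differentiable at x"
  shows "(\<lambda>y. bform (s y) v w) differentiable at x"
  unfolding bform_def by (intro differentiable_wedge) (auto simp: interior_product_def assms)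

lemma differentiable_binv:
  fixes s :: "'p::real_normed_vector \<Rightarrow> V7 form"
  assumes "\<And>us. (\<lambda>y. s y us) differentiable at x" "s x \<in> definite3"
  shows "(\<lambda>y. binv (s y) i j) differentiable at x"
proof -
  have "(\<lambda>y. det (\<chi> p l. if l = k then j $ p else bmat (s y) $ p $ l)) differentiable at x" for k
  proof (rule differentiable_det)
    show "(\<lambda>y. (\<chi> p l. if l = k then j $ p else bmat (s y) $ p $ l) $ p $ l) differentiable at x" for p l
      by (cases "l = k") (simp_all add: bmat_def differentiable_bform[OF assms(1)])
  qed
  moreover have "(\<lambda>y. det (bmat (s y))) differentiable at x"
    by (rule differentiable_det) (simp add: bmat_def differentiable_bform[OF assms(1)])
  ultimately show ?thesis
    unfolding binv_def inner_vec_def using det_bmat_nonzero[OF assms(2)]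
    by (intro differentiable_sum ballI) (auto intro!: differentiable_divide differentiable_mult)
qed

lemma differentiable_contraction:
  fixes \<beta> :: "'p::real_normed_vector \<Rightarrow> 'a::euclidean_space form"
  assumes "\<And>i j. (\<lambda>y. G y i j) differentiable at x"
    "\<And>us. (\<lambda>y. \<beta> y us) differentiable at x" "\<And>us. (\<lambda>y. \<gamma> y us) differentiable at x"
  shows "(\<lambda>y. contraction k (G y) (\<beta> y) (\<gamma> y)) differentiable at x"
  using assms(2,3)
proof (induction k arbitrary: \<beta> \<gamma>)
  case (Suc k)
  have "(\<lambda>y. contraction k (G y) (i \<lrcorner> \<beta> y) (j \<lrcorner> \<gamma> y)) differentiable at x" for i j
    by (rule Suc.IH) (simp_all add: interior_product_def Suc.prems)
  then show ?case
    by (auto intro!: differentiable_divide differentiable_sum differentiable_mult assms(1))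
qed (auto intro!: differentiable_mult)

lemma differentiable_g2_mu:
  fixes s :: "'p::real_normed_vector \<Rightarrow> V7 form"
  assumes "\<And>us. (\<lambda>y. s y us) differentiable at x" "s x \<in> definite3"
  shows "(\<lambda>y. g2_mu (s y)) differentiable at x"
proof -
  let ?c = "\<lambda>y. contraction 7 (binv (s y)) std_vol std_vol"
  \<comment> \<open>The ninth root is differentiated away from 0; its argument is nonzero here
    because \<open>g2_mu\<close> is.\<close>
  have "root 9 (1 / (6 ^ 7 * ?c x)) \<noteq> 0" using g2_mu_pair(1)[OF assms(2)] by (simp add: g2_mu_def)
  then have c: "1 / (6 ^ 7 * ?c x) \<noteq> 0" by simp
  have "?c differentiable at x"
    by (rule differentiable_contraction) (simp_all add: differentiable_binv[OF assms])
  then have "(\<lambda>y. 1 / (6 ^ 7 * ?c y)) differentiable at x"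
    using c by (intro differentiable_divide differentiable_mult) auto
  moreover have "root 9 differentiable at (1 / (6 ^ 7 * ?c x))"
    using DERIV_odd_real_root[of 9, OF _ c] by (auto simp: real_differentiable_def)
  ultimately show ?thesis
    unfolding g2_mu_def using differentiable_chain_at by (fastforce simp: o_def)
qed

text \<open>On the unit sphere \<bar>bform (s x) v v\<bar> has a positive minimum m by compactness.
  While the matrix entries change by less than m in total, no unit vector can become null.\<close>

lemma eventually_definite3:
  fixes s :: "'p::real_normed_vector \<Rightarrow> V7 form"
  assumes "\<And>us. (\<lambda>y. s y us) differentiable at x" "s x \<in> definite3" "\<And>y. s y \<in> Alt 3"
  shows "\<forall>\<^sub>F y in nhds x. s y \<in> definite3"
proof -
  let ?B = "\<lambda>y i j. bform (s y) (axis i 1) (axis j 1)"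
  let ?S = "sphere 0 1 :: V7 set"
  have cont: "continuous_on ?S (\<lambda>v. \<bar>bform (s x) v v\<bar>)"
    by (subst bform_expand[OF assms(3)]) (intro continuous_intros)
  have "compact ?S" "?S \<noteq> {}" by auto
  from continuous_attains_inf[OF this cont]
  obtain v0 where v0: "v0 \<in> ?S" "\<And>v. v \<in> ?S \<Longrightarrow> \<bar>bform (s x) v0 v0\<bar> \<le> \<bar>bform (s x) v v\<bar>" by blast
  define m where "m = \<bar>bform (s x) v0 v0\<bar>"
  have "v0 \<noteq> 0" using v0(1) by auto
  then have "m > 0" using assms(2) by (auto simp: m_def definite3_iff)
  let ?h = "\<lambda>y. \<Sum>i\<in>UNIV. \<Sum>j\<in>UNIV. \<bar>?B y i j - ?B x i j\<bar>"
  have "isCont ?h x"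
    by (intro continuous_intros differentiable_imp_continuous_within differentiable_bform assms(1))
  then have "\<forall>\<^sub>F y in at x. ?h y < m"
    unfolding isCont_def using \<open>m > 0\<close> by (intro order_tendstoD(2)) auto
  then have "\<forall>\<^sub>F y in nhds x. ?h y < m"
    using \<open>m > 0\<close> by (auto simp: eventually_at_filter elim: eventually_mono)
  then show ?thesis
  proof (rule eventually_mono)
    fix y assume y: "?h y < m"
    have "bform (s y) v v \<noteq> 0" if v: "norm v = 1" for v
    proof -
      have "\<bar>bform (s y) v v - bform (s x) v v\<bar>
          = \<bar>\<Sum>i\<in>UNIV. \<Sum>j\<in>UNIV. v $ i * v $ j * (?B y i j - ?B x i j)\<bar>"
        unfolding bform_expand[OF assms(3), of _ v v]
        by (simp add: sum_subtractf right_diff_distrib)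
      also have "\<dots> \<le> ?h y"
      proof (rule order_trans[OF sum_abs sum_mono], rule order_trans[OF sum_abs sum_mono])
        fix i j
        have "\<bar>v $ i\<bar> \<le> 1" "\<bar>v $ j\<bar> \<le> 1" using component_le_norm_cart[of v] v by metis+
        then have "\<bar>v $ i\<bar> * \<bar>v $ j\<bar> \<le> 1" by (simp add: mult_le_one)
        then show "\<bar>v $ i * v $ j * (?B y i j - ?B x i j)\<bar> \<le> \<bar>?B y i j - ?B x i j\<bar>"
          by (simp add: abs_mult mult_left_le_one_le)
      qed
      also have "\<dots> < m" by (rule y)
      also have "m \<le> \<bar>bform (s x) v v\<bar>" using v0(2)[of v] v by (simp add: m_def)
      finally show ?thesis by auto
    qed
    note unit = this
    have "bform (s y) v v \<noteq> 0" if "v \<noteq> 0" for v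
    proof -
      have "bform (s y) ((1 / norm v) *\<^sub>R v) ((1 / norm v) *\<^sub>R v)
          = (1 / norm v) * ((1 / norm v) * bform (s y) v v)"
        by (simp only: linear_scale[OF bform_linear(1)[OF assms(3)]]
            linear_scale[OF bform_linear(2)[OF assms(3)]] real_scaleR_def)
      moreover have "norm ((1 / norm v) *\<^sub>R v) = 1" using that by simp
      ultimately show ?thesis using unit by force
    qed
    then show "s y \<in> definite3" using assms(3) by (simp add: definite3_iff)
  qed
qed

text \<open>The contraction formula is available only near x, where s y is still definite. The
  degree of \<beta> y is likewise required only near x, since for the 6-form inside
  \<open>zform\<close> it is known only where s y is definite.\<close>

lemma differentiable_star:
  fixes s \<beta> :: "'p::real_normed_vector \<Rightarrow> V7 form"
  assumes "\<And>us. (\<lambda>y. s y us) differentiable at x" "\<And>us. (\<lambda>y. \<beta> y us) differentiable at x"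
    "s x \<in> definite3" "\<And>y. s y \<in> Alt 3" "\<forall>\<^sub>F y in nhds x. \<beta> y \<in> Alt k"
  shows "(\<lambda>y. star (s y) (\<beta> y) ws) differentiable at x"
proof (rule differentiable_eventually_cong)
  show "\<forall>\<^sub>F y in nhds x. star (s y) (\<beta> y) ws = contraction k
    (\<lambda>i j. 6 * g2_mu (s y) * binv (s y) i j) (\<beta> y) (\<lambda>us. g2_mu (s y) * std_vol (us @ ws))"
    using eventually_definite3[OF assms(1,3,4)] assms(5)
    by eventually_elim (rule star_contraction)
  show "(\<lambda>y. contraction k (\<lambda>i j. 6 * g2_mu (s y) * binv (s y) i j) (\<beta> y)
      (\<lambda>us. g2_mu (s y) * std_vol (us @ ws))) differentiable at x"
    using differentiable_g2_mu[OF assms(1,3)] differentiable_binv[OF assms(1,3)] assms(2)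
    by (intro differentiable_contraction differentiable_mult) auto
qed

lemma differentiable_zform:
  fixes s b :: "'p::real_normed_vector \<Rightarrow> V7 form"
  assumes "\<And>us. (\<lambda>y. s y us) differentiable at x" "\<And>us. (\<lambda>y. b y us) differentiable at x"
    "s x \<in> definite3" "\<And>y. s y \<in> Alt 3" "\<And>y. b y \<in> Alt 2"
  shows "(\<lambda>y. zform (s y) (b y) ws) differentiable at x"
  unfolding zform_def
proof (rule differentiable_star[OF assms(1) _ assms(3,4)])
  show "(\<lambda>y. (b y \<and>\<^sub>f star (s y) (s y)) us) differentiable at x" for us
    by (intro differentiable_wedge assms(2) differentiable_star[OF assms(1,1,3,4), where k = 3]) (simp add: assms(4))
  show "\<forall>\<^sub>F y in nhds x. b y \<and>\<^sub>f star (s y) (s y) \<in> Alt 6"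
    using eventually_definite3[OF assms(1,3,4)]
  proof (rule eventually_mono)
    fix y assume y: "s y \<in> definite3"
    have "star (s y) (s y) \<in> Alt 4" using star_Alt[OF y assms(4)] by simp
    from wedge_Alt[OF assms(5) this, of y] show "b y \<and>\<^sub>f star (s y) (s y) \<in> Alt 6" by simp
  qed
qed

section \<open>Explicit shuffle expansions\<close>

text \<open>Unfolding \<open>wedge_Cons\<close> also produces terms with the arguments distributed
  in other degrees; these vanish by \<open>Alt_length\<close>.\<close>

lemma wedge_Alt_2_5:
  assumes "\<alpha> \<in> Alt 2" "\<beta> \<in> Alt 5"
  shows "(\<alpha> \<and>\<^sub>f \<beta>) [a, b, c, d, e, f, g]
    = \<alpha> [a, b] * \<beta> [c, d, e, f, g] - \<alpha> [a, c] * \<beta> [b, d, e, f, g]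
      + \<alpha> [a, d] * \<beta> [b, c, e, f, g]
      - \<alpha> [a, e] * \<beta> [b, c, d, f, g]
      + \<alpha> [a, f] * \<beta> [b, c, d, e, g]
      - \<alpha> [a, g] * \<beta> [b, c, d, e, f]
      + \<alpha> [b, c] * \<beta> [a, d, e, f, g]
      - \<alpha> [b, d] * \<beta> [a, c, e, f, g]
      + \<alpha> [b, e] * \<beta> [a, c, d, f, g]
      - \<alpha> [b, f] * \<beta> [a, c, d, e, g]
      + \<alpha> [b, g] * \<beta> [a, c, d, e, f]
      + \<alpha> [c, d] * \<beta> [a, b, e, f, g]
      - \<alpha> [c, e] * \<beta> [a, b, d, f, g]
      + \<alpha> [c, f] * \<beta> [a, b, d, e, g]
      - \<alpha> [c, g] * \<beta> [a, b, d, e, f]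
      + \<alpha> [d, e] * \<beta> [a, b, c, f, g]
      - \<alpha> [d, f] * \<beta> [a, b, c, e, g]
      + \<alpha> [d, g] * \<beta> [a, b, c, e, f]
      + \<alpha> [e, f] * \<beta> [a, b, c, d, g]
      - \<alpha> [e, g] * \<beta> [a, b, c, d, f]
      + \<alpha> [f, g] * \<beta> [a, b, c, d, e]"
  by (simp add: wedge_Cons interior_product_def hat_def Alt_length[OF assms(1)] Alt_length[OF assms(2)])

lemma wedge_Alt_2_3:
  assumes "\<alpha> \<in> Alt 2" "\<beta> \<in> Alt 3"
  shows "(\<alpha> \<and>\<^sub>f \<beta>) [a, b, c, d, e]
    = \<alpha> [a, b] * \<beta> [c, d, e] - \<alpha> [a, c] * \<beta> [b, d, e]
      + \<alpha> [a, d] * \<beta> [b, c, e] - \<alpha> [a, e] * \<beta> [b, c, d]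
      + \<alpha> [b, c] * \<beta> [a, d, e] - \<alpha> [b, d] * \<beta> [a, c, e]
      + \<alpha> [b, e] * \<beta> [a, c, d] + \<alpha> [c, d] * \<beta> [a, b, e]
      - \<alpha> [c, e] * \<beta> [a, b, d] + \<alpha> [d, e] * \<beta> [a, b, c]"
  by (simp add: wedge_Cons interior_product_def hat_def Alt_length[OF assms(1)] Alt_length[OF assms(2)])

lemma wedge_Alt_1_4:
  assumes "\<alpha> \<in> Alt 1" "\<beta> \<in> Alt 4"
  shows "(\<alpha> \<and>\<^sub>f \<beta>) [a, b, c, d, e]
    = \<alpha> [a] * \<beta> [b, c, d, e] - \<alpha> [b] * \<beta> [a, c, d, e]
      + \<alpha> [c] * \<beta> [a, b, d, e] - \<alpha> [d] * \<beta> [a, b, c, e]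
      + \<alpha> [e] * \<beta> [a, b, c, d]"
  by (simp add: wedge_Cons interior_product_def hat_def Alt_length[OF assms(1)] Alt_length[OF assms(2)])

lemma wedge_Alt_1_5:
  assumes "\<alpha> \<in> Alt 1" "\<beta> \<in> Alt 5"
  shows "(\<alpha> \<and>\<^sub>f \<beta>) [a, b, c, d, e, f]
    = \<alpha> [a] * \<beta> [b, c, d, e, f] - \<alpha> [b] * \<beta> [a, c, d, e, f]
      + \<alpha> [c] * \<beta> [a, b, d, e, f]
      - \<alpha> [d] * \<beta> [a, b, c, e, f]
      + \<alpha> [e] * \<beta> [a, b, c, d, f]
      - \<alpha> [f] * \<beta> [a, b, c, d, e]"
  by (simp add: wedge_Cons interior_product_def hat_def Alt_length[OF assms(1)] Alt_length[OF assms(2)])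

lemma wedge_Alt_2_4:
  assumes "\<alpha> \<in> Alt 2" "\<beta> \<in> Alt 4"
  shows "(\<alpha> \<and>\<^sub>f \<beta>) [a, b, c, d, e, f]
    = \<alpha> [a, b] * \<beta> [c, d, e, f] - \<alpha> [a, c] * \<beta> [b, d, e, f]
      + \<alpha> [a, d] * \<beta> [b, c, e, f]
      - \<alpha> [a, e] * \<beta> [b, c, d, f]
      + \<alpha> [a, f] * \<beta> [b, c, d, e]
      + \<alpha> [b, c] * \<beta> [a, d, e, f]
      - \<alpha> [b, d] * \<beta> [a, c, e, f]
      + \<alpha> [b, e] * \<beta> [a, c, d, f]
      - \<alpha> [b, f] * \<beta> [a, c, d, e]
      + \<alpha> [c, d] * \<beta> [a, b, e, f]
      - \<alpha> [c, e] * \<beta> [a, b, d, f]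
      + \<alpha> [c, f] * \<beta> [a, b, d, e]
      + \<alpha> [d, e] * \<beta> [a, b, c, f]
      - \<alpha> [d, f] * \<beta> [a, b, c, e]
      + \<alpha> [e, f] * \<beta> [a, b, c, d]"
  by (simp add: wedge_Cons interior_product_def hat_def Alt_length[OF assms(1)] Alt_length[OF assms(2)])

section \<open>The normal form of a definite three-form\<close>

text \<open>The unknowns are components of s in a frame. The letters a, p, q, r, t, u, w stand for
  012, 034, 056, 135, 146, 236, 245, which survive; n, m, r0, k1, k2, l0, l1, h1, h2, c1, c2, c3, c4
  stand for 045, 046, 134, 145, 156, 234, 235, 246, 256, 345, 346, 356, 456. \<open>Eij\<close> is
  the (i, j) entry of the relation defining the metric, divided by 6, and \<epsilon> is the value of
  the volume form on the frame.\<close>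

lemma g2_equations_solve:
  fixes a :: real
  assumes sign: "a > 0" "p \<ge> 0" "r \<ge> 0" "u \<le> 0" "\<bar>\<epsilon>\<bar> = 1"
    and E00: "a * p * q = \<epsilon>"
    and E01: "a * q * r0 - a * m * r + a * p * k2 = 0"
    and E02: "a * q * l0 - a * m * l1 + a * n * u + a * p * h2 = 0"
    and E03: "a * p * c3 = 0"
    and E04: "a * p * c4 - a * n * c2 + a * m * c1 = 0"
    and E05: "- (a * n * c3) + a * q * c1 = 0"
    and E06: "- (a * m * c3) + a * q * c2 = 0"
    and E11: "a * r0 * k2 - a * r * t = \<epsilon>"
    and E12: "a * k2 * l0 - a * t * l1 + a * k1 * u - a * r * h1 + a * r0 * h2 = 0"
    and E22: "a * l0 * h2 - a * l1 * h1 + a * u * w = \<epsilon>"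
    and E33: "- (p * r * u) = \<epsilon>"
    and E34: "- (p * k1 * u) + n * r0 * u + p * t * l1 - m * r0 * l1 - p * r * h1 + m * r * l0 = 0"
    and E35: "- (p * r * h2) + p * k2 * l1 - q * r0 * l1 + q * r * l0 + n * r * u = 0"
    and E36: "p * k2 * u - q * r0 * u + m * r * u = 0"
    and E44: "- (p * k1 * h1) + n * r0 * h1 + p * t * w - m * r0 * w - n * t * l0 + m * k1 * l0 =
      \<epsilon>"
    and E45: "- (p * k1 * h2) + n * r0 * h2 + p * k2 * w - m * r * w - q * r0 * w - n * k2 * l0 + m *
      k1 * l1 + q * k1 * l0 + n * r * h1 - n * t * l1 = 0"
    and E46: "- (p * t * h2) + m * r0 * h2 + p * k2 * h1 - q * r0 * h1 - m * k2 * l0 - n * t * u + q *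
      t * l0 + m * k1 * u = 0"
    and E55: "n * r * h2 - n * k2 * l1 + q * k1 * l1 - q * r * w = \<epsilon>"
    and E56: "- (n * k2 * u) + q * k1 * u - m * k2 * l1 + q * t * l1 - q * r * h1 + m * r * h2 = 0"
    and E66: "- (m * k2 * u) + q * t * u = \<epsilon>"
  shows "\<epsilon> = 1" "a = 1" "p = 1" "q = 1" "r = 1" "t = -1" "u = -1" "w = -1"
    "n = 0" "m = 0" "r0 = 0" "k1 = 0" "k2 = 0" "l0 = 0" "l1 = 0" "h1 = 0" "h2 = 0"
    "c1 = 0" "c2 = 0" "c3 = 0" "c4 = 0"
proof -
  have a: "a \<noteq> 0" and p: "p \<noteq> 0" and q: "q \<noteq> 0" and r: "r \<noteq> 0" and u: "u \<noteq> 0"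
    using E00 E33 sign by auto
  show c3: "c3 = 0" using E03 a p by simp
  show c1: "c1 = 0" using E05 a q c3 by simp
  show c2: "c2 = 0" using E06 a q c3 by simp
  show c4: "c4 = 0" using E04 a p c1 c2 by simp
  \<comment> \<open>After removal of a nonzero factor, suitable pairs of off-diagonal entries read x
    + y = 0 and x - y = 0. Thus x and y vanish separately, and the results simplify the next
    pair.\<close>
  have "a * (q * r0 - m * r + p * k2) = 0" "u * (p * k2 - q * r0 + m * r) = 0"
    using E01 E36 by algebra+
  then have "q * r0 - m * r + p * k2 = 0" "p * k2 - q * r0 + m * r = 0" using a u by auto
  then have "p * k2 = 0" and qr: "q * r0 = m * r" by linarith+
  then show k2: "k2 = 0" using p by simp
  have "a * (q * l0 - m * l1 + n * u + p * h2) = 0" "r * (q * l0 - m * l1 + n * u - p * h2) = 0"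
    using E02 E35 qr k2 by algebra+
  then have "q * l0 - m * l1 + n * u + p * h2 = 0" "q * l0 - m * l1 + n * u - p * h2 = 0"
    using a r by auto
  then have "p * h2 = 0" and ql: "q * l0 - m * l1 + n * u = 0" by linarith+
  then show h2: "h2 = 0" using p by simp
  have art: "- (a * r * t) = \<epsilon>" using E11 k2 by simp
  then have t: "t \<noteq> 0" using sign(5) by auto
  have "a * (k1 * u - t * l1 - r * h1) = 0" "p * (k1 * u - t * l1 + r * h1) = 0"
    using E12 E34 qr ql k2 h2 by algebra+
  then have "k1 * u - t * l1 - r * h1 = 0" "k1 * u - t * l1 + r * h1 = 0" using a p by auto
  then have "r * h1 = 0" and ku: "k1 * u = t * l1" by linarith+
  then show h1: "h1 = 0" using r by simp
  have auw: "a * u * w = \<epsilon>" using E22 h1 h2 by simp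
  then have w: "w \<noteq> 0" using sign(5) by auto
  have "q * (k1 * u + t * l1) = 0" using E56 k2 h1 h2 by algebra
  then have "k1 * u + t * l1 = 0" using q by simp
  then have "k1 * u = 0" "t * l1 = 0" using ku by linarith+
  then show k1: "k1 = 0" and l1: "l1 = 0" using u t by auto
  have "t * (q * l0 - n * u) = 0" using E46 k1 k2 l1 h1 h2 by algebra
  then have "q * l0 - n * u = 0" using t by simp
  then have "q * l0 = 0" "n * u = 0" using ql l1 by auto
  then show l0: "l0 = 0" and n: "n = 0" using q u by auto
  have "w * (m * r + q * r0) = 0" using E45 k1 k2 l0 l1 h1 h2 n by algebra
  then have "m * r + q * r0 = 0" using w by simp
  then have "m * r = 0" "q * r0 = 0" using qr by auto
  then show m: "m = 0" and r0: "r0 = 0" using q r by auto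
  \<comment> \<open>With all other components zero, the seven diagonal entries prescribe up to sign
    the products over the seven lines of the Fano plane on a, p, q, r, t, u, w. Combining four lines
    at a time gives p^2 = r^2 = u^2 = a^2.\<close>
  have pru: "p * r * u = - \<epsilon>" and ptw: "p * t * w = \<epsilon>" and qrw: "q * r * w = - \<epsilon>"
    and qtu: "q * t * u = \<epsilon>" and apq: "a * p * q = \<epsilon>"
    using E33 E44 E55 E66 E00 k1 k2 l0 l1 h1 h2 n m r0 by auto
  \<comment> \<open>The sign conventions imposed on the frame force positive orientation, so the
    orientation does not have to be arranged separately.\<close>
  have "p * r * u \<le> 0" using sign by (simp add: mult_nonneg_nonpos)
  then show \<epsilon>: "\<epsilon> = 1" using pru sign(5) by auto
  have "p\<^sup>2 * (a * u * w) * (a * r * t) = a\<^sup>2 * (p * r * u) * (p * t * w)" by algebra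
  then have "p\<^sup>2 = a\<^sup>2" using auw art pru ptw \<epsilon> by auto
  then have pa: "p = a" using sign by (simp add: power2_eq_iff)
  have "r\<^sup>2 * (a * p * q) * (a * u * w) = a\<^sup>2 * (p * r * u) * (q * r * w)" by algebra
  then have "r\<^sup>2 = a\<^sup>2" using auw apq pru qrw \<epsilon> by auto
  then have ra: "r = a" using sign by (simp add: power2_eq_iff)
  have "u\<^sup>2 * (a * p * q) * (a * r * t) = a\<^sup>2 * (p * r * u) * (q * t * u)" by algebra
  then have "u\<^sup>2 = a\<^sup>2" using art apq pru qtu \<epsilon> by auto
  then have ua: "u = - a" using sign by (auto simp: power2_eq_iff)
  have "a ^ 3 = 1" using pru \<epsilon> unfolding pa ra ua by (simp add: power3_eq_cube)
  then show a1: "a = 1" using sign(1) power_eq_imp_eq_base[of a 3 1] by simp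
  show "p = 1" "r = 1" "u = -1" using pa ra ua a1 by auto
  then show "q = 1" "t = -1" "w = -1" using apq art auw a1 \<epsilon> by auto
qed

lemma interior_3_eval: "(v \<lrcorner> s) [v', v''] = s [v, v', v'']"
  by (simp add: interior_product_def)

lemma alternating_3_rules:
  assumes "s \<in> Alt 3"
  shows "s [x, y, z] = - s [y, x, z]" "s [x, y, z] = - s [x, z, y]"
    "s [x, x, z] = 0" "s [x, z, z] = 0"
  using alternating_swap_front[OF Alt_alternating[OF assms], of x y "[z]"]
    alternating_swap_front[OF alternating_interior[OF Alt_alternating[OF assms], of x], of y z "[]"]
    alternating_repeat[OF Alt_alternating[OF assms], of "[]" x "[z]"]
    alternating_repeat[OF Alt_alternating[OF assms], of "[x]" z "[]"]
  by (simp_all add: interior_product_def)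

text \<open>The values of the three-form
  \<open>e\<^sup>0\<^sup>1\<^sup>2 + e\<^sup>0\<^sup>3\<^sup>4 + e\<^sup>0\<^sup>5\<^sup>6 + e\<^sup>1\<^sup>3\<^sup>5 - e\<^sup>1\<^sup>4\<^sup>6 - e\<^sup>2\<^sup>3\<^sup>6 - e\<^sup>2\<^sup>4\<^sup>5\<close> on increasing triples.\<close>

definition g2_components :: "(nat \<Rightarrow> nat \<Rightarrow> nat \<Rightarrow> real) \<Rightarrow> bool" where
  "g2_components S \<longleftrightarrow>
     S 0 1 2 = 1 \<and> S 0 1 3 = 0 \<and> S 0 1 4 = 0 \<and> S 0 1 5 = 0 \<and> S 0 1 6 = 0 \<and>
     S 0 2 3 = 0 \<and> S 0 2 4 = 0 \<and> S 0 2 5 = 0 \<and> S 0 2 6 = 0 \<and> S 0 3 4 = 1 \<and>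
     S 0 3 5 = 0 \<and> S 0 3 6 = 0 \<and> S 0 4 5 = 0 \<and> S 0 4 6 = 0 \<and> S 0 5 6 = 1 \<and>
     S 1 2 3 = 0 \<and> S 1 2 4 = 0 \<and> S 1 2 5 = 0 \<and> S 1 2 6 = 0 \<and> S 1 3 4 = 0 \<and>
     S 1 3 5 = 1 \<and> S 1 3 6 = 0 \<and> S 1 4 5 = 0 \<and> S 1 4 6 = -1 \<and> S 1 5 6 = 0 \<and>
     S 2 3 4 = 0 \<and> S 2 3 5 = 0 \<and> S 2 3 6 = -1 \<and> S 2 4 5 = -1 \<and> S 2 4 6 = 0 \<and>
     S 2 5 6 = 0 \<and> S 3 4 5 = 0 \<and> S 3 4 6 = 0 \<and> S 3 5 6 = 0 \<and> S 4 5 6 = 0"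

text \<open>A three-form has 35 components. The choice of the frame makes the 15 in
  \<open>zero\<close> vanish, and the relation defining the metric determines the other 20. The
  rules \<open>sw1\<close>, \<open>sw2\<close> and \<open>rep\<close> bring every component to
  increasing indices.\<close>

lemma g2_frame_components:
  fixes s :: "V7 form" and e :: "nat \<Rightarrow> V7"
  defines "S \<equiv> \<lambda>i j k. s [e i, e j, e k]"
  assumes s: "s \<in> Alt 3"
    and eq: "\<And>i j. i < 7 \<Longrightarrow> j < 7 \<Longrightarrow>
      ((e i \<lrcorner> s) \<and>\<^sub>f (e j \<lrcorner> s) \<and>\<^sub>f s) [e 0, e 1, e 2, e 3, e 4, e 5, e 6]
        = (if i = j then 6 * \<epsilon> else 0)"
    and zero: "S 0 1 3 = 0" "S 0 1 4 = 0" "S 0 1 5 = 0" "S 0 1 6 = 0"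
      "S 0 2 3 = 0" "S 0 2 4 = 0" "S 0 2 5 = 0" "S 0 2 6 = 0"
      "S 1 2 3 = 0" "S 1 2 4 = 0" "S 1 2 5 = 0" "S 1 2 6 = 0"
      "S 0 3 5 = 0" "S 0 3 6 = 0" "S 1 3 6 = 0"
    and sign: "S 0 1 2 > 0" "S 0 3 4 \<ge> 0" "S 1 3 5 \<ge> 0" "S 2 3 6 \<le> 0" "\<bar>\<epsilon>\<bar> = 1"
  shows "\<epsilon> = 1" "g2_components S"
proof -
  have sw1: "S i j k = - S j i k" if "j < i" for i j k
    unfolding S_def by (rule alternating_3_rules(1)[OF s])
  have sw2: "S i j k = - S i k j" if "k < j" for i j k
    unfolding S_def by (rule alternating_3_rules(2)[OF s])
  have rep: "S i i k = 0" "S i k k = 0" for i k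
    unfolding S_def by (rule alternating_3_rules[OF s])+
  have A2: "e i \<lrcorner> s \<in> Alt 2" for i using interior_Alt[of s 2] s by simp
  have A5: "(e i \<lrcorner> s) \<and>\<^sub>f s \<in> Alt 5" for i using wedge_Alt[OF A2 s] by simp
  have S: "s [e i, e j, e k] = S i j k" for i j k by (simp add: S_def)
  note T = eq[unfolded wedge_assoc wedge_Alt_2_5[OF A2 A5] wedge_Alt_2_3[OF A2 s] interior_3_eval S]
  note [simp] = sw1 sw2 rep zero and [simp del] = One_nat_def
  have E00: "S 0 1 2 * S 0 3 4 * S 0 5 6 = \<epsilon>"
    using T[of 0 0] by (simp add: algebra_simps)
  have E01: "S 0 1 2 * S 0 5 6 * S 1 3 4 - S 0 1 2 * S 0 4 6 * S 1 3 5 + S 0 1 2 * S 0 3 4 * S 1 5 6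
      = 0"
    using T[of 0 1] by (simp add: algebra_simps)
  have E02: "S 0 1 2 * S 0 5 6 * S 2 3 4 - S 0 1 2 * S 0 4 6 * S 2 3 5 + S 0 1 2 * S 0 4 5 * S 2 3 6
      + S 0 1 2 * S 0 3 4 * S 2 5 6 = 0"
    using T[of 0 2] by (simp add: algebra_simps)
  have E03: "S 0 1 2 * S 0 3 4 * S 3 5 6 = 0"
    using T[of 0 3] by (simp add: algebra_simps)
  have E04: "S 0 1 2 * S 0 3 4 * S 4 5 6 - S 0 1 2 * S 0 4 5 * S 3 4 6 + S 0 1 2 * S 0 4 6 * S 3 4 5
      = 0"
    using T[of 0 4] by (simp add: algebra_simps)
  have E05: "- (S 0 1 2 * S 0 4 5 * S 3 5 6) + S 0 1 2 * S 0 5 6 * S 3 4 5 = 0"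
    using T[of 0 5] by (simp add: algebra_simps)
  have E06: "- (S 0 1 2 * S 0 4 6 * S 3 5 6) + S 0 1 2 * S 0 5 6 * S 3 4 6 = 0"
    using T[of 0 6] by (simp add: algebra_simps)
  have E11: "S 0 1 2 * S 1 3 4 * S 1 5 6 - S 0 1 2 * S 1 3 5 * S 1 4 6 = \<epsilon>"
    using T[of 1 1] by (simp add: algebra_simps)
  have E12: "S 0 1 2 * S 1 5 6 * S 2 3 4 - S 0 1 2 * S 1 4 6 * S 2 3 5 + S 0 1 2 * S 1 4 5 * S 2 3 6
      - S 0 1 2 * S 1 3 5 * S 2 4 6 + S 0 1 2 * S 1 3 4 * S 2 5 6 = 0"
    using T[of 1 2] by (simp add: algebra_simps)
  have E22: "S 0 1 2 * S 2 3 4 * S 2 5 6 - S 0 1 2 * S 2 3 5 * S 2 4 6 + S 0 1 2 * S 2 3 6 * S 2 4 5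
      = \<epsilon>"
    using T[of 2 2] by (simp add: algebra_simps)
  have E33: "- (S 0 3 4 * S 1 3 5 * S 2 3 6) = \<epsilon>"
    using T[of 3 3] by (simp add: algebra_simps)
  have E34: "- (S 0 3 4 * S 1 4 5 * S 2 3 6) + S 0 4 5 * S 1 3 4 * S 2 3 6 + S 0 3 4 * S 1 4 6 *
      S 2 3 5 - S 0 4 6 * S 1 3 4 * S 2 3 5 - S 0 3 4 * S 1 3 5 * S 2 4 6 + S 0 4 6 * S 1 3 5
      * S 2 3 4 = 0"
    using T[of 3 4] by (simp add: algebra_simps)
  have E35: "- (S 0 3 4 * S 1 3 5 * S 2 5 6) + S 0 3 4 * S 1 5 6 * S 2 3 5 - S 0 5 6 * S 1 3 4 *
      S 2 3 5 + S 0 5 6 * S 1 3 5 * S 2 3 4 + S 0 4 5 * S 1 3 5 * S 2 3 6 = 0"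
    using T[of 3 5] by (simp add: algebra_simps)
  have E36: "S 0 3 4 * S 1 5 6 * S 2 3 6 - S 0 5 6 * S 1 3 4 * S 2 3 6 + S 0 4 6 * S 1 3 5 * S 2 3 6
      = 0"
    using T[of 3 6] by (simp add: algebra_simps)
  have E44: "- (S 0 3 4 * S 1 4 5 * S 2 4 6) + S 0 4 5 * S 1 3 4 * S 2 4 6 + S 0 3 4 * S 1 4 6 *
      S 2 4 5 - S 0 4 6 * S 1 3 4 * S 2 4 5 - S 0 4 5 * S 1 4 6 * S 2 3 4 + S 0 4 6 * S 1 4 5
      * S 2 3 4 = \<epsilon>"
    using T[of 4 4] by (simp add: algebra_simps)
  have E45: "- (S 0 3 4 * S 1 4 5 * S 2 5 6) + S 0 4 5 * S 1 3 4 * S 2 5 6 + S 0 3 4 * S 1 5 6 *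
      S 2 4 5 - S 0 4 6 * S 1 3 5 * S 2 4 5 - S 0 5 6 * S 1 3 4 * S 2 4 5 - S 0 4 5 * S 1 5 6
      * S 2 3 4 + S 0 4 6 * S 1 4 5 * S 2 3 5 + S 0 5 6 * S 1 4 5 * S 2 3 4 + S 0 4 5 *
      S 1 3 5 * S 2 4 6 - S 0 4 5 * S 1 4 6 * S 2 3 5 = 0"
    using T[of 4 5] by (simp add: algebra_simps)
  have E46: "- (S 0 3 4 * S 1 4 6 * S 2 5 6) + S 0 4 6 * S 1 3 4 * S 2 5 6 + S 0 3 4 * S 1 5 6 *
      S 2 4 6 - S 0 5 6 * S 1 3 4 * S 2 4 6 - S 0 4 6 * S 1 5 6 * S 2 3 4 - S 0 4 5 * S 1 4 6
      * S 2 3 6 + S 0 5 6 * S 1 4 6 * S 2 3 4 + S 0 4 6 * S 1 4 5 * S 2 3 6 = 0"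
    using T[of 4 6] by (simp add: algebra_simps)
  have E55: "S 0 4 5 * S 1 3 5 * S 2 5 6 - S 0 4 5 * S 1 5 6 * S 2 3 5 + S 0 5 6 * S 1 4 5 * S 2 3 5
      - S 0 5 6 * S 1 3 5 * S 2 4 5 = \<epsilon>"
    using T[of 5 5] by (simp add: algebra_simps)
  have E56: "- (S 0 4 5 * S 1 5 6 * S 2 3 6) + S 0 5 6 * S 1 4 5 * S 2 3 6 - S 0 4 6 * S 1 5 6 *
      S 2 3 5 + S 0 5 6 * S 1 4 6 * S 2 3 5 - S 0 5 6 * S 1 3 5 * S 2 4 6 + S 0 4 6 * S 1 3 5
      * S 2 5 6 = 0"
    using T[of 5 6] by (simp add: algebra_simps)
  have E66: "- (S 0 4 6 * S 1 5 6 * S 2 3 6) + S 0 5 6 * S 1 4 6 * S 2 3 6 = \<epsilon>"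
    using T[of 6 6] by (simp add: algebra_simps)
  note sol = g2_equations_solve[OF sign E00 E01 E02 E03 E04 E05 E06 E11 E12 E22 E33 E34 E35 E36 E44 E45 E46 E55 E56 E66]
  show "\<epsilon> = 1" by (rule sol(1))
  show "g2_components S" unfolding g2_components_def by (simp add: sol(2-))
qed

section \<open>Construction of an adapted orthonormal frame\<close>

lemma ip_representer:
  fixes g :: "'a::euclidean_space \<Rightarrow> 'a \<Rightarrow> real"
  assumes ip: "inner_product_on g" and l: "linear l"
  shows "\<exists>n. \<forall>w. g n w = l w"
proof -
  obtain es where es: "orthonormal_basis g es" using orthonormal_basis_ex[OF ip] by blast
  have "g (\<Sum>e\<leftarrow>es. l e *\<^sub>R e) w = l w" for w
  proof -
    have "l w = l (\<Sum>e\<leftarrow>es. g w e *\<^sub>R e)"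
      using orthonormal_expansion[OF ip es, of w] by simp
    also have "\<dots> = (\<Sum>e\<leftarrow>es. g w e * l e)"
      by (induction es) (simp_all add: linear_0[OF l] linear_add[OF l] linear_scale[OF l])
    also have "\<dots> = g w (\<Sum>e\<leftarrow>es. l e *\<^sub>R e)"
      by (induction es) (simp_all add: linear_0[OF ip_linear(1)[OF ip]] linear_add[OF ip_linear(1)[OF ip]]
          linear_scale[OF ip_linear(1)[OF ip]])
    also have "\<dots> = g (\<Sum>e\<leftarrow>es. l e *\<^sub>R e) w" by (rule ip_sym[OF ip])
    finally show ?thesis ..
  qed
  then show ?thesis by blast
qed

lemma orthogonal_vector_signed:
  fixes g :: "'a::euclidean_space \<Rightarrow> 'a \<Rightarrow> real"
  assumes ip: "inner_product_on g" and "length us < DIM('a)" and l: "linear l"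
  obtains v where "g v v = 1" "\<And>u. u \<in> set us \<Longrightarrow> g v u = 0" "l v \<ge> (0::real)"
proof -
  obtain v where v: "g v v = 1" "\<And>u. u \<in> set us \<Longrightarrow> g v u = 0"
    using orthogonal_vector_exists[OF ip assms(2)] by blast
  have "g (- v) (- v) = 1" "\<And>u. u \<in> set us \<Longrightarrow> g (- v) u = 0"
    using v by (simp_all add: linear_neg[OF ip_linear(1)[OF ip]] linear_neg[OF ip_linear(2)[OF ip]])
  then show ?thesis
    using that[of v] that[of "- v"] v linear_neg[OF l, of v] by (cases "l v \<ge> 0") auto
qed

lemma linear_maximum_on_unit_sphere:
  fixes g :: "'a::euclidean_space \<Rightarrow> 'a \<Rightarrow> real"
  assumes ip: "inner_product_on g" and l: "linear l" and z: "g z z = 1"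
    and max: "\<And>w. g w w = 1 \<Longrightarrow> l w \<le> l z" and pos: "l z > 0"
  shows "l w = l z * g z w"
proof -
  note lin = ip_linear[OF ip]
  define v where "v = w - g z w *\<^sub>R z"
  have zv: "g z v = 0"
    by (simp add: v_def linear_diff[OF lin(1)] linear_scale[OF lin(1)] z)
  then have vz: "g v z = 0" using ip_sym[OF ip, of v z] by simp
  have "l v = 0"
  proof (rule ccontr)
    assume c: "l v \<noteq> 0"
    then have "v \<noteq> 0" using linear_0[OF l] by auto
    then have q: "g v v > 0" using ip_pos[OF ip] by blast
    \<comment> \<open>\<open>?u\<close> represents l on the plane of z and v, so that l and the
      squared norm both take the value \<open>?N\<close> at it. After normalisation l takes the
      value sqrt ?N, which exceeds the supposed maximum l z.\<close>
    let ?u = "l z *\<^sub>R z + (l v / g v v) *\<^sub>R v"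
    let ?N = "(l z)\<^sup>2 + (l v)\<^sup>2 / g v v"
    have "(l v)\<^sup>2 / g v v > 0" using c q by simp
    then have N: "?N > (l z)\<^sup>2" "?N > 0" using pos by (auto intro: add_pos_pos)
    have gu: "g ?u ?u = ?N"
      using q by (simp add: linear_add[OF lin(1)] linear_scale[OF lin(1)] linear_add[OF lin(2)]
          linear_scale[OF lin(2)] z zv vz power2_eq_square)
    have lu: "l ?u = ?N"
      by (simp add: linear_add[OF l] linear_scale[OF l] power2_eq_square)
    have "g ((1 / sqrt ?N) *\<^sub>R ?u) ((1 / sqrt ?N) *\<^sub>R ?u) = (1 / sqrt ?N) * ((1 / sqrt ?N) * ?N)"
      by (simp only: linear_scale[OF lin(1)] linear_scale[OF lin(2)] gu real_scaleR_def)
    also have "\<dots> = 1" using N(2) by (simp add: field_simps flip: power2_eq_square)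
    finally have "l ((1 / sqrt ?N) *\<^sub>R ?u) \<le> l z" by (rule max)
    moreover have "l ((1 / sqrt ?N) *\<^sub>R ?u) = ?N / sqrt ?N"
      by (simp only: linear_scale[OF l] lu real_scaleR_def) simp
    ultimately have "sqrt ?N \<le> l z" using N(2) by (simp add: real_div_sqrt)
    then have "?N \<le> (l z)\<^sup>2" using real_sqrt_le_iff[of ?N "(l z)\<^sup>2"] pos by simp
    then show False using N(1) by simp
  qed
  then show ?thesis by (simp add: v_def linear_diff[OF l] linear_scale[OF l])
qed

text \<open>Expanding the leading argument in the standard basis reduces the claim to fixed
  arguments. It gives the continuity of s on triples and the differentiability of pulled back
  components in bundle transitions.\<close>

lemma differentiable_args:
  fixes \<alpha> :: "'p::real_normed_vector \<Rightarrow> 'a::euclidean_space form"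
  assumes "\<And>us. (\<lambda>y. \<alpha> y us) differentiable at x" "\<And>y. alternating (\<alpha> y)"
    "\<And>f. f \<in> set fs \<Longrightarrow> f differentiable at x"
  shows "(\<lambda>y. \<alpha> y (map (\<lambda>f. f y) fs)) differentiable at x"
  using assms
proof (induction fs arbitrary: \<alpha>)
  case (Cons f fs)
  have "\<alpha> y (map (\<lambda>f. f y) (f # fs)) = (\<Sum>i\<in>Basis. (f y \<bullet> i) * (i \<lrcorner> \<alpha> y) (map (\<lambda>f. f y) fs))" for y
  proof -
    have "\<alpha> y (map (\<lambda>f. f y) (f # fs))
        = \<alpha> y ((\<Sum>i\<in>Basis. (f y \<bullet> i) *\<^sub>R i) # map (\<lambda>f. f y) fs)"
      by (simp add: euclidean_representation)
    also have "\<dots> = (\<Sum>i\<in>Basis. (f y \<bullet> i) * \<alpha> y (i # map (\<lambda>f. f y) fs))"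
      by (simp only: linear_sum[OF alternating_linear_Cons[OF Cons.prems(2)]]
        linear_scale[OF alternating_linear_Cons[OF Cons.prems(2)]] real_scaleR_def)
    finally show ?thesis by (simp add: interior_product_def)
  qed
  moreover have "(\<lambda>y. (i \<lrcorner> \<alpha> y) (map (\<lambda>f. f y) fs)) differentiable at x" for i
  proof (rule Cons.IH)
    show "(\<lambda>y. (i \<lrcorner> \<alpha> y) us) differentiable at x" for us
      by (simp add: interior_product_def Cons.prems(1))
  qed (use Cons.prems in \<open>auto intro: alternating_interior\<close>)
  moreover have "(\<lambda>y. f y \<bullet> i) differentiable at x" for i
  proof -
    obtain D where "(f has_derivative D) (at x)"
      using Cons.prems(3)[of f] by (auto simp: differentiable_def)
    from has_derivative_inner_left[OF this, of i] show ?thesis by (auto simp: differentiable_def)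
  qed
  ultimately show ?case by simp
qed auto

lemma unit_sphere_compact:
  fixes g :: "'a::euclidean_space \<Rightarrow> 'a \<Rightarrow> real"
  assumes ip: "inner_product_on g"
  shows "compact {v. g v v = 1}"
proof -
  note lin = ip_linear[OF ip]
  have "bounded_bilinear g" using ip_bilinear[OF ip] by (simp add: bilinear_conv_bounded_bilinear)
  then have cont: "continuous_on S (\<lambda>v. g v v)" for S
    by (rule bounded_bilinear.continuous_on) (intro continuous_intros)+
  have ne: "sphere (0::'a) 1 \<noteq> {}" by simp
  obtain v0 where v0: "v0 \<in> sphere 0 1" "\<And>v. v \<in> sphere 0 1 \<Longrightarrow> g v0 v0 \<le> g v v"
    using continuous_attains_inf[OF compact_sphere ne cont] by blast
  have m: "g v0 v0 > 0" using v0(1) ip_pos[OF ip, of v0] by (cases "v0 = 0") auto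
  have "norm v \<le> 1 / sqrt (g v0 v0)" if v: "g v v = 1" for v
  proof -
    have "v \<noteq> 0" using v linear_0[OF lin(1)] by auto
    have "g v0 v0 \<le> g ((1 / norm v) *\<^sub>R v) ((1 / norm v) *\<^sub>R v)"
      using \<open>v \<noteq> 0\<close> by (intro v0(2)) simp
    also have "\<dots> = (1 / norm v) * ((1 / norm v) * g v v)"
      by (simp only: linear_scale[OF lin(1)] linear_scale[OF lin(2)] real_scaleR_def)
    finally have "(norm v)\<^sup>2 * g v0 v0 \<le> 1"
      using \<open>v \<noteq> 0\<close> v by (simp add: field_simps power2_eq_square)
    then have "sqrt ((norm v)\<^sup>2 * g v0 v0) \<le> sqrt 1" by (rule real_sqrt_le_mono)
    then show ?thesis using m by (simp add: real_sqrt_mult field_simps)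
  qed
  then have "bounded {v. g v v = 1}" by (auto simp: bounded_iff)
  moreover have "closed {v. g v v = 1}"
    using continuous_closed_preimage_constant[OF cont closed_UNIV, of 1] by simp
  ultimately show ?thesis by (simp add: compact_eq_bounded_closed)
qed

text \<open>At a maximum of \<open>s\<close> over triples of unit vectors each of the three partial functionals is itself
  maximal, hence a multiple of the dual of its maximiser.\<close>

lemma maximal_triple:
  assumes s: "s \<in> Alt 3" "s \<noteq> (\<lambda>us. 0)" and ip: "inner_product_on (g :: V7 \<Rightarrow> V7 \<Rightarrow> real)"
  obtains a x y z where "a > 0" "g x x = 1" "g y y = 1" "g z z = 1"
    "\<And>w. s [x, y, w] = a * g z w" "\<And>w. s [y, z, w] = a * g x w" "\<And>w. s [z, x, w] = a * g y w"
proof -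
  note alt = Alt_alternating[OF s(1)] and lin = ip_linear[OF ip]
  let ?U = "{v. g v v = 1}"
  let ?f = "\<lambda>(x, y, z). s [x, y, z]"
  obtain es where es: "orthonormal_basis g es" using orthonormal_basis_ex[OF ip] by blast
  have unit: "v \<in> ?U" if "v \<in> set es" for v
    using es that by (auto simp: orthonormal_basis_def in_set_conv_nth)
  have "\<exists>S. s (nths es S) \<noteq> 0"
  proof (rule ccontr)
    assume "\<not> ?thesis"
    then have "s vs = 0" for vs
      using alternating_zero_on_span[OF alt, of es vs] orthonormal_basis_span(3)[OF ip es] by auto
    then show False using s(2) by auto
  qed
  then obtain S where S: "s (nths es S) \<noteq> 0" by blast
  then have "length (nths es S) = 3" using Alt_length[OF s(1)] by blast
  then obtain x0 y0 z0 where xyz: "nths es S = [x0, y0, z0]"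
    by (auto simp: numeral_3_eq_3 length_Suc_conv)
  then have U: "x0 \<in> ?U" "y0 \<in> ?U" "z0 \<in> ?U"
    using unit set_nths_subset[of es S] by auto
  have cont: "continuous_on (?U \<times> ?U \<times> ?U) ?f"
  proof -
    have "(\<lambda>p. s (map (\<lambda>f. f p) [fst, fst \<circ> snd, snd \<circ> snd])) differentiable at p" for p :: "V7 \<times> V7 \<times> V7"
      by (rule differentiable_args)
        (auto simp: alt o_def intro!: bounded_linear_imp_differentiable bounded_linear_intros)
    then have "isCont ?f p" for p
      using differentiable_imp_continuous_within by (fastforce simp: case_prod_unfold)
    then show ?thesis by (simp add: continuous_at_imp_continuous_on)
  qed
  have "compact (?U \<times> ?U \<times> ?U)" by (intro compact_Times unit_sphere_compact ip)
  from continuous_attains_sup[OF this _ cont] U obtain x y z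
    where U': "x \<in> ?U" "y \<in> ?U" "z \<in> ?U"
      and max: "\<And>x' y' z'. x' \<in> ?U \<Longrightarrow> y' \<in> ?U \<Longrightarrow> z' \<in> ?U \<Longrightarrow> s [x', y', z'] \<le> s [x, y, z]"
    by fastforce
  \<comment> \<open>Swapping two arguments flips the sign, so one nonzero value makes the maximum
    positive.\<close>
  have "s [x0, y0, z0] \<le> s [x, y, z]" "s [y0, x0, z0] \<le> s [x, y, z]"
    using max U by blast+
  moreover have "s [y0, x0, z0] = - s [x0, y0, z0]" "s [x0, y0, z0] \<noteq> 0"
    using alternating_3_rules(1)[OF s(1), of x0 y0 z0] S xyz by simp_all
  ultimately have pos: "s [x, y, z] > 0" by linarith
  have cyc: "s [u, v, w] = s [v, w, u]" for u v w
    using alternating_3_rules(1)[OF s(1), of u v w] alternating_3_rules(2)[OF s(1), of v u w] by simp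
  have 1: "linear (\<lambda>w. s [u, v, w])" for u v using alternating_linear[OF alt, of "[u, v]" "[]"] by simp
  have max': "s [x, y, w] \<le> s [x, y, z]" "s [y, z, w] \<le> s [y, z, x]" "s [z, x, w] \<le> s [z, x, y]"
    if "g w w = 1" for w
    using max[of x y w] max[of w y z] max[of x w z] U' that
      cyc[of w y z] cyc[of x y z] cyc[of z x w] cyc[of z x y] by auto
  have c: "s [y, z, x] = s [x, y, z]" "s [z, x, y] = s [x, y, z]"
    using cyc[of x y z] cyc[of z x y] by simp_all
  have "g x x = 1" "g y y = 1" "g z z = 1" using U' by auto
  note lm = linear_maximum_on_unit_sphere[OF ip 1 this(3) max'(1) pos]
    linear_maximum_on_unit_sphere[OF ip 1 this(1) max'(2), unfolded c, OF _ pos]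
    linear_maximum_on_unit_sphere[OF ip 1 this(2) max'(3), unfolded c, OF _ pos]
  show ?thesis
    by (rule that[OF pos \<open>g x x = 1\<close> \<open>g y y = 1\<close> \<open>g z z = 1\<close>]) (rule lm; assumption)+
qed

text \<open>The maximal triple x0, x1, x2 makes twelve components vanish: those with two indices
  among 0, 1, 2 and one among 3, ..., 6. Three more are removed by the choice of x5 and x6, and the
  signs of x4, x5, x6 are free to be adjusted. These are the hypotheses of
  \<open>g2_frame_components\<close>.\<close>

lemma g2_frame_exists:
  assumes "s \<in> definite3"
  obtains g vol and e :: "nat \<Rightarrow> V7" where
    "g2_pair s g vol" "orthonormal_basis g (map e [0..<7])" "vol (map e [0..<7]) = 1"
    "g2_components (\<lambda>i j k. s [e i, e j, e k])"
proof -
  have s: "s \<in> Alt 3" using assms by (rule definite3_Alt)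
  note alt = Alt_alternating[OF s]
  have "s \<noteq> (\<lambda>us. 0)"
  proof
    assume "s = (\<lambda>us. 0)"
    then have "bform s v v = 0" for v by (simp add: bform_def)
    then show False using assms by (metis definite3_iff axis_eq_0_iff zero_neq_one)
  qed
  obtain g vol where gv: "g2_pair s g vol" using g2_pair_exists[OF assms] by blast
  then have ip: "inner_product_on g" and vf: "volume_form_of g vol"
    and eqn: "\<And>v w. (v \<lrcorner> s) \<and>\<^sub>f (w \<lrcorner> s) \<and>\<^sub>f s = (\<lambda>vs. 6 * g v w * vol vs)"
    by (auto simp: g2_pair_def)
  obtain a x0 x1 x2 where a: "a > 0" and u: "g x0 x0 = 1" "g x1 x1 = 1" "g x2 x2 = 1"
    and m: "\<And>w. s [x0, x1, w] = a * g x2 w" "\<And>w. s [x1, x2, w] = a * g x0 w"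
      "\<And>w. s [x2, x0, w] = a * g x1 w"
    using maximal_triple[OF s \<open>s \<noteq> _\<close> ip] by metis
  note alt3 = alternating_3_rules[OF s]
  have rep: "s [v, w, v] = 0" for v w using alt3(2)[of v w v] alt3(3)[of v w] by simp
  \<comment> \<open>A repeated argument in \<open>m\<close> makes the left-hand side vanish.\<close>
  have o: "g x0 x1 = 0" "g x0 x2 = 0" "g x1 x2 = 0"
    using m(2)[of x1] m(2)[of x2] m(3)[of x2] rep alt3(4) a by auto
  have lin: "linear (\<lambda>w. s [v, v', w])" for v v' using alternating_linear[OF alt, of "[v, v']" "[]"] by simp
  obtain x3 where x3: "g x3 x3 = 1" "\<And>u. u \<in> set [x0, x1, x2] \<Longrightarrow> g x3 u = 0"
    using orthogonal_vector_exists[OF ip, of "[x0, x1, x2]"] by auto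
  obtain n0 n1 where n: "\<And>w. g n0 w = s [x0, x3, w]" "\<And>w. g n1 w = s [x1, x3, w]"
    using ip_representer[OF ip lin] by metis
  have lin': "linear (\<lambda>w. - s [v, v', w])" for v v'
    by (rule linear_compose_neg[OF lin])
  \<comment> \<open>In the normal form \<open>n0\<close> and \<open>n1\<close> turn out to be x4 and
    x5. Orthogonality to them removes the components 036 and 136 here, and 035 in the choice of x5.
    Never more than six vectors are prescribed, so dimension 7 leaves room for another one.\<close>
  obtain x6 where x6: "g x6 x6 = 1" "\<And>u. u \<in> set [x0, x1, x2, x3, n0, n1] \<Longrightarrow> g x6 u = 0"
      "0 \<le> - s [x2, x3, x6]"
    using orthogonal_vector_signed[OF ip _ lin', of "[x0, x1, x2, x3, n0, n1]" x2 x3] by auto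
  obtain x5 where x5: "g x5 x5 = 1" "\<And>u. u \<in> set [x0, x1, x2, x3, x6, n0] \<Longrightarrow> g x5 u = 0"
      "0 \<le> s [x1, x3, x5]"
    using orthogonal_vector_signed[OF ip _ lin, of "[x0, x1, x2, x3, x6, n0]" x1 x3] by auto
  obtain x4 where x4: "g x4 x4 = 1" "\<And>u. u \<in> set [x0, x1, x2, x3, x5, x6] \<Longrightarrow> g x4 u = 0"
      "0 \<le> s [x0, x3, x4]"
    using orthogonal_vector_signed[OF ip _ lin, of "[x0, x1, x2, x3, x5, x6]" x0 x3] by auto
  define e where "e = (!) [x0, x1, x2, x3, x4, x5, x6]"
  have e: "e 0 = x0" "e 1 = x1" "e 2 = x2" "e 3 = x3" "e 4 = x4" "e 5 = x5" "e 6 = x6"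
    by (simp_all add: e_def)
  have map_e: "map e [0..<7] = [x0, x1, x2, x3, x4, x5, x6]"
  proof -
    have "length [x0, x1, x2, x3, x4, x5, x6] = 7" by simp
    then show ?thesis unfolding e_def by (metis map_nth)
  qed
  note sym = ip_sym[OF ip]
  have orth: "g x0 x1 = 0" "g x0 x2 = 0" "g x0 x3 = 0" "g x0 x4 = 0" "g x0 x5 = 0" "g x0 x6 = 0"
    "g x1 x2 = 0" "g x1 x3 = 0" "g x1 x4 = 0" "g x1 x5 = 0" "g x1 x6 = 0"
    "g x2 x3 = 0" "g x2 x4 = 0" "g x2 x5 = 0" "g x2 x6 = 0"
    "g x3 x4 = 0" "g x3 x5 = 0" "g x3 x6 = 0" "g x4 x5 = 0" "g x4 x6 = 0" "g x5 x6 = 0"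
    "g n0 x5 = 0" "g n0 x6 = 0" "g n1 x6 = 0"
    using o x3(2) x4(2) x5(2) x6(2) x4(2)[of x5] x4(2)[of x6] x5(2)[of x6] by (simp_all add: sym)
  note unit = u x3(1) x4(1) x5(1) x6(1)
  have ge: "g (e i) (e j) = (if i = j then 1 else 0)" if "i < 7" "j < 7" for i j
  proof -
    have "i \<in> {0, 1, 2, 3, 4, 5, 6}" "j \<in> {0, 1, 2, 3, 4, 5, 6}" using that by auto
    then show ?thesis
      using orth unit sym by (elim insertE emptyE) (simp_all only: e if_True, simp_all)
  qed
  have on: "orthonormal_basis g (map e [0..<7])"
    by (simp add: orthonormal_basis_def ge)
  have \<epsilon>: "\<bar>vol (map e [0..<7])\<bar> = 1" using vf on by (simp add: volume_form_of_def)
  have eq: "((e i \<lrcorner> s) \<and>\<^sub>f (e j \<lrcorner> s) \<and>\<^sub>f s) [e 0, e 1, e 2, e 3, e 4, e 5, e 6]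
      = (if i = j then 6 * vol (map e [0..<7]) else 0)" if "i < 7" "j < 7" for i j
    unfolding eqn using ge[OF that] by (simp only: e map_e) simp
  have z: "g x2 v = 0 \<Longrightarrow> s [x0, x1, v] = 0" "g x1 v = 0 \<Longrightarrow> s [x0, x2, v] = 0"
    "g x0 v = 0 \<Longrightarrow> s [x1, x2, v] = 0" for v
    using m alt3(1)[of x0 x2 v] by simp_all
  have zeros: "s [x0, x1, x3] = 0" "s [x0, x1, x4] = 0" "s [x0, x1, x5] = 0" "s [x0, x1, x6] = 0"
    "s [x0, x2, x3] = 0" "s [x0, x2, x4] = 0" "s [x0, x2, x5] = 0" "s [x0, x2, x6] = 0"
    "s [x1, x2, x3] = 0" "s [x1, x2, x4] = 0" "s [x1, x2, x5] = 0" "s [x1, x2, x6] = 0"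
    by (simp_all only: z orth)
  have zeros': "s [x0, x3, x5] = 0" "s [x0, x3, x6] = 0" "s [x1, x3, x6] = 0"
    unfolding n[symmetric] by (rule orth)+
  have signs: "s [x0, x1, x2] > 0" "s [x0, x3, x4] \<ge> 0" "s [x1, x3, x5] \<ge> 0" "s [x2, x3, x6] \<le> 0"
    using x4(3) x5(3) x6(3) m(1)[of x2] u a by simp_all
  have "vol (map e [0..<7]) = 1 \<and> g2_components (\<lambda>i j k. s [e i, e j, e k])"
    by (intro conjI g2_frame_components[of s e "vol (map e [0..<7])", OF s eq];
        (assumption | simp only: e zeros zeros' signs \<epsilon>))
  then show ?thesis using that gv on by blast
qed

section \<open>The Hodge star in a frame in normal form\<close>

lemma nths_in_subseqs: "nths xs S \<in> set (subseqs xs)"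
proof (induction xs arbitrary: S)
  case (Cons x xs)
  then show ?case by (auto simp: nths_Cons Let_def)
qed simp

text \<open>In terms of \<open>subseqs\<close> the increasing sublists of an explicit frame can be
  enumerated by simplification.\<close>

lemma Alt_eq_on_subseqs:
  assumes "\<alpha> \<in> Alt k" "\<beta> \<in> Alt k" "span (set es) = UNIV"
    "\<And>us. us \<in> set (filter (\<lambda>us. length us = k) (subseqs es)) \<Longrightarrow> \<alpha> us = \<beta> us"
  shows "\<alpha> = \<beta>"
  by (rule Alt_eq_on_frame[OF assms(1-3)])
    (auto intro!: assms(4) nths_in_subseqs simp: length_nths_subset)

text \<open>A k-element index set other than \<open>is\<close> meets \<open>js\<close>, and the
  repeated argument makes \<open>vol\<close> vanish. Only the complement of \<open>js\<close>
  contributes.\<close>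

lemma frame_ip_complement:
  assumes "\<beta> \<in> Alt k" "alternating vol" "sorted is" "distinct (is @ js)" "set (is @ js) = {..<n}"
    "length is = k"
  shows "frame_ip (map e [0..<n]) \<beta> (\<lambda>us. vol (us @ map e js)) = \<beta> (map e is) * vol (map e (is @ js))"
proof -
  have set_nths_upt: "set (nths [0..<n] S) = S" if "S \<subseteq> {..<n}" for S
    using that by (force simp: set_nths)
  have is_sub: "set is \<subseteq> {..<n}" using assms(5) by auto
  have is_eq: "nths [0..<n] (set is) = is"
    by (rule sorted_distinct_set_unique)
      (use assms(3,4) in \<open>auto simp: set_nths_upt[OF is_sub] intro: sorted_nths distinct_nthsI\<close>)
  have "frame_ip (map e [0..<n]) \<beta> (\<lambda>us. vol (us @ map e js))
      = (\<Sum>S\<in>{set is}. \<beta> (nths (map e [0..<n]) S) * vol (nths (map e [0..<n]) S @ map e js))"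
    unfolding frame_ip_def
  proof (rule sum.mono_neutral_right)
    show "\<forall>S\<in>Pow {..<length (map e [0..<n])} - {set is}.
        \<beta> (nths (map e [0..<n]) S) * vol (nths (map e [0..<n]) S @ map e js) = 0"
    proof
      fix S assume "S \<in> Pow {..<length (map e [0..<n])} - {set is}"
      then have S: "S \<subseteq> {..<n}" "S \<noteq> set is" by auto
      show "\<beta> (nths (map e [0..<n]) S) * vol (nths (map e [0..<n]) S @ map e js) = 0"
      proof (cases "card S = k")
        case True
        have "card (set is) = k" using assms(4,6) distinct_card by force
        then have "\<not> S \<subseteq> set is" using True S(2) by (metis card_subset_eq List.finite_set)
        then obtain j where "j \<in> S" "j \<in> set js" using S(1) assms(5) by auto
        then have "\<not> distinct (map e (nths [0..<n] S @ js))"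
          using set_nths_upt[OF S(1)] by (auto simp: distinct_map)
        then have "vol (map e (nths [0..<n] S @ js)) = 0"
          using assms(2) unfolding alternating_def by blast
        then show ?thesis by (simp add: nths_map)
      next
        case False
        then have "length (nths (map e [0..<n]) S) \<noteq> k" using S(1) by (simp add: length_nths_subset)
        then show ?thesis using Alt_length[OF assms(1)] by simp
      qed
    qed
  qed (use is_sub in auto)
  then show ?thesis by (simp add: nths_map is_eq)
qed

context
  fixes s :: "V7 form" and g :: "V7 \<Rightarrow> V7 \<Rightarrow> real" and vol :: "V7 form" and e :: "nat \<Rightarrow> V7"
  assumes s: "s \<in> Alt 3" and gv: "g2_pair s g vol" and on: "orthonormal_basis g (map e [0..<7])"
    and vol_e: "vol (map e [0..<7]) = 1" and comps: "g2_components (\<lambda>i j k. s [e i, e j, e k])"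
begin

lemma star_on_frame:
  assumes "\<beta> \<in> Alt k" "sorted is" "distinct (is @ js)" "set (is @ js) = {..<7}" "length is = k"
  shows "star s \<beta> (map e js) = \<beta> (map e is) * vol (map e (is @ js))"
  using star_frame[OF gv on assms(1)] frame_ip_complement[OF assms(1) _ assms(2-5), of vol e] gv
  by (auto simp: g2_pair_def volume_form_of_def Alt_def)

lemma alternating_vol: "alternating vol"
  using gv by (simp add: g2_pair_def volume_form_of_def Alt_def)

text \<open>Each rule applies only to a descending pair of indices, so rewriting sorts the arguments
  and thereby computes the sign of the permutation.\<close>

lemma vol_swap:
  shows "b < a \<Longrightarrow> vol [e a, e b, e c, e d, e i, e j, e k] = - vol [e b, e a, e c, e d, e i, e j, e k]"
    "c < b \<Longrightarrow> vol [e a, e b, e c, e d, e i, e j, e k] = - vol [e a, e c, e b, e d, e i, e j, e k]"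
    "d < c \<Longrightarrow> vol [e a, e b, e c, e d, e i, e j, e k] = - vol [e a, e b, e d, e c, e i, e j, e k]"
    "i < d \<Longrightarrow> vol [e a, e b, e c, e d, e i, e j, e k] = - vol [e a, e b, e c, e i, e d, e j, e k]"
    "j < i \<Longrightarrow> vol [e a, e b, e c, e d, e i, e j, e k] = - vol [e a, e b, e c, e d, e j, e i, e k]"
    "k < j \<Longrightarrow> vol [e a, e b, e c, e d, e i, e j, e k] = - vol [e a, e b, e c, e d, e i, e k, e j]"
  using alternating_swap[of vol "[]" "e a" "e b"] alternating_swap[of vol "[e a]" "e b" "e c"]
    alternating_swap[of vol "[e a, e b]" "e c" "e d"]
    alternating_swap[of vol "[e a, e b, e c]" "e d" "e i"]
    alternating_swap[of vol "[e a, e b, e c, e d]" "e i" "e j"]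
    alternating_swap[of vol "[e a, e b, e c, e d, e i]" "e j" "e k"]
    alternating_vol[unfolded alternating_iff] by simp_all

lemma map_e_upt: "map e [0..<7] = [e 0, e 1, e 2, e 3, e 4, e 5, e 6]"
  by (simp add: upt_rec numeral_eq_Suc)

lemma vol_sorted: "vol [e 0, e 1, e 2, e 3, e 4, e 5, e 6] = 1"
  using vol_e by (simp only: map_e_upt)

lemma set_7: "{..<7::nat} = {0, 1, 2, 3, 4, 5, 6}"
  by auto

lemmas frame_simps = set_7 insert_commute vol_swap vol_sorted

lemmas star_3_on_frame = star_on_frame[OF s]

text \<open>Each component of the dual 4-form is the component of s on the complementary triple,
  times the sign of the resulting permutation.\<close>

lemma star_self_components:
  shows "star s s [e 0, e 1, e 2, e 3] = 0" "star s s [e 0, e 1, e 2, e 4] = 0"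
    "star s s [e 0, e 1, e 2, e 5] = 0" "star s s [e 0, e 1, e 2, e 6] = 0"
    "star s s [e 0, e 1, e 3, e 4] = 0" "star s s [e 0, e 1, e 3, e 5] = 0"
    "star s s [e 0, e 1, e 3, e 6] = -1" "star s s [e 0, e 1, e 4, e 5] = -1"
    "star s s [e 0, e 1, e 4, e 6] = 0" "star s s [e 0, e 1, e 5, e 6] = 0"
    "star s s [e 0, e 2, e 3, e 4] = 0" "star s s [e 0, e 2, e 3, e 5] = -1"
    "star s s [e 0, e 2, e 3, e 6] = 0" "star s s [e 0, e 2, e 4, e 5] = 0"
    "star s s [e 0, e 2, e 4, e 6] = 1" "star s s [e 0, e 2, e 5, e 6] = 0"
    "star s s [e 0, e 3, e 4, e 5] = 0" "star s s [e 0, e 3, e 4, e 6] = 0"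
    "star s s [e 0, e 3, e 5, e 6] = 0" "star s s [e 0, e 4, e 5, e 6] = 0"
    "star s s [e 1, e 2, e 3, e 4] = 1" "star s s [e 1, e 2, e 3, e 5] = 0"
    "star s s [e 1, e 2, e 3, e 6] = 0" "star s s [e 1, e 2, e 4, e 5] = 0"
    "star s s [e 1, e 2, e 4, e 6] = 0" "star s s [e 1, e 2, e 5, e 6] = 1"
    "star s s [e 1, e 3, e 4, e 5] = 0" "star s s [e 1, e 3, e 4, e 6] = 0"
    "star s s [e 1, e 3, e 5, e 6] = 0" "star s s [e 1, e 4, e 5, e 6] = 0"
    "star s s [e 2, e 3, e 4, e 5] = 0" "star s s [e 2, e 3, e 4, e 6] = 0"
    "star s s [e 2, e 3, e 5, e 6] = 0" "star s s [e 2, e 4, e 5, e 6] = 0"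
    "star s s [e 3, e 4, e 5, e 6] = 1"
  supply [simp] = frame_simps comps[unfolded g2_components_def] and [simp del] = One_nat_def
  by (use star_3_on_frame[of "[4, 5, 6]" "[0, 1, 2, 3]"] in simp, use star_3_on_frame[of "[3, 5, 6]" "[0, 1, 2, 4]"] in simp,
      use star_3_on_frame[of "[3, 4, 6]" "[0, 1, 2, 5]"] in simp, use star_3_on_frame[of "[3, 4, 5]" "[0, 1, 2, 6]"] in simp,
      use star_3_on_frame[of "[2, 5, 6]" "[0, 1, 3, 4]"] in simp, use star_3_on_frame[of "[2, 4, 6]" "[0, 1, 3, 5]"] in simp,
      use star_3_on_frame[of "[2, 4, 5]" "[0, 1, 3, 6]"] in simp, use star_3_on_frame[of "[2, 3, 6]" "[0, 1, 4, 5]"] in simp,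
      use star_3_on_frame[of "[2, 3, 5]" "[0, 1, 4, 6]"] in simp, use star_3_on_frame[of "[2, 3, 4]" "[0, 1, 5, 6]"] in simp,
      use star_3_on_frame[of "[1, 5, 6]" "[0, 2, 3, 4]"] in simp, use star_3_on_frame[of "[1, 4, 6]" "[0, 2, 3, 5]"] in simp,
      use star_3_on_frame[of "[1, 4, 5]" "[0, 2, 3, 6]"] in simp, use star_3_on_frame[of "[1, 3, 6]" "[0, 2, 4, 5]"] in simp,
      use star_3_on_frame[of "[1, 3, 5]" "[0, 2, 4, 6]"] in simp, use star_3_on_frame[of "[1, 3, 4]" "[0, 2, 5, 6]"] in simp,
      use star_3_on_frame[of "[1, 2, 6]" "[0, 3, 4, 5]"] in simp, use star_3_on_frame[of "[1, 2, 5]" "[0, 3, 4, 6]"] in simp,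
      use star_3_on_frame[of "[1, 2, 4]" "[0, 3, 5, 6]"] in simp, use star_3_on_frame[of "[1, 2, 3]" "[0, 4, 5, 6]"] in simp,
      use star_3_on_frame[of "[0, 5, 6]" "[1, 2, 3, 4]"] in simp, use star_3_on_frame[of "[0, 4, 6]" "[1, 2, 3, 5]"] in simp,
      use star_3_on_frame[of "[0, 4, 5]" "[1, 2, 3, 6]"] in simp, use star_3_on_frame[of "[0, 3, 6]" "[1, 2, 4, 5]"] in simp,
      use star_3_on_frame[of "[0, 3, 5]" "[1, 2, 4, 6]"] in simp, use star_3_on_frame[of "[0, 3, 4]" "[1, 2, 5, 6]"] in simp,
      use star_3_on_frame[of "[0, 2, 6]" "[1, 3, 4, 5]"] in simp, use star_3_on_frame[of "[0, 2, 5]" "[1, 3, 4, 6]"] in simp,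
      use star_3_on_frame[of "[0, 2, 4]" "[1, 3, 5, 6]"] in simp, use star_3_on_frame[of "[0, 2, 3]" "[1, 4, 5, 6]"] in simp,
      use star_3_on_frame[of "[0, 1, 6]" "[2, 3, 4, 5]"] in simp, use star_3_on_frame[of "[0, 1, 5]" "[2, 3, 4, 6]"] in simp,
      use star_3_on_frame[of "[0, 1, 4]" "[2, 3, 5, 6]"] in simp, use star_3_on_frame[of "[0, 1, 3]" "[2, 4, 5, 6]"] in simp,
      use star_3_on_frame[of "[0, 1, 2]" "[3, 4, 5, 6]"] in simp)

lemma s_definite3: "s \<in> definite3"
  using g2_pair_definite3[OF s gv] .

lemma star_s_Alt: "star s s \<in> Alt 4"
  using star_Alt[OF s_definite3 s] by simp

context
  fixes b :: "V7 form"
  assumes b: "b \<in> Alt 2"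
begin

lemmas star_6_on_frame = star_on_frame[OF wedge_Alt[OF b star_s_Alt]]

text \<open>The right-hand sides are the contraction of b with s: the value at e_i is the sum over j
  < k of s(e_i, e_j, e_k) b(e_j, e_k).\<close>

lemma zform_components:
  shows "zform s b [e 0] = b [e 1, e 2] + b [e 3, e 4] + b [e 5, e 6]"
    "zform s b [e 1] = - b [e 0, e 2] + b [e 3, e 5] - b [e 4, e 6]"
    "zform s b [e 2] = b [e 0, e 1] - b [e 3, e 6] - b [e 4, e 5]"
    "zform s b [e 3] = - b [e 0, e 4] - b [e 1, e 5] + b [e 2, e 6]"
    "zform s b [e 4] = b [e 0, e 3] + b [e 1, e 6] + b [e 2, e 5]"
    "zform s b [e 5] = - b [e 0, e 6] + b [e 1, e 3] - b [e 2, e 4]"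
    "zform s b [e 6] = b [e 0, e 5] - b [e 1, e 4] - b [e 2, e 3]"
  supply [simp] = frame_simps zform_def wedge_Alt_2_4[OF b star_s_Alt] star_self_components and [simp del] = One_nat_def
  by (use star_6_on_frame[of "[1, 2, 3, 4, 5, 6]" "[0]"] in simp, use star_6_on_frame[of "[0, 2, 3, 4, 5, 6]" "[1]"] in simp,
      use star_6_on_frame[of "[0, 1, 3, 4, 5, 6]" "[2]"] in simp, use star_6_on_frame[of "[0, 1, 2, 4, 5, 6]" "[3]"] in simp,
      use star_6_on_frame[of "[0, 1, 2, 3, 5, 6]" "[4]"] in simp, use star_6_on_frame[of "[0, 1, 2, 3, 4, 6]" "[5]"] in simp,
      use star_6_on_frame[of "[0, 1, 2, 3, 4, 5]" "[6]"] in simp)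

lemma zform_Alt: "zform s b \<in> Alt 1"
  using star_Alt[OF s_definite3 wedge_Alt[OF b star_s_Alt]] by (simp add: zform_def)

text \<open>Both sides are 5-forms, hence determined by 21 components, and each comparison is a
  linear identity in the components of b.\<close>

lemma star_eq_in_frame:
  "(\<lambda>us. star s b us + (b \<and>\<^sub>f s) us) = zform s b \<and>\<^sub>f star s s"
proof (rule Alt_eq_on_subseqs[of _ 5 _ "map e [0..<7]"])
  show "(\<lambda>us. star s b us + (b \<and>\<^sub>f s) us) \<in> Alt 5"
    using Alt_add[of "star s b" 5] star_Alt[OF s_definite3 b] wedge_Alt[OF b s] by simp
  show "zform s b \<and>\<^sub>f star s s \<in> Alt 5" using wedge_Alt[OF zform_Alt star_s_Alt] by simp
  show "span (set (map e [0..<7])) = UNIV"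
    using orthonormal_basis_span(3)[OF _ on] gv by (simp add: g2_pair_def)
  note [simp] = frame_simps comps[unfolded g2_components_def] star_self_components
    and [simp del] = One_nat_def
  note star_2_on_frame = star_on_frame[OF b]
  have *: "star s b [e 0, e 1, e 2, e 3, e 4] = b [e 5, e 6]"
    "star s b [e 0, e 1, e 2, e 3, e 5] = - b [e 4, e 6]"
    "star s b [e 0, e 1, e 2, e 3, e 6] = b [e 4, e 5]"
    "star s b [e 0, e 1, e 2, e 4, e 5] = b [e 3, e 6]"
    "star s b [e 0, e 1, e 2, e 4, e 6] = - b [e 3, e 5]"
    "star s b [e 0, e 1, e 2, e 5, e 6] = b [e 3, e 4]"
    "star s b [e 0, e 1, e 3, e 4, e 5] = - b [e 2, e 6]"
    "star s b [e 0, e 1, e 3, e 4, e 6] = b [e 2, e 5]"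
    "star s b [e 0, e 1, e 3, e 5, e 6] = - b [e 2, e 4]"
    "star s b [e 0, e 1, e 4, e 5, e 6] = b [e 2, e 3]"
    "star s b [e 0, e 2, e 3, e 4, e 5] = b [e 1, e 6]"
    "star s b [e 0, e 2, e 3, e 4, e 6] = - b [e 1, e 5]"
    "star s b [e 0, e 2, e 3, e 5, e 6] = b [e 1, e 4]"
    "star s b [e 0, e 2, e 4, e 5, e 6] = - b [e 1, e 3]"
    "star s b [e 0, e 3, e 4, e 5, e 6] = b [e 1, e 2]"
    "star s b [e 1, e 2, e 3, e 4, e 5] = - b [e 0, e 6]"
    "star s b [e 1, e 2, e 3, e 4, e 6] = b [e 0, e 5]"
    "star s b [e 1, e 2, e 3, e 5, e 6] = - b [e 0, e 4]"
    "star s b [e 1, e 2, e 4, e 5, e 6] = b [e 0, e 3]"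
    "star s b [e 1, e 3, e 4, e 5, e 6] = - b [e 0, e 2]"
    "star s b [e 2, e 3, e 4, e 5, e 6] = b [e 0, e 1]"
    by (use star_2_on_frame[of "[5, 6]" "[0, 1, 2, 3, 4]"] in simp, use star_2_on_frame[of "[4, 6]" "[0, 1, 2, 3, 5]"] in simp,
      use star_2_on_frame[of "[4, 5]" "[0, 1, 2, 3, 6]"] in simp, use star_2_on_frame[of "[3, 6]" "[0, 1, 2, 4, 5]"] in simp,
      use star_2_on_frame[of "[3, 5]" "[0, 1, 2, 4, 6]"] in simp, use star_2_on_frame[of "[3, 4]" "[0, 1, 2, 5, 6]"] in simp,
      use star_2_on_frame[of "[2, 6]" "[0, 1, 3, 4, 5]"] in simp, use star_2_on_frame[of "[2, 5]" "[0, 1, 3, 4, 6]"] in simp,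
      use star_2_on_frame[of "[2, 4]" "[0, 1, 3, 5, 6]"] in simp, use star_2_on_frame[of "[2, 3]" "[0, 1, 4, 5, 6]"] in simp,
      use star_2_on_frame[of "[1, 6]" "[0, 2, 3, 4, 5]"] in simp, use star_2_on_frame[of "[1, 5]" "[0, 2, 3, 4, 6]"] in simp,
      use star_2_on_frame[of "[1, 4]" "[0, 2, 3, 5, 6]"] in simp, use star_2_on_frame[of "[1, 3]" "[0, 2, 4, 5, 6]"] in simp,
      use star_2_on_frame[of "[1, 2]" "[0, 3, 4, 5, 6]"] in simp, use star_2_on_frame[of "[0, 6]" "[1, 2, 3, 4, 5]"] in simp,
      use star_2_on_frame[of "[0, 5]" "[1, 2, 3, 4, 6]"] in simp, use star_2_on_frame[of "[0, 4]" "[1, 2, 3, 5, 6]"] in simp,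
      use star_2_on_frame[of "[0, 3]" "[1, 2, 4, 5, 6]"] in simp, use star_2_on_frame[of "[0, 2]" "[1, 3, 4, 5, 6]"] in simp,
      use star_2_on_frame[of "[0, 1]" "[2, 3, 4, 5, 6]"] in simp)
  have "\<forall>us\<in>set (filter (\<lambda>us. length us = 5) (subseqs (map e [0..<7]))).
      star s b us + (b \<and>\<^sub>f s) us = (zform s b \<and>\<^sub>f star s s) us"
    unfolding map_e_upt by (simp add: Let_def * wedge_Alt_2_3[OF b s] zform_components
        wedge_Alt_1_4[OF zform_Alt star_s_Alt])
  then show "star s b us + (b \<and>\<^sub>f s) us = (zform s b \<and>\<^sub>f star s s) us"
    if "us \<in> set (filter (\<lambda>us. length us = 5) (subseqs (map e [0..<7])))" for us
    using that by blast
qed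

end

end

lemma star_add_wedge:
  assumes "s \<in> definite3" "b \<in> Alt 2"
  shows "star s b us + (b \<and>\<^sub>f s) us = (zform s b \<and>\<^sub>f star s s) us"
proof -
  obtain g vol e where "g2_pair s g vol" "orthonormal_basis g (map e [0..<7])"
      "vol (map e [0..<7]) = 1" "g2_components (\<lambda>i j k. s [e i, e j, e k])"
    using g2_frame_exists[OF assms(1)] .
  from star_eq_in_frame[OF definite3_Alt[OF assms(1)] this assms(2)]
  show ?thesis by (simp add: fun_eq_iff)
qed

section \<open>Existence of a definite form and of a point with nonzero six-form\<close>

lemma covectors_2: "covectors [u, w] [x, y] = u x * w y - w x * u y"
  by (simp add: wedge_Cons interior_product_def hat_def unit_form_def)

lemma covectors_3: "covectors [u, v, w] [x, y, z] =
    u x * (v y * w z - w y * v z) - u y * (v x * w z - w x * v z) + u z * (v x * w y - w x * v y)"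
  by (simp add: wedge_Cons interior_product_def hat_def unit_form_def algebra_simps)

lemma exists_nonzero_six_form:
  assumes "s \<in> definite3"
  shows "\<exists>b\<in>Alt 2. zform s b \<and>\<^sub>f b \<and>\<^sub>f s \<noteq> zero_form"
proof -
  obtain g vol and e :: "nat \<Rightarrow> V7" where gv: "g2_pair s g vol"
    and on: "orthonormal_basis g (map e [0..<7])"
    and rest: "vol (map e [0..<7]) = 1" "g2_components (\<lambda>i j k. s [e i, e j, e k])"
    using g2_frame_exists[OF assms] .
  have s: "s \<in> Alt 3" using assms by (rule definite3_Alt)
  have ip: "inner_product_on g" using gv by (simp add: g2_pair_def)
  have ge: "g (e i) (e j) = (if i = j then 1 else 0)" if "i < 7" "j < 7" for i j
    using on that by (simp add: orthonormal_basis_def)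
  \<comment> \<open>A single product does not suffice: for b = e^01 one gets z = e^2, and e^2 e^01 s
    vanishes because every term of s contains 0, 1 or 2. The summand e^23 adds -e^6 to z, and the
    term -e^245 of s then gives the coefficient -1 at 012456.\<close>
  define b where "b = (\<lambda>us. covectors [g (e 0), g (e 1)] us + covectors [g (e 2), g (e 3)] us)"
  have "covectors [g v, g w] \<in> Alt 2" for v w
    using covectors_Alt[of "[g v, g w]"] ip_linear(1)[OF ip]
    by (auto simp: numeral_2_eq_2 simp del: covectors.simps)
  then have b: "b \<in> Alt 2" unfolding b_def by (intro Alt_add)
  note frame = s gv on rest
  note z = zform_Alt[OF frame b] zform_components[OF frame b]
  have bs: "b \<and>\<^sub>f s \<in> Alt 5" using wedge_Alt[OF b s] by simp
  have be: "b [e i, e j] = (if i = 0 \<and> j = 1 \<or> i = 2 \<and> j = 3 then 1 else 0)" if "i < j" "j < 7" for i j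
    using that by (auto simp: b_def covectors_2 ge simp del: covectors.simps)
  note [simp] = rest(2)[unfolded g2_components_def] be z(2-) and [simp del] = One_nat_def
  have "(zform s b \<and>\<^sub>f b \<and>\<^sub>f s) [e 0, e 1, e 2, e 4, e 5, e 6] = -1"
    unfolding wedge_assoc wedge_Alt_1_5[OF z(1) bs] wedge_Alt_2_3[OF b s] by simp
  then have "zform s b \<and>\<^sub>f b \<and>\<^sub>f s \<noteq> zero_form" unfolding zero_form_def by fastforce
  then show ?thesis using b by blast
qed

text \<open>The converse of \<open>g2_frame_components\<close>: the normal form satisfies the
  relation defining the metric in its own frame, which makes it possible to write down a definite
  form.\<close>

lemma g2_components_products:
  fixes e :: "nat \<Rightarrow> V7"
  assumes s: "s \<in> Alt 3" and comps: "g2_components (\<lambda>i j k. s [e i, e j, e k])" and "i < 7" "j < 7"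
  shows "((e i \<lrcorner> s) \<and>\<^sub>f (e j \<lrcorner> s) \<and>\<^sub>f s) [e 0, e 1, e 2, e 3, e 4, e 5, e 6] = (if i = j then 6 else 0)"
proof -
  define S where "S = (\<lambda>i j k. s [e i, e j, e k])"
  have S: "s [e i, e j, e k] = S i j k" for i j k by (simp add: S_def)
  have sw1: "S i j k = - S j i k" if "j < i" for i j k
    unfolding S_def by (rule alternating_3_rules(1)[OF s])
  have sw2: "S i j k = - S i k j" if "k < j" for i j k
    unfolding S_def by (rule alternating_3_rules(2)[OF s])
  have rep: "S i i k = 0" "S i k k = 0" for i k
    unfolding S_def by (rule alternating_3_rules[OF s])+
  have A2: "e i \<lrcorner> s \<in> Alt 2" for i using interior_Alt[of s 2] s by simp
  have A5: "(e i \<lrcorner> s) \<and>\<^sub>f s \<in> Alt 5" for i using wedge_Alt[OF A2 s] by simp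
  note [simp] = sw1 sw2 rep comps[unfolded g2_components_def S] and [simp del] = One_nat_def
  have "i \<in> {0, 1, 2, 3, 4, 5, 6}" "j \<in> {0, 1, 2, 3, 4, 5, 6}" using assms(3,4) by auto
  then show ?thesis
    unfolding wedge_assoc wedge_Alt_2_5[OF A2 A5] wedge_Alt_2_3[OF A2 s] interior_3_eval S
    by (elim insertE emptyE; hypsubst; simp)
qed

text \<open>The normal form is written in a Euclidean orthonormal frame. \<open>bform s v v\<close>
  times the constant \<open>std_vol ?E\<close> is 6 times a sum of squares; the constant is carried
  along because only nonvanishing matters.\<close>

lemma definite3_nonempty: "definite3 \<noteq> {}"
proof -
  have ip: "inner_product_on ((\<bullet>) :: V7 \<Rightarrow> V7 \<Rightarrow> real)"
    by (simp add: inner_product_on_def inner_commute bilinear_conv_bounded_bilinear bounded_bilinear_inner)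
  obtain es where es: "orthonormal_basis ((\<bullet>) :: V7 \<Rightarrow> V7 \<Rightarrow> real) es" using orthonormal_basis_ex[OF ip] by blast
  define e where "e = (!) es"
  have len: "length es = 7" using es by (simp add: orthonormal_basis_def)
  have on: "orthonormal_basis (\<bullet>) (map e [0..<7])"
    using es map_nth[of es] len by (simp add: e_def)
  have ee: "e i \<bullet> e j = (if i = j then 1 else 0)" if "i < 7" "j < 7" for i j
    using on that by (simp add: orthonormal_basis_def)
  define c where "c = (\<lambda>i j k. covectors [(\<bullet>) (e i), (\<bullet>) (e j), (\<bullet>) (e k)])"
  have "linear ((\<bullet>) v)" for v :: V7 by (rule linearI) (simp_all add: inner_add_right)
  then have c: "c i j k \<in> Alt 3" for i j k
    unfolding c_def using covectors_Alt[of "[(\<bullet>) (e i), (\<bullet>) (e j), (\<bullet>) (e k)]"]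
    by (auto simp: numeral_3_eq_3 simp del: covectors.simps)
  define s where "s = (\<lambda>us. c 0 1 2 us + c 0 3 4 us + c 0 5 6 us + c 1 3 5 us
    + -1 * c 1 4 6 us + -1 * c 2 3 6 us + -1 * c 2 4 5 us)"
  have s: "s \<in> Alt 3" unfolding s_def by (intro Alt_add Alt_scale c)
  have comps: "g2_components (\<lambda>i j k. s [e i, e j, e k])"
    unfolding g2_components_def s_def c_def covectors_3 by (simp add: ee del: One_nat_def)
  let ?E = "[e 0, e 1, e 2, e 3, e 4, e 5, e 6]"
  let ?Q = "\<lambda>v w. ((v \<lrcorner> s) \<and>\<^sub>f (w \<lrcorner> s) \<and>\<^sub>f s) ?E"
  have "?Q v w = bform s v w * std_vol ?E" for v w
    by (simp add: triple_wedge_eq[OF s])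
  then have prod: "bform s (e i) (e j) * std_vol ?E = (if i = j then 6 else 0)" if "i < 7" "j < 7" for i j
    using g2_components_products[OF s comps that] by metis
  have "bform s v v \<noteq> 0" if "v \<noteq> 0" for v
  proof -
    have "v = (\<Sum>x\<leftarrow>map e [0..<7]. (v \<bullet> x) *\<^sub>R x)" by (rule orthonormal_expansion[OF ip on])
    then have v: "v = (\<Sum>i<7. (v \<bullet> e i) *\<^sub>R e i)"
      by (simp add: o_def interv_sum_list_conv_sum_set_nat atLeast0LessThan)
    have "bform s v v = (\<Sum>i<7. (v \<bullet> e i) * bform s (e i) v)"
      by (subst (1) v) (simp only: linear_sum[OF bform_linear(1)[OF s]] linear_scale[OF bform_linear(1)[OF s]] real_scaleR_def)
    also have "\<dots> = (\<Sum>i<7. (v \<bullet> e i) * (\<Sum>j<7. (v \<bullet> e j) * bform s (e i) (e j)))"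
      by (subst (2) v) (simp only: linear_sum[OF bform_linear(2)[OF s]] linear_scale[OF bform_linear(2)[OF s]] real_scaleR_def)
    finally have "bform s v v * std_vol ?E
        = (\<Sum>i<7. (v \<bullet> e i) * (\<Sum>j<7. (v \<bullet> e j) * (bform s (e i) (e j) * std_vol ?E)))"
      by (simp only: sum_distrib_right mult.assoc)
    also have "\<dots> = (\<Sum>i<7. (v \<bullet> e i) * (\<Sum>j<7. (v \<bullet> e j) * (if i = j then 6 else 0)))"
      by (intro sum.cong arg_cong2[where f = "(*)"] refl prod) auto
    also have "\<dots> = (\<Sum>i<7. 6 * (v \<bullet> e i)\<^sup>2)"
      by (intro sum.cong) (auto simp: power2_eq_square if_distrib sum.delta cong: if_cong)
    finally have eq: "bform s v v * std_vol ?E = (\<Sum>i<7. 6 * (v \<bullet> e i)\<^sup>2)" .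
    obtain i where "i < 7" "v \<bullet> e i \<noteq> 0"
    proof (rule ccontr)
      assume "\<not> thesis"
      then have "\<And>i. i < 7 \<Longrightarrow> v \<bullet> e i = 0" using that by blast
      then show False using v \<open>v \<noteq> 0\<close> by simp
    qed
    then have "(\<Sum>i<7. 6 * (v \<bullet> e i)\<^sup>2) > 0" by (intro sum_pos2[of _ i]) auto
    then show ?thesis using eq by auto
  qed
  then have "s \<in> definite3" using s by (simp add: definite3_iff)
  then show ?thesis by auto
qed

section \<open>Components of forms on the model space\<close>

definition form3 :: "real^idx3 \<Rightarrow> V7 form" where
  "form3 S = (\<lambda>vs. \<Sum>I\<in>UNIV. S $ I * index_form (Rep_idx3 I) vs)"

definition form2 :: "real^idx2 \<Rightarrow> V7 form" where
  "form2 B = (\<lambda>vs. \<Sum>I\<in>UNIV. B $ I * index_form (Rep_idx2 I) vs)"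

lemma card_Rep: "card (Rep_idx3 I) = 3" "card (Rep_idx2 J) = 2"
  using Rep_idx3[of I] Rep_idx2[of J] by simp_all

lemma form3_Alt: "form3 S \<in> Alt 3" and form2_Alt: "form2 B \<in> Alt 2"
  unfolding form3_def form2_def
  by (intro Alt_sum Alt_scale; metis index_form_Alt card_Rep)+

lemma form3_basis: "form3 S (basis_vectors (Rep_idx3 I)) = S $ I"
  by (simp add: form3_def index_form_basis_vectors card_Rep Rep_idx3_inject if_distrib cong: if_cong)

lemma form2_basis: "form2 B (basis_vectors (Rep_idx2 I)) = B $ I"
  by (simp add: form2_def index_form_basis_vectors card_Rep Rep_idx2_inject if_distrib cong: if_cong)

lemma nths_std_frame:
  assumes "S \<subseteq> {..<7}"
  shows "\<exists>I. card I = card S \<and> nths std_frame S = basis_vectors I"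
proof -
  let ?L = "sorted_list_of_set (UNIV :: 7 set)"
  let ?I = "set (nths ?L S)"
  have "distinct (nths ?L S)" "sorted (nths ?L S)"
    by (simp_all add: distinct_nthsI sorted_nths)
  then have "sorted_list_of_set ?I = nths ?L S" "card ?I = length (nths ?L S)"
    by (simp_all add: sorted_list_of_set.idem_if_sorted_distinct distinct_card)
  moreover have "length (nths ?L S) = card S"
    using assms by (intro length_nths_subset) simp
  ultimately show ?thesis
    by (intro exI[of _ ?I]) (simp add: std_frame_def basis_vectors_def nths_map)
qed

lemma Alt_eq_on_basis:
  assumes "\<alpha> \<in> Alt k" "\<beta> \<in> Alt k" "\<And>I. card I = k \<Longrightarrow> \<alpha> (basis_vectors I) = \<beta> (basis_vectors I)"
  shows "\<alpha> = \<beta>"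
proof (rule Alt_eq_on_frame[OF assms(1,2) span_std_frame])
  fix S assume "S \<subseteq> {..<length std_frame}" "card S = k"
  then show "\<alpha> (nths std_frame S) = \<beta> (nths std_frame S)"
    using nths_std_frame[of S] assms(3) by auto
qed

lemma form3_components:
  assumes "s \<in> Alt 3"
  shows "form3 (\<chi> I. s (basis_vectors (Rep_idx3 I))) = s"
proof (rule Alt_eq_on_basis[OF form3_Alt assms])
  fix I :: "7 set" assume "card I = 3"
  then have "I = Rep_idx3 (Abs_idx3 I)" by (simp add: Abs_idx3_inverse)
  then show "form3 (\<chi> I. s (basis_vectors (Rep_idx3 I))) (basis_vectors I) = s (basis_vectors I)"
    using form3_basis[of _ "Abs_idx3 I"] by (metis vec_lambda_beta)
qed

lemma form2_components:
  assumes "b \<in> Alt 2"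
  shows "form2 (\<chi> I. b (basis_vectors (Rep_idx2 I))) = b"
proof (rule Alt_eq_on_basis[OF form2_Alt assms])
  fix I :: "7 set" assume "card I = 2"
  then have "I = Rep_idx2 (Abs_idx2 I)" by (simp add: Abs_idx2_inverse)
  then show "form2 (\<chi> I. b (basis_vectors (Rep_idx2 I))) (basis_vectors I) = b (basis_vectors I)"
    using form2_basis[of _ "Abs_idx2 I"] by (metis vec_lambda_beta)
qed

lemma differentiable_component:
  assumes "f differentiable at x" shows "(\<lambda>y. f y $ i) differentiable at x"
proof -
  obtain D where "(f has_derivative D) (at x)" using assms by (auto simp: differentiable_def)
  from bounded_linear.has_derivative[OF bounded_linear_vec_nth this, of i]
  show ?thesis by (auto simp: differentiable_def)
qed

lemma differentiable_fst_snd: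
  "(fst :: 'a::real_normed_vector \<times> 'b::real_normed_vector \<Rightarrow> 'a) differentiable at x"
  "(\<lambda>y :: 'a \<times> 'b \<times> 'c::real_normed_vector. fst (snd y)) differentiable at x'"
  "(\<lambda>y :: 'a \<times> 'b \<times> 'c. snd (snd y)) differentiable at x'"
  by (intro bounded_linear_imp_differentiable bounded_linear_intros)+

lemma differentiable_form3: "(\<lambda>y :: coords. form3 (fst (snd y)) us) differentiable at x"
  and differentiable_form2: "(\<lambda>y :: coords. form2 (snd (snd y)) us) differentiable at x"
  unfolding form3_def form2_def
  by (simp_all add: differentiable_component differentiable_fst_snd)

lemma pull_pull: "pull L (pull M \<alpha>) = pull (M \<circ> L) \<alpha>"
  by (simp add: pull_def)

lemma pull_id: "pull id \<alpha> = \<alpha>"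
  by (simp add: pull_def)

lemma frechet_derivative_eventually_cong:
  assumes "\<forall>\<^sub>F y in nhds x. f y = g y"
  shows "frechet_derivative f (at x) = frechet_derivative g (at x)"
proof -
  have *: "(f has_derivative D) (at x) \<Longrightarrow> (g has_derivative D) (at x)"
    if "\<forall>\<^sub>F y in nhds x. f y = g y" for f g :: "'a \<Rightarrow> 'b" and D
    using that eventually_nhds_x_imp_x[OF that]
    by (intro has_derivative_transform_eventually[of f D x UNIV g])
      (auto simp: eventually_at_filter elim: eventually_mono)
  have "\<forall>\<^sub>F y in nhds x. g y = f y" using assms by (rule eventually_mono) simp
  then have "(f has_derivative D) (at x) \<longleftrightarrow> (g has_derivative D) (at x)" for D
    using *[of f g D] *[of g f D] assms by blast
  then show ?thesis by (simp add: frechet_derivative_def)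
qed

lemma frechet_derivative_wedge:
  fixes \<alpha> \<beta> :: "'p::real_normed_vector \<Rightarrow> 'a form"
  assumes "\<And>us. (\<lambda>y. \<alpha> y us) differentiable at x" "\<And>us. (\<lambda>y. \<beta> y us) differentiable at x"
  shows "frechet_derivative (\<lambda>y. (\<alpha> y \<and>\<^sub>f \<beta> y) vs) (at x) v
    = ((\<lambda>us. frechet_derivative (\<lambda>y. \<alpha> y us) (at x) v) \<and>\<^sub>f \<beta> x) vs
      + (\<alpha> x \<and>\<^sub>f (\<lambda>us. frechet_derivative (\<lambda>y. \<beta> y us) (at x) v)) vs"
proof -
  let ?A = "\<lambda>us. frechet_derivative (\<lambda>y. \<alpha> y us) (at x)"
  let ?B = "\<lambda>us. frechet_derivative (\<lambda>y. \<beta> y us) (at x)"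
  let ?\<epsilon> = "\<lambda>S. (-1::real) ^ card {(i, j). i \<in> S \<and> j \<in> {..<length vs} - S \<and> j < i}"
  have A: "((\<lambda>y. \<alpha> y us) has_derivative ?A us) (at x)"
    and B: "((\<lambda>y. \<beta> y us) has_derivative ?B us) (at x)" for us
    using assms by (simp_all add: frechet_derivative_works[symmetric])
  have "((\<lambda>y. (\<alpha> y \<and>\<^sub>f \<beta> y) vs) has_derivative
    (\<lambda>v. \<Sum>S\<in>Pow {..<length vs}. ?\<epsilon> S * \<alpha> x (nths vs S) * ?B (nths vs ({..<length vs} - S)) v
      + ?\<epsilon> S * ?A (nths vs S) v * \<beta> x (nths vs ({..<length vs} - S)))) (at x)"
    unfolding wedge_def
    by (intro has_derivative_sum has_derivative_mult has_derivative_mult_right A B)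
  then have "frechet_derivative (\<lambda>y. (\<alpha> y \<and>\<^sub>f \<beta> y) vs) (at x)
    = (\<lambda>v. \<Sum>S\<in>Pow {..<length vs}. ?\<epsilon> S * \<alpha> x (nths vs S) * ?B (nths vs ({..<length vs} - S)) v
      + ?\<epsilon> S * ?A (nths vs S) v * \<beta> x (nths vs ({..<length vs} - S)))"
    by (rule frechet_derivative_at[symmetric])
  then show ?thesis by (simp add: wedge_def sum.distrib add.commute)
qed

section \<open>Charts of the base and of the bundle\<close>

definition transition :: "('p, 'e) chart \<Rightarrow> ('p, 'e) chart \<Rightarrow> 'e \<Rightarrow> 'e" where
  "transition c c' = chart_map c' \<circ> chart_inv c"

definition jacobian :: "('p, 'e::euclidean_space) chart \<Rightarrow> ('p, 'e) chart \<Rightarrow> 'p \<Rightarrow> 'e \<Rightarrow> 'e" where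
  "jacobian c c' p = frechet_derivative (transition c c') (at (chart_map c p))"

lemma tangent_of_coords_jacobian: "tangent_of_coords A c p = jacobian c (chart_at A p) p"
  by (simp add: tangent_of_coords_def jacobian_def transition_def)

lemma chart_at_props:
  assumes "p \<in> carrier A" shows "chart_at A p \<in> A" "p \<in> chart_dom (chart_at A p)"
proof -
  have "\<exists>c. c \<in> A \<and> p \<in> chart_dom c" using assms by (auto simp: carrier_def)
  from someI_ex[OF this] show "chart_at A p \<in> A" "p \<in> chart_dom (chart_at A p)"
    by (simp_all add: chart_at_def)
qed

lemma chart_map_inv: "u \<in> chart_image c \<Longrightarrow> chart_map c (chart_inv c u) = u"
  and chart_inv_dom: "u \<in> chart_image c \<Longrightarrow> chart_inv c u \<in> chart_dom c"
  by (simp_all add: chart_inv_def chart_image_def f_inv_into_f inv_into_into)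

text \<open>The inverse of the bundle chart over c: the components give forms in the coordinates of
  c, and the inverse coordinate change carries them to the fixed representation of the tangent
  space.\<close>

definition coords_point :: "('m, V7) chart set \<Rightarrow> ('m, V7) chart \<Rightarrow> coords \<Rightarrow> 'm point" where
  "coords_point A c y = (let m = chart_inv c (fst y); L = inv (tangent_of_coords A c m) in
     (m, pull L (form3 (fst (snd y))), pull L (form2 (snd (snd y)))))"

text \<open>This is the image of the bundle chart. Definiteness is invariant under linear
  isomorphisms, so it can be tested on the coordinates themselves.\<close>

definition coords_domain :: "('m, V7) chart \<Rightarrow> coords set" where
  "coords_domain c = {y. fst y \<in> chart_image c \<and> form3 (fst (snd y)) \<in> definite3}"

context
  fixes T :: "'m topology" and A :: "('m, real^7) chart set"
  assumes mfd: "smooth_manifold T A"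
begin

lemma chart_open: "c \<in> A \<Longrightarrow> open (chart_image c)"
  using mfd by (simp add: smooth_manifold_def)

lemma chart_homeomorphic:
  "c \<in> A \<Longrightarrow> homeomorphic_map (subtopology T (chart_dom c)) (top_of_set (chart_image c)) (chart_map c)"
  using mfd by (simp add: smooth_manifold_def)

lemma chart_topspace: "c \<in> A \<Longrightarrow> topspace (subtopology T (chart_dom c)) = chart_dom c"
  using mfd by (auto simp: smooth_manifold_def dest: openin_subset)

lemma chart_inj: "c \<in> A \<Longrightarrow> inj_on (chart_map c) (chart_dom c)"
  using homeomorphic_imp_injective_map[OF chart_homeomorphic] by (metis chart_topspace)

lemma chart_inv_map: "c \<in> A \<Longrightarrow> p \<in> chart_dom c \<Longrightarrow> chart_inv c (chart_map c p) = p"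
  by (simp add: chart_inv_def chart_inj)

lemma overlap_open:
  assumes "c \<in> A" "c' \<in> A"
  shows "open (chart_map c ` (chart_dom c \<inter> chart_dom c'))"
proof -
  have "openin T (chart_dom c')" using mfd assms(2) by (simp add: smooth_manifold_def)
  then have "openin (subtopology T (chart_dom c)) (chart_dom c \<inter> chart_dom c')"
    using openin_subtopology_Int2 by blast
  then have "openin (top_of_set (chart_image c)) (chart_map c ` (chart_dom c \<inter> chart_dom c'))"
    using homeomorphic_imp_open_map[OF chart_homeomorphic[OF assms(1)]] by (auto simp: open_map_def)
  then show ?thesis using chart_open[OF assms(1)] openin_open_trans by blast
qed

lemma transition_differentiable:
  assumes "c \<in> A" "c' \<in> A" "u \<in> chart_map c ` (chart_dom c \<inter> chart_dom c')"
  shows "transition c c' differentiable at u"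
    "(\<lambda>x. frechet_derivative (transition c c') (at x) v) differentiable at u"
proof -
  let ?O = "chart_map c ` (chart_dom c \<inter> chart_dom c')"
  have "smooth_on ?O (transition c c')"
    using mfd assms(1,2) by (simp add: smooth_manifold_def transition_def)
  \<comment> \<open>Two derivatives are extracted because the Jacobian of the base transition enters
    the bundle transition and has to be differentiable itself.\<close>
  then have "C_on (Suc (Suc 0)) (transition c c') ?O" unfolding smooth_on_def by blast
  then have "transition c c' differentiable_on ?O"
    "(\<lambda>x. frechet_derivative (transition c c') (at x) v) differentiable_on ?O" by simp_all
  then show "transition c c' differentiable at u"
    "(\<lambda>x. frechet_derivative (transition c c') (at x) v) differentiable at u"
    using assms(3) unfolding differentiable_on_def
    by (metis at_within_open[OF assms(3) overlap_open[OF assms(1,2)]])+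
qed

lemma jacobian_has_derivative:
  assumes "c \<in> A" "c' \<in> A" "p \<in> chart_dom c" "p \<in> chart_dom c'"
  shows "(transition c c' has_derivative jacobian c c' p) (at (chart_map c p))"
  unfolding jacobian_def using transition_differentiable(1)[OF assms(1,2)] assms(3,4)
  by (auto simp: frechet_derivative_works[symmetric])

lemma jacobian_linear:
  assumes "c \<in> A" "c' \<in> A" "p \<in> chart_dom c" "p \<in> chart_dom c'"
  shows "linear (jacobian c c' p)"
  using has_derivative_linear[OF jacobian_has_derivative[OF assms]] .

lemma transition_map:
  "c \<in> A \<Longrightarrow> p \<in> chart_dom c \<Longrightarrow> transition c c' (chart_map c p) = chart_map c' p"
  by (simp add: transition_def chart_inv_map)

lemma eventually_overlap:
  assumes "c \<in> A" "c' \<in> A" "p \<in> chart_dom c" "p \<in> chart_dom c'"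
  shows "\<forall>\<^sub>F u in nhds (chart_map c p). u \<in> chart_map c ` (chart_dom c \<inter> chart_dom c')"
  using assms by (intro eventually_nhds_in_open overlap_open) auto

lemma jacobian_comp:
  assumes "c \<in> A" "c' \<in> A" "c'' \<in> A" "p \<in> chart_dom c" "p \<in> chart_dom c'" "p \<in> chart_dom c''"
  shows "jacobian c' c'' p \<circ> jacobian c c' p = jacobian c c'' p"
proof -
  have "(transition c' c'' \<circ> transition c c' has_derivative jacobian c' c'' p \<circ> jacobian c c' p)
      (at (chart_map c p))"
    using jacobian_has_derivative[of c c' p] jacobian_has_derivative[of c' c'' p] assms
    by (intro diff_chain_at) (simp_all add: transition_map)
  moreover have "\<forall>\<^sub>F u in nhds (chart_map c p). (transition c' c'' \<circ> transition c c') u = transition c c'' u"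
    using eventually_overlap[OF assms(1,2,4,5)]
    by (rule eventually_mono) (auto simp: transition_map assms)
  ultimately show ?thesis
    unfolding jacobian_def[of c c'']
    by (simp only: frechet_derivative_at[symmetric] frechet_derivative_eventually_cong[symmetric])
qed

lemma jacobian_self:
  assumes "c \<in> A" "p \<in> chart_dom c"
  shows "jacobian c c p = id"
proof -
  have "\<forall>\<^sub>F u in nhds (chart_map c p). transition c c u = id u"
    using eventually_overlap[OF assms(1,1,2,2)] by (rule eventually_mono) (auto simp: transition_map assms)
  from frechet_derivative_eventually_cong[OF this] show ?thesis
    unfolding jacobian_def id_def by simp
qed

lemma jacobian_bij:
  assumes "c \<in> A" "c' \<in> A" "p \<in> chart_dom c" "p \<in> chart_dom c'"
  shows "bij (jacobian c c' p)"
  using jacobian_comp[of c c' c p] jacobian_comp[of c' c c' p] jacobian_self assms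
  by (metis o_bij)

lemma chart_dom_carrier: "c \<in> A \<Longrightarrow> p \<in> chart_dom c \<Longrightarrow> p \<in> carrier A"
  by (auto simp: carrier_def)

lemma toc_linear: "c \<in> A \<Longrightarrow> p \<in> chart_dom c \<Longrightarrow> linear (tangent_of_coords A c p)"
  and toc_bij: "c \<in> A \<Longrightarrow> p \<in> chart_dom c \<Longrightarrow> bij (tangent_of_coords A c p)"
  using chart_at_props[of p A]
  by (auto simp: tangent_of_coords_jacobian chart_dom_carrier intro: jacobian_linear jacobian_bij)

lemma toc_jacobian:
  assumes "c \<in> A" "c' \<in> A" "p \<in> chart_dom c" "p \<in> chart_dom c'"
  shows "tangent_of_coords A c' p \<circ> jacobian c c' p = tangent_of_coords A c p"
  unfolding tangent_of_coords_jacobian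
  using chart_at_props[OF chart_dom_carrier[OF assms(1,3)]] assms by (intro jacobian_comp) auto

lemma inv_toc:
  assumes "c \<in> A" "p \<in> chart_dom c"
  shows "linear (inv (tangent_of_coords A c p))" "bij (inv (tangent_of_coords A c p))"
    "inv (tangent_of_coords A c p) \<circ> tangent_of_coords A c p = id"
    "tangent_of_coords A c p \<circ> inv (tangent_of_coords A c p) = id"
  using toc_linear[OF assms] toc_bij[OF assms]
  by (auto simp: bij_imp_bij_inv inv_o_cancel bij_is_inj bij_is_surj surj_iff[symmetric]
      intro!: inj_linear_imp_inv_linear)

lemma coords_point_dom:
  assumes "c \<in> A" "y \<in> coords_domain c"
  shows "coords_point A c y \<in> chart_dom (X_chart A c)"
    "chart_map (X_chart A c) (coords_point A c y) = y"
proof -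
  let ?m = "chart_inv c (fst y)"
  have m: "?m \<in> chart_dom c" "chart_map c ?m = fst y" and d: "form3 (fst (snd y)) \<in> definite3"
    using assms(2) by (auto simp: coords_domain_def chart_inv_dom chart_map_inv)
  note L = inv_toc[OF assms(1) m(1)]
  show "coords_point A c y \<in> chart_dom (X_chart A c)"
    using m(1) chart_dom_carrier[OF assms(1) m(1)] definite3_pull[OF d L(1,2)] pull_Alt[OF L(1) form2_Alt]
    by (simp add: coords_point_def Let_def X_chart_def X_space_def)
  show "chart_map (X_chart A c) (coords_point A c y) = y"
    by (simp add: coords_point_def Let_def X_chart_def pull_pull L m(2) pull_id form3_basis form2_basis
        prod_eq_iff vec_eq_iff)
qed

lemma X_chart_map_in:
  assumes "c \<in> A" "x \<in> chart_dom (X_chart A c)"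
  shows "chart_map (X_chart A c) x \<in> coords_domain c"
    "coords_point A c (chart_map (X_chart A c) x) = x"
proof -
  obtain m s b where x: "x = (m, s, b)" by (cases x)
  have m: "m \<in> chart_dom c" and s: "s \<in> definite3" and b: "b \<in> Alt 2"
    using assms(2) by (auto simp: x X_chart_def X_space_def)
  let ?L = "tangent_of_coords A c m"
  note L = toc_linear[OF assms(1) m] toc_bij[OF assms(1) m]
  have map: "chart_map (X_chart A c) x = (chart_map c m,
      \<chi> I. pull ?L s (basis_vectors (Rep_idx3 I)), \<chi> I. pull ?L b (basis_vectors (Rep_idx2 I)))"
    by (simp add: x X_chart_def)
  have f: "form3 (fst (snd (chart_map (X_chart A c) x))) = pull ?L s"
    "form2 (snd (snd (chart_map (X_chart A c) x))) = pull ?L b"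
    unfolding map using form3_components[OF pull_Alt[OF L(1) definite3_Alt[OF s]]]
      form2_components[OF pull_Alt[OF L(1) b]] by simp_all
  show "chart_map (X_chart A c) x \<in> coords_domain c"
    using m definite3_pull[OF s L] by (simp add: coords_domain_def f) (simp add: map chart_image_def)
  have fst: "fst (chart_map (X_chart A c) x) = chart_map c m" by (simp add: map)
  have "coords_point A c (chart_map (X_chart A c) x) = (m, s, b)"
    unfolding coords_point_def Let_def f fst chart_inv_map[OF assms(1) m] pull_pull
      inv_toc[OF assms(1) m] pull_id ..
  then show "coords_point A c (chart_map (X_chart A c) x) = x" by (simp only: x)
qed

lemma X_chart_inv:
  assumes "c \<in> A" "y \<in> coords_domain c"
  shows "chart_inv (X_chart A c) y = coords_point A c y"
proof -
  have "inj_on (chart_map (X_chart A c)) (chart_dom (X_chart A c))"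
    by (rule inj_on_inverseI[of _ "coords_point A c"]) (rule X_chart_map_in(2)[OF assms(1)])
  from inv_into_f_f[OF this coords_point_dom(1)[OF assms]] show ?thesis
    by (simp add: chart_inv_def coords_point_dom(2)[OF assms])
qed

lemma eventually_coords_domain:
  assumes "c \<in> A" "y0 \<in> coords_domain c"
  shows "\<forall>\<^sub>F y in nhds y0. y \<in> coords_domain c"
proof -
  have "\<forall>\<^sub>F y in nhds y0. form3 (fst (snd y)) \<in> definite3"
    using assms(2) by (intro eventually_definite3 differentiable_form3) (auto simp: coords_domain_def form3_Alt)
  moreover have "\<forall>\<^sub>F y in nhds y0. fst y \<in> chart_image c"
  proof -
    have "(fst \<longlongrightarrow> fst y0) (nhds y0)" by (rule tendsto_fst[OF filterlim_ident])
    then show ?thesis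
      using chart_open[OF assms(1)] assms(2) by (auto simp: coords_domain_def dest: topological_tendstoD)
  qed
  ultimately show ?thesis by eventually_elim (simp add: coords_domain_def)
qed

end

section \<open>Tautological forms and their exterior derivatives in bundle coordinates\<close>

definition natural_form :: "(V7 form \<Rightarrow> V7 form \<Rightarrow> V7 form) \<Rightarrow> bool" where
  "natural_form F \<longleftrightarrow> (\<forall>s\<in>definite3. \<forall>b\<in>Alt 2. \<forall>L. linear L \<longrightarrow> bij L \<longrightarrow>
     F (pull L s) (pull L b) = pull L (F s b))"

text \<open>The local expression of a tautological form does not involve the chart of the base.\<close>

definition local_form :: "(V7 form \<Rightarrow> V7 form \<Rightarrow> V7 form) \<Rightarrow> coords \<Rightarrow> coords form" where
  "local_form F y = pull fst (F (form3 (fst (snd y))) (form2 (snd (snd y))))"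

definition local_deriv ::
  "(V7 form \<Rightarrow> V7 form \<Rightarrow> V7 form) \<Rightarrow> coords \<Rightarrow> coords \<Rightarrow> coords form" where
  "local_deriv F y v us = frechet_derivative (\<lambda>y. local_form F y us) (at y) v"

lemma differentiable_vec_lambda:
  fixes f :: "'i::finite \<Rightarrow> 'p::euclidean_space \<Rightarrow> real"
  assumes "\<And>i. f i differentiable at x"
  shows "(\<lambda>y. \<chi> i. f i y) differentiable at x"
  by (rule iffD2[OF differentiable_componentwise_within])
    (use assms in \<open>auto simp: Basis_vec_def inner_axis\<close>)

lemma carrier_X_atlas: "carrier (X_atlas A) = X_space A"
  by (auto simp: carrier_def X_atlas_def X_chart_def X_space_def)

context
  fixes T :: "'m topology" and A :: "('m, real^7) chart set"
  assumes mfd: "smooth_manifold T A"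
begin

text \<open>Fibre components transform by the Jacobian of the inverse base transition, so one
  derivative of the bundle transition costs two of the base transition. The result makes the
  \<open>frechet_derivative\<close> inside \<open>tangent_of_coords\<close> on the bundle a genuine
  derivative.\<close>

lemma X_transition_differentiable:
  assumes "c \<in> A" "c' \<in> A" "y0 \<in> coords_domain c" "chart_inv c (fst y0) \<in> chart_dom c'"
  shows "\<forall>\<^sub>F y in nhds y0. fst (transition (X_chart A c) (X_chart A c') y) = transition c c' (fst y)"
    and "transition (X_chart A c) (X_chart A c') differentiable at y0"
proof -
  let ?O = "chart_map c ` (chart_dom c \<inter> chart_dom c')"
  let ?h = "\<lambda>v y. frechet_derivative (transition c' c) (at (transition c c' (fst y))) v"
  let ?f = "\<lambda>y :: coords. (transition c c' (fst y),
      \<chi> I. form3 (fst (snd y)) (map (\<lambda>f. f y) (map ?h (basis_vectors (Rep_idx3 I)))),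
      \<chi> I. form2 (snd (snd y)) (map (\<lambda>f. f y) (map ?h (basis_vectors (Rep_idx2 I)))))"
  have y0: "chart_inv c (fst y0) \<in> chart_dom c" "chart_map c (chart_inv c (fst y0)) = fst y0"
    using assms(3) by (auto simp: coords_domain_def chart_inv_dom chart_map_inv)
  have "\<forall>\<^sub>F u in nhds (fst y0). u \<in> ?O"
    using eventually_overlap[OF mfd assms(1,2) y0(1) assms(4)] by (simp only: y0(2))
  then have "\<forall>\<^sub>F y in nhds y0. fst y \<in> ?O"
    using tendsto_fst[OF filterlim_ident, of y0] by (rule eventually_compose_filterlim)
  with eventually_coords_domain[OF mfd assms(1,3)]
  have ev: "\<forall>\<^sub>F y in nhds y0. y \<in> coords_domain c \<and> fst y \<in> ?O" by (rule eventually_conj)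
  have eq: "transition (X_chart A c) (X_chart A c') y = ?f y" if y: "y \<in> coords_domain c \<and> fst y \<in> ?O" for y
  proof -
    let ?m = "chart_inv c (fst y)"
    have m: "?m \<in> chart_dom c" "?m \<in> chart_dom c'"
      using y chart_inv_map[OF mfd assms(1)] by auto
    have "inv (tangent_of_coords A c ?m) \<circ> tangent_of_coords A c' ?m
        = (inv (tangent_of_coords A c ?m) \<circ> tangent_of_coords A c ?m) \<circ> jacobian c' c ?m"
      using toc_jacobian[OF mfd assms(2,1) m(2,1)] by (simp add: comp_assoc)
    then have J: "inv (tangent_of_coords A c ?m) \<circ> tangent_of_coords A c' ?m = jacobian c' c ?m"
      using inv_toc(3)[OF mfd assms(1) m(1)] by simp
    have "jacobian c' c ?m v = ?h v y" for v
      by (simp add: jacobian_def transition_def[of c c'])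
    then have "map (jacobian c' c ?m) vs = map (\<lambda>f. f y) (map ?h vs)" for vs by simp
    then have pull: "pull (jacobian c' c ?m) \<alpha> vs = \<alpha> (map (\<lambda>f. f y) (map ?h vs))" for \<alpha> vs
      unfolding pull_def by (rule arg_cong)
    have "transition (X_chart A c) (X_chart A c') y = chart_map (X_chart A c') (coords_point A c y)"
      using y by (simp only: transition_def comp_apply X_chart_inv[OF mfd assms(1)])
    also have "\<dots> = (chart_map c' ?m,
        \<chi> I. pull (jacobian c' c ?m) (form3 (fst (snd y))) (basis_vectors (Rep_idx3 I)),
        \<chi> I. pull (jacobian c' c ?m) (form2 (snd (snd y))) (basis_vectors (Rep_idx2 I)))"
      by (simp add: coords_point_def Let_def X_chart_def pull_pull J)
    also have "chart_map c' ?m = transition c c' (fst y)" by (simp add: transition_def)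
    finally show ?thesis by (simp only: pull)
  qed
  show "\<forall>\<^sub>F y in nhds y0. fst (transition (X_chart A c) (X_chart A c') y) = transition c c' (fst y)"
    using ev by (rule eventually_mono) (simp add: eq)
  have tr: "(\<lambda>y :: coords. transition c c' (fst y)) differentiable at y0"
    by (rule differentiable_compose[OF transition_differentiable(1)[OF mfd assms(1,2)]])
      (use y0 assms(4) in \<open>auto simp: image_iff differentiable_fst_snd intro!: bexI[of _ "chart_inv c (fst y0)"]\<close>)
  have "transition c c' (fst y0) \<in> chart_map c' ` (chart_dom c' \<inter> chart_dom c)"
    using y0 assms(4) by (auto simp: transition_def)
  then have h: "?h v differentiable at y0" for v
    using differentiable_compose[OF transition_differentiable(2)[OF mfd assms(2,1)] tr] by blast
  have h': "f differentiable at y0" if "f \<in> set (map ?h vs)" for f vs using that h by auto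
  have "(\<lambda>y :: coords. form3 (fst (snd y)) (map (\<lambda>f. f y) (map ?h vs))) differentiable at y0"
    "(\<lambda>y :: coords. form2 (snd (snd y)) (map (\<lambda>f. f y) (map ?h vs))) differentiable at y0" for vs
    by (rule differentiable_args[OF differentiable_form3 Alt_alternating[OF form3_Alt]], erule h',
        rule differentiable_args[OF differentiable_form2 Alt_alternating[OF form2_Alt]], erule h')
  then have "?f differentiable at y0"
    using tr by (intro differentiable_Pair differentiable_vec_lambda)
  moreover have "\<forall>\<^sub>F y in nhds y0. transition (X_chart A c) (X_chart A c') y = ?f y"
    using ev by (rule eventually_mono) (rule eq)
  ultimately show "transition (X_chart A c) (X_chart A c') differentiable at y0"
    by (intro differentiable_eventually_cong[of "transition (X_chart A c) (X_chart A c')" ?f])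
qed

lemma chart_at_X:
  assumes "x \<in> X_space A"
  obtains c where "c \<in> A" "chart_at (X_atlas A) x = X_chart A c" "x \<in> chart_dom (X_chart A c)"
    "base x \<in> chart_dom c"
proof -
  have p: "chart_at (X_atlas A) x \<in> X_atlas A" "x \<in> chart_dom (chart_at (X_atlas A) x)"
    using chart_at_props[of x "X_atlas A"] assms by (simp_all add: carrier_X_atlas)
  then obtain c where "c \<in> A" "chart_at (X_atlas A) x = X_chart A c" by (auto simp: X_atlas_def)
  moreover from this p(2) have "x \<in> chart_dom (X_chart A c)" by simp
  moreover from this have "base x \<in> chart_dom c" by (simp add: X_chart_def)
  ultimately show ?thesis by (rule that)
qed

lemma tangent_map_base:
  assumes "x \<in> X_space A" "c \<in> A" "chart_at (X_atlas A) x = X_chart A c" "x \<in> chart_dom (X_chart A c)"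
  shows "tangent_map (X_atlas A) A base x = tangent_of_coords A c (base x) \<circ> fst"
proof -
  let ?y = "chart_map (X_chart A c) x"
  let ?c1 = "chart_at A (base x)"
  have m: "base x \<in> chart_dom c" and fst_y: "fst ?y = chart_map c (base x)"
    using assms(4) by (auto simp: X_chart_def split: prod.splits)
  note c1 = chart_at_props[OF chart_dom_carrier[OF mfd assms(2) m]]
  have "\<forall>\<^sub>F y in nhds ?y. (chart_map ?c1 \<circ> base \<circ> chart_inv (X_chart A c)) y = (transition c ?c1 \<circ> fst) y"
    using eventually_coords_domain[OF mfd assms(2) X_chart_map_in(1)[OF mfd assms(2,4)]]
    by (rule eventually_mono)
      (simp add: X_chart_inv[OF mfd assms(2)] coords_point_def Let_def transition_def)
  moreover have "(transition c ?c1 \<circ> fst has_derivative jacobian c ?c1 (base x) \<circ> fst) (at ?y)"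
    using jacobian_has_derivative[OF mfd assms(2) c1(1) m c1(2)]
    by (intro diff_chain_at) (auto simp: fst_y intro: bounded_linear_imp_has_derivative bounded_linear_fst)
  ultimately show ?thesis
    unfolding tangent_map_def assms(3) tangent_of_coords_jacobian
    by (simp only: frechet_derivative_eventually_cong frechet_derivative_at[symmetric])
qed

text \<open>By the chain rule the projection has differential \<open>fst\<close> in the bundle
  coordinates over c, whichever chart \<open>chart_at\<close> has selected at x.\<close>

lemma tangent_map_toc:
  assumes "c \<in> A" "x \<in> chart_dom (X_chart A c)"
  shows "tangent_map (X_atlas A) A base x \<circ> tangent_of_coords (X_atlas A) (X_chart A c) x
    = tangent_of_coords A c (base x) \<circ> fst"
proof -
  have x: "x \<in> X_space A" and m: "base x \<in> chart_dom c"
    and fst_y: "fst (chart_map (X_chart A c) x) = chart_map c (base x)"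
    using assms(2) by (auto simp: X_chart_def split: prod.splits)
  let ?y = "chart_map (X_chart A c) x"
  obtain c2 where c2: "c2 \<in> A" "chart_at (X_atlas A) x = X_chart A c2" "x \<in> chart_dom (X_chart A c2)"
      "base x \<in> chart_dom c2"
    using chart_at_X[OF x] .
  note y = X_chart_map_in(1)[OF mfd assms]
  have inv: "chart_inv c (fst ?y) = base x" by (simp add: fst_y chart_inv_map[OF mfd assms(1) m])
  note tr = X_transition_differentiable[OF assms(1) c2(1) y, unfolded inv, OF c2(4)]
  let ?D = "tangent_of_coords (X_atlas A) (X_chart A c) x"
  have "(transition (X_chart A c) (X_chart A c2) has_derivative ?D) (at ?y)"
    using tr(2) unfolding tangent_of_coords_jacobian jacobian_def c2(2)
    by (simp add: frechet_derivative_works[symmetric])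
  then have "((\<lambda>y. fst (transition (X_chart A c) (X_chart A c2) y)) has_derivative (\<lambda>v. fst (?D v))) (at ?y)"
    by (rule has_derivative_fst)
  moreover have "(transition c c2 \<circ> fst has_derivative jacobian c c2 (base x) \<circ> fst) (at ?y)"
    using jacobian_has_derivative[OF mfd assms(1) c2(1) m c2(4)]
    by (intro diff_chain_at) (auto simp: fst_y intro: bounded_linear_imp_has_derivative bounded_linear_fst)
  ultimately have "(\<lambda>v. fst (?D v)) = jacobian c c2 (base x) \<circ> fst"
    using frechet_derivative_eventually_cong[OF tr(1)] frechet_derivative_at
    by (metis (no_types, lifting) comp_apply ext)
  then have "fst (?D v) = jacobian c c2 (base x) (fst v)" for v by (metis comp_apply)
  then show ?thesis
    using toc_jacobian[OF mfd assms(1) c2(1) m c2(4)]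
    by (simp add: tangent_map_base[OF x c2(1-3)] fun_eq_iff)
qed

text \<open>The coordinate change in \<open>coords_point\<close> and the one in the pullback are
  inverse to each other, and equivariance of F moves them next to each other so that they
  cancel.\<close>

lemma pull_tautological:
  assumes "natural_form F" "c \<in> A" "y \<in> coords_domain c"
  shows "(case coords_point A c y of (m, s, b) \<Rightarrow> pull (tangent_of_coords A c m \<circ> fst) (F s b)) = local_form F y"
proof -
  let ?m = "chart_inv c (fst y)"
  let ?L = "tangent_of_coords A c ?m"
  have m: "?m \<in> chart_dom c" and d: "form3 (fst (snd y)) \<in> definite3"
    using assms(3) by (auto simp: coords_domain_def chart_inv_dom)
  note L = inv_toc[OF mfd assms(2) m]
  have "pull ?L (F (pull (inv ?L) (form3 (fst (snd y)))) (pull (inv ?L) (form2 (snd (snd y)))))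
      = F (form3 (fst (snd y))) (form2 (snd (snd y)))"
    using assms(1) d form2_Alt L by (simp add: natural_form_def pull_pull pull_id)
  then show ?thesis
    by (simp add: coords_point_def Let_def local_form_def pull_pull[symmetric])
qed

lemma form_in_chart_tautological:
  assumes "natural_form F" "c \<in> A" "y \<in> coords_domain c"
  shows "form_in_chart (X_atlas A) (X_chart A c) (tautological A F) y = local_form F y"
proof -
  note x = coords_point_dom(1)[OF mfd assms(2,3)]
  have "coords_point A c y \<in> X_space A" using x by (auto simp: X_chart_def)
  then show ?thesis
    using pull_tautological[OF assms] tangent_map_toc[OF assms(2) x]
    by (auto simp: form_in_chart_def X_chart_inv[OF mfd assms(2,3)] tautological_def pull_pull
        split: prod.splits)
qed

lemma tautological_own_chart:
  assumes "natural_form F" "x \<in> X_space A" "c \<in> A" "chart_at (X_atlas A) x = X_chart A c"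
    "x \<in> chart_dom (X_chart A c)"
  shows "tautological A F x = local_form F (chart_map (X_chart A c) x)"
  using pull_tautological[OF assms(1,3) X_chart_map_in(1)[OF mfd assms(3,5)]] assms(2)
  by (auto simp: tautological_def tangent_map_base[OF assms(2-5)] X_chart_map_in(2)[OF mfd assms(3,5)]
      split: prod.splits)

text \<open>The chart expression agrees with \<open>local_form\<close> on
  \<open>coords_domain c\<close>; this set is a neighbourhood of the point, so the derivatives agree
  as well.\<close>

lemma ext_d_tautological:
  assumes "natural_form F" "x \<in> X_space A" "c \<in> A" "chart_at (X_atlas A) x = X_chart A c"
    "x \<in> chart_dom (X_chart A c)"
  shows "ext_d (X_atlas A) (tautological A F) x vs
    = antisym_deriv (local_deriv F (chart_map (X_chart A c) x)) vs"
proof -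
  let ?y = "chart_map (X_chart A c) x"
  have "frechet_derivative (\<lambda>y. form_in_chart (X_atlas A) (X_chart A c) (tautological A F) y us) (at ?y)
      = frechet_derivative (\<lambda>y. local_form F y us) (at ?y)" for us
    using eventually_coords_domain[OF mfd assms(3) X_chart_map_in(1)[OF mfd assms(3,5)]]
    by (intro frechet_derivative_eventually_cong, elim eventually_mono)
      (simp add: form_in_chart_tautological[OF assms(1,3)])
  then show ?thesis
    using assms(2) by (simp add: ext_d_def carrier_X_atlas assms(4) antisym_deriv_def local_deriv_def)
qed

end

section \<open>The obstruction\<close>

lemma natural_forms:
  "natural_form (\<lambda>s b. s)" "natural_form (\<lambda>s b. b)" "natural_form (\<lambda>s b. star s s)"
  "natural_form (\<lambda>s b. star s b)" "natural_form zform" "natural_form (\<lambda>s b. star s unit_form)"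
proof -
  have "pull L unit_form = unit_form" for L :: "V7 \<Rightarrow> V7"
    by (simp add: pull_def unit_form_def fun_eq_iff)
  then show "natural_form (\<lambda>s b. star s unit_form)"
    using star_pull[OF _ unit_form_Alt] by (simp add: natural_form_def)
qed (simp_all add: natural_form_def star_pull[OF _ definite3_Alt] star_pull zform_pull)

lemma local_form_eval: "local_form F y us = F (form3 (fst (snd y))) (form2 (snd (snd y))) (map fst us)"
  by (simp add: local_form_def pull_def)

lemma local_form_differentiable:
  assumes "form3 (fst (snd y)) \<in> definite3"
  shows "(\<lambda>y. local_form (\<lambda>s b. s) y us) differentiable at y"
    "(\<lambda>y. local_form (\<lambda>s b. b) y us) differentiable at y"
    "(\<lambda>y. local_form (\<lambda>s b. star s s) y us) differentiable at y"
    "(\<lambda>y. local_form zform y us) differentiable at y"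
  unfolding local_form_eval
  using assms differentiable_form3 differentiable_form2
    differentiable_star[of "\<lambda>y. form3 (fst (snd y))" y "\<lambda>y. form3 (fst (snd y))" 3]
    differentiable_zform[of "\<lambda>y. form3 (fst (snd y))" y "\<lambda>y. form2 (snd (snd y))"]
  by (simp_all add: form3_Alt form2_Alt)

lemma frechet_derivative_diff:
  assumes "f differentiable at x" "h differentiable at x"
  shows "frechet_derivative (\<lambda>y. f y - h y) (at x) v
    = frechet_derivative f (at x) v - frechet_derivative h (at x) v"
  using has_derivative_diff[OF assms[unfolded frechet_derivative_works], THEN frechet_derivative_at]
  by (simp add: fun_eq_iff)

lemma local_deriv_wedge:
  assumes "\<And>us. (\<lambda>y. local_form F y us) differentiable at y"
    "\<And>us. (\<lambda>y. local_form H y us) differentiable at y"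
  shows "frechet_derivative (\<lambda>y. (local_form F y \<and>\<^sub>f local_form H y) us) (at y) v
    = (local_deriv F y v \<and>\<^sub>f local_form H y) us + (local_form F y \<and>\<^sub>f local_deriv H y v) us"
  unfolding local_deriv_def[abs_def] by (rule frechet_derivative_wedge[OF assms])

lemma local_form_star_b:
  assumes "form3 (fst (snd y)) \<in> definite3"
  shows "local_form (\<lambda>s b. star s b) y us
    = (local_form zform y \<and>\<^sub>f local_form (\<lambda>s b. star s s) y) us
      - (local_form (\<lambda>s b. b) y \<and>\<^sub>f local_form (\<lambda>s b. s) y) us"
  using star_add_wedge[OF assms form2_Alt, of "snd (snd y)" "map fst us"]
  unfolding local_form_def pull_wedge[symmetric] by (simp add: pull_def)

lemma local_form_Alt:
  assumes "form3 (fst (snd y)) \<in> definite3"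
  shows "local_form (\<lambda>s b. s) y \<in> Alt 3" "local_form (\<lambda>s b. b) y \<in> Alt 2"
    "local_form zform y \<in> Alt 1"
proof -
  have "star (form3 (fst (snd y))) (form3 (fst (snd y))) \<in> Alt 4"
    using star_Alt[OF assms form3_Alt] by simp
  then have "zform (form3 (fst (snd y))) (form2 (snd (snd y))) \<in> Alt 1"
    using star_Alt[OF assms wedge_Alt[OF form2_Alt, of _ 4]] by (simp add: zform_def)
  then show "local_form (\<lambda>s b. s) y \<in> Alt 3" "local_form (\<lambda>s b. b) y \<in> Alt 2"
    "local_form zform y \<in> Alt 1"
    unfolding local_form_def by (intro pull_Alt form3_Alt form2_Alt linear_fst; assumption)+
qed

text \<open>The differentials are known only on arguments from E. They may still be substituted
  inside wedge products, whose factors are evaluated only on sublists of \<open>vs\<close>.\<close>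

lemma integral_element_obstruction:
  fixes y :: coords
  defines "d F \<equiv> antisym_deriv (local_deriv F y)"
  assumes def: "form3 (fst (snd y)) \<in> definite3"
    and db: "\<And>vs. set vs \<subseteq> E \<Longrightarrow> d (\<lambda>s b. b) vs = lam * local_form (\<lambda>s b. s) y vs"
    and ds: "\<And>vs. set vs \<subseteq> E \<Longrightarrow> d (\<lambda>s b. s) vs = 0"
    and dt: "\<And>vs. set vs \<subseteq> E \<Longrightarrow> d (\<lambda>s b. star s s) vs
      = - 2 / 3 * local_form (\<lambda>s b. star s b) y vs
        + 1 / 3 * (local_form (\<lambda>s b. b) y \<and>\<^sub>f local_form (\<lambda>s b. s) y) vs"
    and dp: "\<And>vs. set vs \<subseteq> E \<Longrightarrow> d (\<lambda>s b. star s b) vs = 0"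
    and dz: "\<And>vs. set vs \<subseteq> E \<Longrightarrow> d zform vs = 0"
    and vs: "set vs \<subseteq> E"
  shows "(local_form zform y \<and>\<^sub>f (local_form (\<lambda>s b. b) y \<and>\<^sub>f local_form (\<lambda>s b. s) y)) vs = 0"
proof -
  let ?s = "\<lambda>s b :: V7 form. s :: V7 form" and ?b = "\<lambda>s b :: V7 form. b"
    and ?t = "\<lambda>s b :: V7 form. star s s" and ?p = "\<lambda>s b. star s b"
  let ?l = "\<lambda>F. local_form F y"
  note diff = local_form_differentiable[OF def] and Alt = local_form_Alt[OF def]
  note wd = local_deriv_wedge[OF diff(4,3)] local_deriv_wedge[OF diff(2,1)]
  have "\<forall>\<^sub>F y in nhds y. form3 (fst (snd y)) \<in> definite3"
    by (intro eventually_definite3 differentiable_form3 form3_Alt def)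
  \<comment> \<open>Since the identity is to be differentiated, it is needed on a whole
    neighbourhood of y and not just at y.\<close>
  then have ev: "\<forall>\<^sub>F y in nhds y. local_form ?p y us
      = (local_form zform y \<and>\<^sub>f local_form ?t y) us - (local_form ?b y \<and>\<^sub>f local_form ?s y) us" for us
    by (rule eventually_mono) (rule local_form_star_b)
  have "local_deriv ?p y v us
      = frechet_derivative (\<lambda>y. (local_form zform y \<and>\<^sub>f local_form ?t y) us) (at y) v
        - frechet_derivative (\<lambda>y. (local_form ?b y \<and>\<^sub>f local_form ?s y) us) (at y) v" for v us
    unfolding local_deriv_def frechet_derivative_eventually_cong[OF ev]
    by (rule frechet_derivative_diff) (intro differentiable_wedge diff)+
  then have "local_deriv ?p y = (\<lambda>v us.
      ((local_deriv zform y v \<and>\<^sub>f ?l ?t) us + (?l zform \<and>\<^sub>f local_deriv ?t y v) us)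
      - ((local_deriv ?b y v \<and>\<^sub>f ?l ?s) us + (?l ?b \<and>\<^sub>f local_deriv ?s y v) us))"
    by (intro ext) (simp only: wd)
  then have "d ?p vs = ((d zform \<and>\<^sub>f ?l ?t) vs + (hat (?l zform) \<and>\<^sub>f d ?t) vs)
      - ((d ?b \<and>\<^sub>f ?l ?s) vs + (hat (?l ?b) \<and>\<^sub>f d ?s) vs)"
    unfolding d_def
    by (simp only: antisym_deriv_diff antisym_deriv_add antisym_deriv_wedge_left
        antisym_deriv_wedge_right)
  moreover have "(d zform \<and>\<^sub>f ?l ?t) vs = 0"
    by (rule wedge_eq_0_left) (use dz vs in auto)
  moreover have "(hat (?l ?b) \<and>\<^sub>f d ?s) vs = 0"
    by (rule wedge_eq_0_right) (use ds vs in auto)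
  moreover have "(d ?b \<and>\<^sub>f ?l ?s) vs = 0"
  proof -
    have "(d ?b \<and>\<^sub>f ?l ?s) vs = ((\<lambda>us. lam * ?l ?s us) \<and>\<^sub>f ?l ?s) vs"
      by (rule wedge_cong_on) (use db vs in auto)
    also have "\<dots> = 0" using wedge_self_odd[OF Alt(1)] by (simp add: wedge_scale_left)
    finally show ?thesis .
  qed
  moreover have "(hat (?l zform) \<and>\<^sub>f d ?t) vs = - (?l zform \<and>\<^sub>f (?l ?b \<and>\<^sub>f ?l ?s)) vs"
  proof -
    have "hat (?l zform) = (\<lambda>us. - ?l zform us)" using hat_Alt[OF Alt(3)] by simp
    then have "(hat (?l zform) \<and>\<^sub>f d ?t) vs = - (?l zform \<and>\<^sub>f d ?t) vs"
      by (simp add: wedge_uminus_left)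
    \<comment> \<open>Eliminating star b from \<open>dt\<close> leaves the coefficient 2/3 + 1/3 = 1
      at the product of b and s. The remaining term is killed by the square of the 1-form z.\<close>
    also have "(?l zform \<and>\<^sub>f d ?t) vs = (?l zform \<and>\<^sub>f
        (\<lambda>us. (?l ?b \<and>\<^sub>f ?l ?s) us + (- 2 / 3) * (?l zform \<and>\<^sub>f ?l ?t) us)) vs"
      by (rule wedge_cong_on) (use dt vs local_form_star_b[OF def] in \<open>auto simp: algebra_simps\<close>)
    also have "\<dots> = (?l zform \<and>\<^sub>f (?l ?b \<and>\<^sub>f ?l ?s)) vs"
    proof -
      have "?l zform \<and>\<^sub>f (?l zform \<and>\<^sub>f ?l ?t) = (\<lambda>us. 0)"
        using wedge_self_odd[OF Alt(3)] by (simp flip: wedge_assoc)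
      then show ?thesis by (simp only: wedge_add_right wedge_scale_right mult_zero_right add_0_right)
    qed
    finally show ?thesis .
  qed
  ultimately show ?thesis using dp[OF vs] by simp
qed

lemma map_linear_preimage:
  assumes "linear f" "subspace E" "set vs \<subseteq> E" "span (f ` set vs) = UNIV"
  shows "\<exists>ws. set ws \<subseteq> E \<and> map f ws = us"
proof -
  have "span (f ` set vs) \<subseteq> f ` E"
    by (rule span_minimal[OF image_mono[OF assms(3)] linear_subspace_image[OF assms(1,2)]])
  then have "f ` E = UNIV" by (simp only: assms(4) top_unique)
  then have "\<exists>w. w \<in> E \<and> f w = u" for u by (metis UNIV_I imageE)
  then obtain h where "\<And>u. h u \<in> E" "\<And>u. f (h u) = u" by metis
  then show ?thesis by (intro exI[of _ "map h us"]) (auto simp: o_def)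
qed

lemma no_admissible_integral_element:
  fixes T :: "'m topology" and A :: "('m, real^7) chart set"
  assumes mfd: "smooth_manifold T A" and x: "(m, s, b) \<in> X_space A"
    and nz: "zform s b \<and>\<^sub>f b \<and>\<^sub>f s \<noteq> zero_form"
  shows "\<not> admissible (X_atlas A) (augmented_ideal A lam) (omega_form A) 7 (m, s, b) E"
proof
  let ?x = "(m, s, b)"
  let ?I = "augmented_ideal A lam"
  assume adm: "admissible (X_atlas A) ?I (omega_form A) 7 ?x E"
  then have E: "subspace E" and int: "\<And>\<theta> vs. \<theta> \<in> ?I \<Longrightarrow> set vs \<subseteq> E \<Longrightarrow> \<theta> ?x vs = 0"
    by (auto simp: admissible_def integral_element_def)
  obtain c where c: "c \<in> A" "chart_at (X_atlas A) ?x = X_chart A c" "?x \<in> chart_dom (X_chart A c)"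
    using chart_at_X[OF mfd x] by metis
  define y where "y = chart_map (X_chart A c) ?x"
  have y: "y \<in> coords_domain c" unfolding y_def by (rule X_chart_map_in(1)[OF mfd c(1,3)])
  then have def: "form3 (fst (snd y)) \<in> definite3" by (simp add: coords_domain_def)
  have val: "tautological A F ?x = local_form F y" if "natural_form F" for F
    unfolding y_def by (rule tautological_own_chart[OF mfd that x c])
  have ext: "ext_d (X_atlas A) (tautological A F) ?x = antisym_deriv (local_deriv F y)"
    if "natural_form F" for F
    using ext_d_tautological[OF mfd that x c] by (simp add: y_def fun_eq_iff)
  note val' = natural_forms[THEN val] and ext' = natural_forms[THEN ext]
  \<comment> \<open>The five generators of the augmented ideal contain all the information about E
    that the obstruction uses.\<close>
  have gens: "\<theta> ?x vs = 0" if "\<theta> \<in> {Upsilon3 A lam, Upsilon4 A, Upsilon5 A, Upsilon6 A,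
      ext_d (X_atlas A) (z_form A)}" "set vs \<subseteq> E" for \<theta> vs
    using that int[of \<theta> vs] unfolding augmented_ideal_def I_ideal_def
    by (auto intro: differential_ideal.gen algebraic_ideal.gen)
  have zero: "(local_form zform y \<and>\<^sub>f (local_form (\<lambda>s b. b) y \<and>\<^sub>f local_form (\<lambda>s b. s) y)) vs = 0"
    if "set vs \<subseteq> E" for vs
  proof (rule integral_element_obstruction[OF def, where E = E and lam = lam])
    fix vs assume vs: "set vs \<subseteq> E"
    show "antisym_deriv (local_deriv (\<lambda>s b. b) y) vs = lam * local_form (\<lambda>s b. s) y vs"
      using gens[OF _ vs, of "Upsilon3 A lam"] by (simp add: Upsilon3_def b_form_def s_form_def val' ext')
    show "antisym_deriv (local_deriv (\<lambda>s b. s) y) vs = 0"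
      using gens[OF _ vs, of "Upsilon4 A"] by (simp add: Upsilon4_def s_form_def ext')
    show "antisym_deriv (local_deriv (\<lambda>s b. star s s) y) vs
        = - 2 / 3 * local_form (\<lambda>s b. star s b) y vs
          + 1 / 3 * (local_form (\<lambda>s b. b) y \<and>\<^sub>f local_form (\<lambda>s b. s) y) vs"
      using gens[OF _ vs, of "Upsilon5 A"]
      by (simp add: Upsilon5_def s_form_def b_form_def t_form_def p_form_def dwedge_def val' ext')
    show "antisym_deriv (local_deriv (\<lambda>s b. star s b) y) vs = 0"
      using gens[OF _ vs, of "Upsilon6 A"] by (simp add: Upsilon6_def p_form_def ext')
    show "antisym_deriv (local_deriv zform y) vs = 0"
      using gens[OF _ vs, of "ext_d (X_atlas A) (z_form A)"] by (simp add: z_form_def ext')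
  qed (rule that)
  let ?\<xi> = "zform (form3 (fst (snd y))) (form2 (snd (snd y))) \<and>\<^sub>f
    (form2 (snd (snd y)) \<and>\<^sub>f form3 (fst (snd y)))"
  have \<xi>: "?\<xi> (map fst vs) = 0" if "set vs \<subseteq> E" for vs
    using zero[OF that] unfolding local_form_def pull_wedge[symmetric] by (simp add: pull_def)
  obtain vs where vs: "set vs \<subseteq> E" "omega_form A ?x vs \<noteq> 0"
    using adm by (auto simp: admissible_def)
  \<comment> \<open>The top-degree form is nonzero on the projected vectors, so they span the model
    space. Every argument list of the six-form therefore lifts to E, where the six-form
    vanishes.\<close>
  have "star (form3 (fst (snd y))) unit_form \<in> Alt DIM(V7)"
    using star_Alt[OF def unit_form_Alt] by simp
  moreover have "star (form3 (fst (snd y))) unit_form (map fst vs) \<noteq> 0"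
    using vs(2) by (simp add: omega_form_def val' local_form_eval)
  ultimately have "span (fst ` set vs) = UNIV"
    using Alt_nonzero_span by fastforce
  then have "?\<xi> us = 0" for us
    using map_linear_preimage[OF linear_fst E vs(1), of us] \<xi> by auto
  then have \<xi>0: "?\<xi> = zero_form" by (simp add: zero_form_def fun_eq_iff)
  let ?L = "tangent_of_coords A c m"
  have m: "m \<in> chart_dom c" and sb: "s \<in> definite3" "b \<in> Alt 2"
    using c(3) by (auto simp: X_chart_def X_space_def)
  note L = toc_linear[OF mfd c(1) m] toc_bij[OF mfd c(1) m]
  have f: "form3 (fst (snd y)) = pull ?L s" "form2 (snd (snd y)) = pull ?L b"
    using form3_components[OF pull_Alt[OF L(1) definite3_Alt[OF sb(1)]]]
      form2_components[OF pull_Alt[OF L(1) sb(2)]] by (simp_all add: y_def X_chart_def)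
  \<comment> \<open>So far the six-form vanishes in the coordinates of c; equivariance identifies it
    with the pullback of the six-form of (s, b) by the isomorphism \<open>?L\<close>, which is then
    undone.\<close>
  have "pull ?L (zform s b \<and>\<^sub>f b \<and>\<^sub>f s) = zero_form"
    using \<xi>0 unfolding f zform_pull[OF sb L] pull_wedge[symmetric] wedge_assoc .
  then have "pull (inv ?L) (pull ?L (zform s b \<and>\<^sub>f b \<and>\<^sub>f s)) = zero_form"
    by (simp add: pull_def zero_form_def)
  then show False
    using nz inv_toc(4)[OF mfd c(1) m] by (simp add: pull_pull pull_id)
qed

theorem mainTheorem3:
  fixes T :: "'m topology" and A :: "('m, real^7) chart set" and lam :: real
  assumes "smooth_manifold T A" and "topspace T \<noteq> {}"
  shows "(\<forall>m s b. (m, s, b) \<in> X_space A \<longrightarrow> zform s b \<and>\<^sub>f b \<and>\<^sub>f s \<noteq> zero_form \<longrightarrow>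
            \<not> (\<exists>E. admissible (X_atlas A) (augmented_ideal A lam) (omega_form A) 7 (m, s, b) E))
       \<and> \<not> involutive (X_atlas A) (augmented_ideal A lam) (omega_form A) 7"
proof (intro conjI allI impI notI)
  fix m s b
  assume "(m, s, b) \<in> X_space A" "zform s b \<and>\<^sub>f b \<and>\<^sub>f s \<noteq> zero_form"
    "\<exists>E. admissible (X_atlas A) (augmented_ideal A lam) (omega_form A) 7 (m, s, b) E"
  then show False using no_admissible_integral_element[OF assms(1)] by blast
next
  assume inv: "involutive (X_atlas A) (augmented_ideal A lam) (omega_form A) 7"
  \<comment> \<open>Involutivity demands an admissible element at every point of X, so a single
    point with nonzero six-form refutes it. A point m of the nonempty base is taken to carry such a
    pair.\<close>
  have "carrier A = topspace T" using assms(1) by (simp add: smooth_manifold_def carrier_def)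
  then obtain m where "m \<in> carrier A" using assms(2) by blast
  moreover obtain s where "s \<in> definite3" using definite3_nonempty by blast
  moreover obtain b where "b \<in> Alt 2" and nz: "zform s b \<and>\<^sub>f b \<and>\<^sub>f s \<noteq> zero_form"
    using exists_nonzero_six_form[OF \<open>s \<in> definite3\<close>] by blast
  ultimately have x: "(m, s, b) \<in> X_space A" by (simp add: X_space_def)
  then have "\<exists>E. admissible (X_atlas A) (augmented_ideal A lam) (omega_form A) 7 (m, s, b) E"
    using inv unfolding involutive_def carrier_X_atlas by blast
  then show False using no_admissible_integral_element[OF assms(1) x nz] by blast
qed

end
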